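(* Let $m_0\in\mathcal{M}(\mathbb{T})$ and $y_0=\Phi m_0$. Assume that there exists a solution to $\mathcal{D}_0(y_0)$ and that $\eta_0''(x)\neq0$ for some $x\in\operatorname{Ext}(m_0)$. Then for every $\epsilon>0$ small enough, there exist $\alpha>0$ and $\lambda_0>0$ such that for all $(\lambda,w)\in D_{\alpha,\lambda_0}$ and every solution $\tilde m_\lambda$ of $\mathcal{P}_\lambda(y_0+w)$, the restriction of $\tilde m_\lambda$ to $(x-\epsilon,x+\epsilon)$ is - either the null measure, - or of the form $\tilde a_{\lambda,w}\delta_{\tilde x_{\lambda,w}}$, where $\operatorname{sign}\tilde a_{\lambda,w}=\eta_0(x)$ and $\tilde x_{\lambda,w}\in(x-\epsilon,x+\epsilon)$. If, in addition, $m_0$ is identifiable and $|m_0|((x-\epsilon,x+\epsilon))\neq0$, only the second case may happen.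
   Context: $\mathbb{T}=\mathbb{R}/\mathbb{Z}$. $\mathcal{M}(\mathbb{T})$ is the space of real Radon measures on $\mathbb{T}$ and $\|m\|_{TV}=\sup\{\int\psi\,dm:\psi\in C(\mathbb{T}),\|\psi\|_\infty\le1\}$. Fix a real-valued $\varphi\in C^2(\mathbb{T})$ and let $\Phi:\mathcal{M}(\mathbb{T})\to L^2(\mathbb{T})$, $(\Phi m)(t)=\int_{\mathbb{T}}\varphi(x-t)\,dm(x)$, with adjoint $\Phi^*:L^2(\mathbb{T})\to C(\mathbb{T})$, $(\Phi^*p)(t)=\int_{\mathbb{T}}\varphi(t-x)p(x)\,dx$. For $y\in L^2(\mathbb{T})$: for $\lambda>0$, $\mathcal{P}_\lambda(y)$ is the problem $\min_{m\in\mathcal{M}(\mathbb{T})}\frac12\|\Phi m-y\|_2^2+\lambda\|m\|_{TV}$; $\mathcal{P}_0(y)$ is $\min_{\Phi m=y}\|m\|_{TV}$; $\mathcal{D}_0(y)$ is $\sup\{\langle y,p\rangle:p\in L^2(\mathbb{T}),\ \|\Phi^*p\|_\infty\le1\}$. $D_{\alpha,\lambda_0}=\{(\lambda,w)\in\mathbb{R}_+\times L^2(\mathbb{T}):0\le\lambda\le\lambda_0,\ \|w\|_2\le\alpha\lambda\}$. The minimal norm certificate is $\eta_0=\Phi^*p_0$, where $p_0$ is the solution of $\mathcal{D}_0(y_0)$ of minimal $L^2$ norm. The extended support of $m_0$ is $\operatorname{Ext}(m_0)=\{t\in\mathbb{T}:\eta_0(t)=\pm1\}$. The measure $m_0$ is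 identifiable if it is the unique solution of $\mathcal{P}_0(y_0)$ with $y_0=\Phi m_0$. *)

theory Defs
  imports "HOL-Analysis.Analysis"
begin

section \<open>The circle \<open>\<real>/\<int>\<close>\<close>

quotient_type circle = real / "\<lambda>x y::real. x - y \<in> \<int>"
  morphisms rep_circle circ
proof (rule equivpI)
  show "reflp (\<lambda>x y::real. x - y \<in> \<int>)"
    by (simp add: reflp_def)
  show "symp (\<lambda>x y::real. x - y \<in> \<int>)"
    by (metis (no_types, lifting) sympI minus_diff_eq minus_in_Ints_iff)
  show "transp (\<lambda>x y::real. x - y \<in> \<int>)"
  proof (rule transpI)
    fix x y z :: real
    assume "x - y \<in> \<int>" "y - z \<in> \<int>"
    then have "(x - y) + (y - z) \<in> \<int>" by (rule Ints_add)
    then show "x - z \<in> \<int>" by simp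
  qed
qed

instantiation circle :: ab_group_add
begin

lift_definition zero_circle :: circle is "0 :: real" .

lift_definition plus_circle :: "circle \<Rightarrow> circle \<Rightarrow> circle" is "(+)"
proof -
  fix a b c d :: real
  assume "a - b \<in> \<int>" "c - d \<in> \<int>"
  then have "(a - b) + (c - d) \<in> \<int>" by (rule Ints_add)
  then show "(a + c) - (b + d) \<in> \<int>" by (simp add: algebra_simps)
qed

lift_definition uminus_circle :: "circle \<Rightarrow> circle" is "uminus"
proof -
  fix a b :: real
  assume "a - b \<in> \<int>"
  then have "- (a - b) \<in> \<int>" by (rule Ints_minus)
  then show "(- a) - (- b) \<in> \<int>" by simp
qed

lift_definition minus_circle :: "circle \<Rightarrow> circle \<Rightarrow> circle" is "(-)"
proof -
  fix a b c d :: real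
  assume "a - b \<in> \<int>" "c - d \<in> \<int>"
  then have "(a - b) - (c - d) \<in> \<int>" by (rule Ints_diff)
  then show "(a - c) - (b - d) \<in> \<int>" by (simp add: algebra_simps)
qed

instance
  by standard (transfer, simp)+

end

text \<open>Distance of a real number to the nearest integer.\<close>

definition int_dist :: "real \<Rightarrow> real"
  where "int_dist s = min (frac s) (1 - frac s)"

lemma int_dist_le: "int_dist s \<le> \<bar>s - of_int k\<bar>"
proof (cases "k \<le> \<lfloor>s\<rfloor>")
  case True
  then have "frac s \<le> s - of_int k" by (simp add: frac_def)
  then show ?thesis by (simp add: int_dist_def)
next
  case False
  then have "of_int (\<lfloor>s\<rfloor> + 1) \<le> (of_int k :: real)"
    by (simp only: of_int_le_iff)
  then have "1 - frac s \<le> of_int k - s" by (simp add: frac_def)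
  then show ?thesis by (simp add: int_dist_def)
qed

lemma int_dist_attained: "\<exists>k. int_dist s = \<bar>s - of_int k\<bar>"
proof (cases "frac s \<le> 1 - frac s")
  case True
  then have "int_dist s = \<bar>s - of_int \<lfloor>s\<rfloor>\<bar>"
    using frac_ge_0[of s] by (simp add: int_dist_def frac_def)
  then show ?thesis ..
next
  case False
  then have "int_dist s = \<bar>s - of_int (\<lfloor>s\<rfloor> + 1)\<bar>"
    using frac_lt_1[of s] by (simp add: int_dist_def frac_def)
  then show ?thesis ..
qed

lemma int_dist_cong:
  assumes "s - t \<in> \<int>"
  shows "int_dist s = int_dist t"
proof -
  obtain k where "s - t = of_int k" using assms by (auto elim: Ints_cases)
  then have "s = t + of_int k" by simp
  then have "frac s = frac t" by (simp add: frac_def)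
  then show ?thesis by (simp add: int_dist_def)
qed

instantiation circle :: metric_space
begin

lift_definition dist_circle :: "circle \<Rightarrow> circle \<Rightarrow> real" is "\<lambda>x y. int_dist (x - y)"
proof (rule int_dist_cong)
  fix a b c d :: real
  assume "a - b \<in> \<int>" "c - d \<in> \<int>"
  then have "(a - b) - (c - d) \<in> \<int>" by (rule Ints_diff)
  then show "(a - c) - (b - d) \<in> \<int>" by (simp add: algebra_simps)
qed

definition uniformity_circle :: "(circle \<times> circle) filter"
  where "uniformity_circle = (INF e\<in>{0 <..}. principal {(x, y). dist x y < e})"

definition open_circle :: "circle set \<Rightarrow> bool"
  where "open_circle U \<longleftrightarrow> (\<forall>x\<in>U. \<forall>\<^sub>F (x', y) in uniformity. x' = x \<longrightarrow> y \<in> U)"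

instance
proof
  show "uniformity = (INF e\<in>{0 <..}. principal {(x :: circle, y). dist x y < e})"
    by (rule uniformity_circle_def)
  show "open U \<longleftrightarrow> (\<forall>x\<in>U. \<forall>\<^sub>F (x', y) in uniformity. x' = x \<longrightarrow> y \<in> U)" for U :: "circle set"
    by (rule open_circle_def)
  show "dist x y = 0 \<longleftrightarrow> x = y" for x y :: circle
  proof transfer
    fix x y :: real
    show "int_dist (x - y) = 0 \<longleftrightarrow> x - y \<in> \<int>"
    proof
      assume "int_dist (x - y) = 0"
      then obtain k where "x - y = of_int k" using int_dist_attained[of "x - y"] by auto
      then show "x - y \<in> \<int>" by simp
    next
      assume "x - y \<in> \<int>"
      then have "frac (x - y) = 0" by (simp only: frac_eq_0_iff)
      then show "int_dist (x - y) = 0" unfolding int_dist_def \<open>frac (x - y) = 0\<close> by simp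
    qed
  qed
  show "dist x y \<le> dist x z + dist y z" for x y z :: circle
  proof transfer
    fix x y z :: real
    obtain j where j: "int_dist (x - z) = \<bar>x - z - of_int j\<bar>" using int_dist_attained by blast
    obtain k where k: "int_dist (y - z) = \<bar>y - z - of_int k\<bar>" using int_dist_attained by blast
    have "int_dist (x - y) \<le> \<bar>x - y - of_int (j - k)\<bar>" by (rule int_dist_le)
    then show "int_dist (x - y) \<le> int_dist (x - z) + int_dist (y - z)"
      unfolding j k by simp
  qed
qed

end

lemma dist_circ_le: "dist (circ s) (circ t) \<le> dist s t"
  using int_dist_le[of "s - t" 0] by (simp add: dist_circle.abs_eq dist_real_def)

lemma continuous_on_circ [continuous_intros]: "continuous_on A circ"
  unfolding continuous_on_iff by (meson dist_circ_le le_less_trans)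

lemma measurable_circ [measurable]: "circ \<in> borel_measurable borel"
  by (rule borel_measurable_continuous_onI) (rule continuous_on_circ)

definition haar :: "circle measure"
  where "haar = distr (restrict_space lborel {0..<1}) borel circ"

text \<open>The open arc \<open>(x - \<epsilon>, x + \<epsilon>)\<close>.\<close>

definition arc_around :: "circle \<Rightarrow> real \<Rightarrow> circle set"
  where "arc_around x \<epsilon> = (\<lambda>s. x + circ s) ` {-\<epsilon><..<\<epsilon>}"

definition circle_deriv :: "(circle \<Rightarrow> real) \<Rightarrow> circle \<Rightarrow> real"
  where "circle_deriv f x = deriv (\<lambda>s::real. f (x + circ s)) 0"

definition circle_differentiable :: "(circle \<Rightarrow> real) \<Rightarrow> bool"
  where "circle_differentiable f \<longleftrightarrow> (\<forall>x. (\<lambda>s::real. f (x + circ s)) field_differentiable at 0)"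

definition C2_circle :: "(circle \<Rightarrow> real) \<Rightarrow> bool"
  where "C2_circle f \<longleftrightarrow>
    circle_differentiable f \<and> circle_differentiable (circle_deriv f) \<and>
    continuous_on UNIV (circle_deriv (circle_deriv f))"


section \<open>Real Radon measures on the circle\<close>

text \<open>
  On the compact metric space \<open>\<real>/\<int>\<close> every finite signed Borel measure is regular, so the real
  Radon measures are the countably additive real set functions on the Borel sets. Set functions
  are total in HOL; the value \<open>0\<close> outside the Borel sets makes equality of set functions coincide
  with equality of measures.
\<close>

definition radon_measures :: "(circle set \<Rightarrow> real) set"
  where "radon_measures = {m.
    (\<forall>A. A \<notin> sets borel \<longrightarrow> m A = 0) \<and>
    (\<forall>A :: nat \<Rightarrow> circle set. range A \<subseteq> sets borel \<longrightarrow> disjoint_family A \<longrightarrow>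
      (\<lambda>i. m (A i)) sums m (\<Union>i. A i))}"

text \<open>
  The Jordan decomposition: \<open>m\<^sup>+(A)\<close> is the supremum of \<open>m(B)\<close> over the Borel sets \<open>B \<subseteq> A\<close>. Here
  \<open>ennreal\<close> truncates negative values to \<open>0\<close>, which is harmless since \<open>B = {}\<close> is allowed.
\<close>

definition pos_part :: "(circle set \<Rightarrow> real) \<Rightarrow> circle measure"
  where "pos_part m = measure_of UNIV (sets borel)
    (\<lambda>A. SUP B\<in>{B \<in> sets borel. B \<subseteq> A}. ennreal (m B))"

definition neg_part :: "(circle set \<Rightarrow> real) \<Rightarrow> circle measure"
  where "neg_part m = pos_part (\<lambda>A. - m A)"

definition total_variation :: "(circle set \<Rightarrow> real) \<Rightarrow> circle set \<Rightarrow> real"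
  where "total_variation m A = measure (pos_part m) A + measure (neg_part m) A"

definition signed_integral :: "(circle set \<Rightarrow> real) \<Rightarrow> (circle \<Rightarrow> real) \<Rightarrow> real"
  where "signed_integral m f = (LINT x|pos_part m. f x) - (LINT x|neg_part m. f x)"

definition tv_norm :: "(circle set \<Rightarrow> real) \<Rightarrow> real"
  where "tv_norm m =
    (SUP \<psi>\<in>{\<psi>. continuous_on UNIV \<psi> \<and> (\<forall>x. \<bar>\<psi> x\<bar> \<le> 1)}. signed_integral m \<psi>)"

definition null_radon :: "circle set \<Rightarrow> real"
  where "null_radon = (\<lambda>A. 0)"

definition scaled_dirac :: "real \<Rightarrow> circle \<Rightarrow> circle set \<Rightarrow> real"
  where "scaled_dirac a x = (\<lambda>A. if A \<in> sets borel \<and> x \<in> A then a else 0)"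

definition restrict_radon :: "(circle set \<Rightarrow> real) \<Rightarrow> circle set \<Rightarrow> circle set \<Rightarrow> real"
  where "restrict_radon m I = (\<lambda>A. if A \<in> sets borel then m (A \<inter> I) else 0)"


section \<open>The space \<open>L\<^sup>2\<close>\<close>

text \<open>
  Elements of \<open>L\<^sup>2\<close> are represented by square-integrable functions; equality in \<open>L\<^sup>2\<close> is equality
  almost everywhere.
\<close>

definition L2 :: "(circle \<Rightarrow> real) set"
  where "L2 = {f \<in> borel_measurable haar. integrable haar (\<lambda>x. (f x)\<^sup>2)}"

definition L2_inner :: "(circle \<Rightarrow> real) \<Rightarrow> (circle \<Rightarrow> real) \<Rightarrow> real"
  where "L2_inner f g = (LINT x|haar. f x * g x)"

definition L2_norm :: "(circle \<Rightarrow> real) \<Rightarrow> real"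
  where "L2_norm f = sqrt (L2_inner f f)"


section \<open>The convolution operator and the variational problems\<close>

definition Phi :: "(circle \<Rightarrow> real) \<Rightarrow> (circle set \<Rightarrow> real) \<Rightarrow> circle \<Rightarrow> real"
  where "Phi \<phi> m = (\<lambda>t. signed_integral m (\<lambda>x. \<phi> (x - t)))"

definition Phi_adj :: "(circle \<Rightarrow> real) \<Rightarrow> (circle \<Rightarrow> real) \<Rightarrow> circle \<Rightarrow> real"
  where "Phi_adj \<phi> p = (\<lambda>t. LINT x|haar. \<phi> (t - x) * p x)"

definition P_objective ::
    "(circle \<Rightarrow> real) \<Rightarrow> real \<Rightarrow> (circle \<Rightarrow> real) \<Rightarrow> (circle set \<Rightarrow> real) \<Rightarrow> real"
  where "P_objective \<phi> lam y m =
    1 / 2 * (L2_norm (\<lambda>t. Phi \<phi> m t - y t))\<^sup>2 + lam * tv_norm m"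

definition P0_feasible :: "(circle \<Rightarrow> real) \<Rightarrow> (circle \<Rightarrow> real) \<Rightarrow> (circle set \<Rightarrow> real) set"
  where "P0_feasible \<phi> y = {m \<in> radon_measures. AE t in haar. Phi \<phi> m t = y t}"

definition P_solution ::
    "(circle \<Rightarrow> real) \<Rightarrow> real \<Rightarrow> (circle \<Rightarrow> real) \<Rightarrow> (circle set \<Rightarrow> real) \<Rightarrow> bool"
  where "P_solution \<phi> lam y m \<longleftrightarrow>
    (if lam = 0
     then m \<in> P0_feasible \<phi> y \<and> (\<forall>m'\<in>P0_feasible \<phi> y. tv_norm m \<le> tv_norm m')
     else m \<in> radon_measures \<and>
       (\<forall>m'\<in>radon_measures. P_objective \<phi> lam y m \<le> P_objective \<phi> lam y m'))"

definition D0_feasible :: "(circle \<Rightarrow> real) \<Rightarrow> (circle \<Rightarrow> real) set"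
  where "D0_feasible \<phi> = {p \<in> L2. \<forall>t. \<bar>Phi_adj \<phi> p t\<bar> \<le> 1}"

definition D0_solution :: "(circle \<Rightarrow> real) \<Rightarrow> (circle \<Rightarrow> real) \<Rightarrow> (circle \<Rightarrow> real) \<Rightarrow> bool"
  where "D0_solution \<phi> y p \<longleftrightarrow>
    p \<in> D0_feasible \<phi> \<and> (\<forall>q\<in>D0_feasible \<phi>. L2_inner y q \<le> L2_inner y p)"

definition D0_min_norm_solution ::
    "(circle \<Rightarrow> real) \<Rightarrow> (circle \<Rightarrow> real) \<Rightarrow> (circle \<Rightarrow> real) \<Rightarrow> bool"
  where "D0_min_norm_solution \<phi> y p \<longleftrightarrow>
    D0_solution \<phi> y p \<and> (\<forall>q. D0_solution \<phi> y q \<longrightarrow> L2_norm p \<le> L2_norm q)"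

text \<open>
  The solution of minimal norm is unique in \<open>L\<^sup>2\<close>, hence only almost everywhere as a function;
  its image under \<open>Phi_adj \<phi>\<close> does not depend on the chosen representative.
\<close>

definition min_norm_certificate :: "(circle \<Rightarrow> real) \<Rightarrow> (circle \<Rightarrow> real) \<Rightarrow> circle \<Rightarrow> real"
  where "min_norm_certificate \<phi> y = Phi_adj \<phi> (SOME p. D0_min_norm_solution \<phi> y p)"

definition extended_support :: "(circle \<Rightarrow> real) \<Rightarrow> (circle set \<Rightarrow> real) \<Rightarrow> circle set"
  where "extended_support \<phi> m0 =
    {t. min_norm_certificate \<phi> (Phi \<phi> m0) t = 1 \<or> min_norm_certificate \<phi> (Phi \<phi> m0) t = - 1}"

definition identifiable :: "(circle \<Rightarrow> real) \<Rightarrow> (circle set \<Rightarrow> real) \<Rightarrow> bool"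
  where "identifiable \<phi> m0 \<longleftrightarrow> (\<forall>m. P_solution \<phi> 0 (Phi \<phi> m0) m \<longleftrightarrow> m = m0)"

definition noise_domain :: "real \<Rightarrow> real \<Rightarrow> (real \<times> (circle \<Rightarrow> real)) set"
  where "noise_domain \<alpha> lam0 =
    {(lam, w). 0 \<le> lam \<and> lam \<le> lam0 \<and> w \<in> L2 \<and> L2_norm w \<le> \<alpha> * lam}"

end

theory Submission
  imports Defs "HOL-Probability.Helly_Selection" "HOL-Probability.Giry_Monad"
begin

text \<open>
  For \<open>\<lambda> > 0\<close> a solution \<open>m\<close> of the penalised problem yields the dual variable \<open>p = (y\<^sub>0 + w - \<Phi> m) / \<lambda>\<close>,
  the projection of \<open>(y\<^sub>0 + w) / \<lambda>\<close> onto \<open>{p. \<bar>\<Phi>\<^sup>* p\<bar> \<le> 1}\<close>, and \<open>m\<close> is carried by the points where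
  \<open>\<eta> = \<Phi>\<^sup>* p\<close> is \<open>\<plusminus>1\<close>. As \<open>\<lambda> \<rightarrow> 0\<close> with \<open>\<parallel>w\<parallel> \<le> \<alpha> \<lambda>\<close>, the variable \<open>p\<close> comes close to the minimal norm
  solution \<open>p\<^sub>0\<close>, so \<open>\<eta>\<close> and \<open>\<eta>''\<close> are uniformly close to those of the certificate. Near \<open>x\<close> the function \<open>\<eta>\<close>
  then has constant sign and \<open>\<eta>'' \<noteq> 0\<close>; since \<open>\<eta>' = 0\<close> wherever \<open>\<bar>\<eta>\<bar> = 1\<close>, there is at most one saturation point.
  For \<open>\<lambda> = 0\<close> the same argument applies to \<open>p\<^sub>0\<close> itself because there is no duality gap. If \<open>m\<^sub>0\<close> is identifiable,
  weak limits of solutions equal \<open>m\<^sub>0\<close>, so the solutions cannot vanish on an arc charged by \<open>m\<^sub>0\<close>.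

  Closeness of \<open>p\<close> to \<open>p\<^sub>0\<close> is obtained without weak compactness in \<open>L\<^sup>2\<close>: both lie almost at the minimal distance
  from \<open>0\<close> in the convex set of almost optimal feasible points, and the parallelogram law applies.
\<close>

section \<open>Topology and calculus on the circle\<close>

text \<open>Of the projection property a single inequality is used: since \<open>lam * p\<close> is
  \<open>y0 + w - Phi \<phi> m\<close>, weak duality gives <Phi m, p0> \<le> |m| = <Phi m, p>. It
  bounds the norm of p by |p0| + 2 \<alpha> and makes p almost optimal for the dual problem.
  Smallness of \<alpha> matters because w / \<lambda> may have norm \<alpha> however small \<lambda>
  is. What weak compactness in the Hilbert space would provide is that the least norm among almost
  optimal feasible points tends to |p0|; \<open>L2_nested_convex\<close> gives this and also the
  existence of p0. For measures, weak compactness is really used: the case \<lambda> = 0 brings no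
  dual variable of its own, so saturation by p0 has to come from limits of penalised solutions. The
  arc radius and the tolerance \<delta> depend on the certificate alone, and \<alpha> depends on
  \<delta>; only the bound on \<lambda> that excludes null restrictions depends on \<epsilon>. For
  that bound a nonzero variation of m0 on the arc is not enough, since the mass could cancel in an
  integral; the noise-free case first shows that m0 is itself a single spike there.\<close>

lemma circ_rep_circle [simp]: "circ (rep_circle c) = c"
  by (rule Quotient3_abs_rep[OF Quotient3_circle])

lemma circ_eq_iff: "circ s = circ t \<longleftrightarrow> s - t \<in> \<int>"
  by (rule circle.abs_eq_iff)

lemma circ_add: "circ (s + t) = circ s + circ t"
  by (simp add: plus_circle.abs_eq)

lemma circ_0: "circ 0 = 0"
  by (simp add: zero_circle.abs_eq)

lemma circ_frac: "circ (frac s) = circ s"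
  unfolding circ_eq_iff by (simp add: frac_def)

lemma circle_eq_circ_frac: "\<exists>s. 0 \<le> s \<and> s < 1 \<and> c = circ s"
  by (metis circ_frac circ_rep_circle frac_ge_0 frac_lt_1)

lemma compact_UNIV_circle: "compact (UNIV :: circle set)"
proof -
  have "UNIV = circ ` {0..1}"
    using circle_eq_circ_frac by (force simp: image_iff)
  then show ?thesis
    using compact_continuous_image[OF continuous_on_circ compact_Icc, of 0 1] by simp
qed

text \<open>This class gives access to inner regularity by compact sets and to the identification of
  the Borel sets of a product with the product sigma-algebra.\<close>

instance circle :: polish_space
proof
  show "convergent X" if "Cauchy X" for X :: "nat \<Rightarrow> circle"
    using compact_imp_complete[OF compact_UNIV_circle] that
    by (auto simp: complete_def convergent_def)
next
  let ?B = "(\<lambda>(q, r). ball (circ q) r) ` (\<rat> \<times> \<rat>)"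
  have "topological_basis ?B"
  proof (rule topological_basisI)
    show "open B'" if "B' \<in> ?B" for B'
      using that by auto
  next
    fix U :: "circle set" and c assume "open U" "c \<in> U"
    then obtain e where e: "e > 0" "ball c e \<subseteq> U"
      using openE by blast
    obtain r where r: "r \<in> \<rat>" "0 < r" "r < e / 2"
      using Rats_dense_in_real[of 0 "e/2"] e by auto
    obtain s where s: "c = circ s"
      using circle_eq_circ_frac by blast
    obtain q where q: "q \<in> \<rat>" "s < q" "q < s + r"
      using Rats_dense_in_real[of s "s + r"] r by auto
    have d: "dist (circ q) c < r"
      using dist_circ_le[of q s] q by (simp add: s dist_real_def)
    have "ball (circ q) r \<subseteq> ball c e"
    proof
      fix d' assume "d' \<in> ball (circ q) r"
      then show "d' \<in> ball c e"
        using dist_triangle[of c d' "circ q"] d r by (simp add: dist_commute)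
    qed
    then show "\<exists>B'\<in>?B. c \<in> B' \<and> B' \<subseteq> U"
      using e(2) d q(1) r(1) by (intro bexI[of _ "ball (circ q) r"]) auto
  qed
  moreover have "countable ?B"
    by (intro countable_image countable_SIGMA countable_rat)
  ultimately show "\<exists>B::circle set set. countable B \<and> open = generate_topology B"
    by (intro exI[of _ ?B]) (simp add: topological_basis_imp_subbasis)
qed

section \<open>Invariance of the metric, arcs and balls\<close>

lemma dist_circle_translate: "dist (a + c) (b + c) = dist a (b :: circle)"
  by transfer simp

lemma dist_circle_reflect: "dist (c - a) (c - b) = dist a (b :: circle)"
proof -
  have "dist (c - a) (c - b) = dist b a"
    by transfer (simp add: algebra_simps)
  then show ?thesis by (simp add: dist_commute)
qed

lemma dist_circle_minus_le: "dist (a - b) (c - d) \<le> dist a c + dist b (d :: circle)"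
proof -
  have "dist (a - b) (c - d) \<le> dist (a - b) (c - b) + dist (c - b) (c - d)"
    by (rule dist_triangle)
  then show ?thesis
    using dist_circle_translate[of a "- b" c] dist_circle_reflect[of c b d] by simp
qed

text \<open>Subtracting the nearest integer from a difference of representatives leaves a signed
  displacement h of the right length. Metric statements can then be read along a real
  parameter.\<close>

lemma dist_circle_eq: "\<exists>h. d = c + circ h \<and> dist c d = \<bar>h\<bar>"
proof -
  obtain s t where st: "c = circ s" "d = circ t"
    using circle_eq_circ_frac by metis
  obtain k where k: "int_dist (t - s) = \<bar>t - s - of_int k\<bar>"
    using int_dist_attained by blast
  have "d = c + circ (t - s - of_int k)"
    unfolding st circ_add[symmetric] circ_eq_iff by simp
  moreover have "dist c d = \<bar>t - s - of_int k\<bar>"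
    using k unfolding st by (subst dist_commute) (simp add: dist_circle.abs_eq)
  ultimately show ?thesis by blast
qed

lemma dist_add_circ_le: "dist c (c + circ h) \<le> \<bar>h\<bar>"
proof -
  have "dist c (c + circ h) = dist (circ 0) (circ h)"
    using dist_circle_translate[of 0 c "circ h"] by (simp add: add.commute circ_0)
  also have "\<dots> \<le> \<bar>h\<bar>"
    using dist_circ_le[of 0 h] by (simp add: dist_real_def)
  finally show ?thesis .
qed

lemma continuous_on_minus_circle [continuous_intros]:
  fixes f g :: "'a::topological_space \<Rightarrow> circle"
  assumes "continuous_on A f" "continuous_on A g"
  shows "continuous_on A (\<lambda>x. f x - g x)"
  unfolding continuous_on_def
proof (intro ballI tendstoI)
  fix x e assume x: "x \<in> A" and e: "(e::real) > 0"
  have "\<forall>\<^sub>F y in at x within A. dist (f y) (f x) < e / 2"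
    "\<forall>\<^sub>F y in at x within A. dist (g y) (g x) < e / 2"
    using assms x half_gt_zero[OF e] unfolding continuous_on_def by (blast intro: tendstoD)+
  then show "\<forall>\<^sub>F y in at x within A. dist (f y - g y) (f x - g x) < e"
  proof eventually_elim
    case (elim y)
    then show ?case using dist_circle_minus_le[of "f y" "g y" "f x" "g x"] by simp
  qed
qed

lemma arc_around_eq_ball: "arc_around c e = ball c e"
proof
  show "arc_around c e \<subseteq> ball c e"
  proof
    fix d assume "d \<in> arc_around c e"
    then obtain h where "- e < h" "h < e" "d = c + circ h"
      by (auto simp: arc_around_def)
    then show "d \<in> ball c e" using dist_add_circ_le[of c h] by simp
  qed
  show "ball c e \<subseteq> arc_around c e"
  proof
    fix d assume "d \<in> ball c e"
    then show "d \<in> arc_around c e"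
      using dist_circle_eq[of d c] by (auto simp: arc_around_def intro!: imageI)
  qed
qed

section \<open>Differentiation along the circle\<close>

lemma circle_differentiable_DERIV:
  assumes "circle_differentiable f"
  shows "((\<lambda>s. f (c + circ s)) has_real_derivative circle_deriv f (c + circ s)) (at s)"
proof -
  have "((\<lambda>h. f ((c + circ s) + circ h)) has_real_derivative circle_deriv f (c + circ s)) (at 0)"
    using assms unfolding circle_differentiable_def circle_deriv_def
    by (auto simp: DERIV_deriv_iff_field_differentiable)
  then have "((\<lambda>h. f (c + circ (h + s))) has_real_derivative circle_deriv f (c + circ s)) (at 0)"
    by (simp add: circ_add ac_simps)
  then show ?thesis
    using DERIV_shift[of "\<lambda>s. f (c + circ s)" "circle_deriv f (c + circ s)" 0 s]
    by (simp only: add_0_left)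
qed

lemma circle_derivI:
  assumes "\<And>c. ((\<lambda>s. f (c + circ s)) has_real_derivative g c) (at 0)"
  shows "circle_differentiable f" "circle_deriv f = g"
  using assms by (auto simp: circle_differentiable_def circle_deriv_def fun_eq_iff
      field_differentiable_def DERIV_imp_deriv)

lemma circle_differentiable_continuous:
  assumes "circle_differentiable f"
  shows "continuous_on UNIV f"
  unfolding continuous_on_iff
proof safe
  fix c :: circle and e :: real assume "e > 0"
  have "isCont (\<lambda>s. f (c + circ s)) 0"
    using circle_differentiable_DERIV[OF assms] by (rule DERIV_isCont)
  then obtain d where d: "d > 0" "\<And>h. \<bar>h\<bar> < d \<Longrightarrow> dist (f (c + circ h)) (f (c + circ 0)) < e"
    using \<open>e > 0\<close> unfolding continuous_at_eps_delta by (auto simp: dist_real_def)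
  show "\<exists>d>0. \<forall>x'\<in>UNIV. dist x' c < d \<longrightarrow> dist (f x') (f c) < e"
  proof (intro exI[of _ d] conjI ballI impI d(1))
    fix x' assume "dist x' c < d"
    then obtain h where "x' = c + circ h" "\<bar>h\<bar> < d"
      using dist_circle_eq[of x' c] by (auto simp: dist_commute)
    then show "dist (f x') (f c) < e" using d(2)[of h] by (simp add: circ_0)
  qed
qed

lemma C2_circle_continuous:
  assumes "C2_circle f"
  shows "continuous_on UNIV f" "continuous_on UNIV (circle_deriv f)"
    "continuous_on UNIV (circle_deriv (circle_deriv f))"
  using assms circle_differentiable_continuous by (auto simp: C2_circle_def)

lemma continuous_circle_bounded:
  assumes "continuous_on UNIV (f :: circle \<Rightarrow> real)"
  obtains B where "B > 0" "\<And>x. \<bar>f x\<bar> \<le> B"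
proof -
  have "bounded (range f)"
    using compact_continuous_image[OF assms compact_UNIV_circle] compact_imp_bounded by blast
  then show ?thesis using that unfolding bounded_pos by auto
qed

text \<open>Mean value inequality for the first-order remainder, with the modulus of uniform
  continuity of the derivative. Uniformity in the base point u is what later allows differentiation
  under the integral.\<close>

lemma circle_deriv_uniform:
  assumes g: "circle_differentiable g" and cont: "continuous_on UNIV (circle_deriv g)"
    and "e > 0"
  obtains d where "d > 0"
    "\<And>u h. \<bar>h\<bar> < d \<Longrightarrow> \<bar>g (u + circ h) - g u - h * circle_deriv g u\<bar> \<le> e * \<bar>h\<bar>"
proof -
  have "uniformly_continuous_on UNIV (circle_deriv g)"
    using compact_uniformly_continuous[OF cont compact_UNIV_circle] .
  then obtain d where d: "d > 0"
    "\<And>u v. dist v u < d \<Longrightarrow> dist (circle_deriv g v) (circle_deriv g u) < e"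
    using \<open>e > 0\<close> unfolding uniformly_continuous_on_def by (metis UNIV_I)
  have "\<bar>g (u + circ h) - g u - h * circle_deriv g u\<bar> \<le> e * \<bar>h\<bar>" if "\<bar>h\<bar> < d" for u h
  proof -
    define F where "F s = g (u + circ s) - s * circle_deriv g u" for s
    have F': "(F has_real_derivative circle_deriv g (u + circ s) - circle_deriv g u) (at s within S)"
      for s S
      unfolding F_def
      by (rule DERIV_subset[where s=UNIV])
         (auto intro!: derivative_eq_intros circle_differentiable_DERIV[OF g])
    have b: "norm (circle_deriv g (u + circ s) - circle_deriv g u) \<le> e"
      if "s \<in> closed_segment 0 h" for s
    proof -
      have "\<bar>s\<bar> < d" using that \<open>\<bar>h\<bar> < d\<close> by (auto simp: closed_segment_eq_real_ivl split: if_splits)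
      then show ?thesis
        using d(2)[of "u + circ s" u] dist_add_circ_le[of u s]
        by (simp add: dist_real_def dist_commute)
    qed
    have "norm (F h - F 0) \<le> e * norm (h - 0)"
      by (rule field_differentiable_bound[OF convex_closed_segment F' b]) auto
    then show ?thesis by (simp add: F_def circ_0 algebra_simps)
  qed
  then show ?thesis using that d(1) by blast
qed

section \<open>Haar measure as a probability measure\<close>

lemma sets_haar [simp, measurable_cong]: "sets haar = sets borel"
  by (simp add: haar_def)

lemma space_haar [simp]: "space haar = UNIV"
  by (simp add: haar_def)

lemma prob_space_haar: "prob_space haar"
proof -
  have "prob_space (restrict_space lborel {0..<1::real})"
    by (rule prob_spaceI) (simp add: emeasure_restrict_space space_restrict_space)
  then show ?thesis
    unfolding haar_def
    by (rule prob_space.prob_space_distr) (simp add: measurable_restrict_space1)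
qed

interpretation haar: prob_space haar
  by (rule prob_space_haar)

section \<open>Signed measures\<close>

lemma radon_notin_sets: "m \<in> radon_measures \<Longrightarrow> A \<notin> sets borel \<Longrightarrow> m A = 0"
  by (auto simp: radon_measures_def)

lemma radon_sums:
  assumes "m \<in> radon_measures" "\<And>i::nat. A i \<in> sets borel" "disjoint_family A"
  shows "(\<lambda>i. m (A i)) sums m (\<Union>i. A i)"
  using assms unfolding radon_measures_def by blast

lemma radon_empty [simp]:
  assumes "m \<in> radon_measures"
  shows "m {} = 0"
proof -
  have "(\<lambda>i::nat. m {}) sums m (\<Union>i::nat. {})"
    by (rule radon_sums[OF assms]) (auto simp: disjoint_family_on_def)
  then have "(\<lambda>i::nat. m {}) \<longlonglongrightarrow> 0"
    using summable_LIMSEQ_zero sums_summable by blast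
  then show ?thesis by (simp add: LIMSEQ_const_iff)
qed

lemma radon_Un:
  assumes "m \<in> radon_measures" "A \<in> sets borel" "B \<in> sets borel" "A \<inter> B = {}"
  shows "m (A \<union> B) = m A + m B"
proof -
  have "(\<lambda>i. m (binaryset A B i)) sums m (\<Union>i. binaryset A B i)"
    using assms by (intro radon_sums) (auto simp: binaryset_def disjoint_family_on_def)
  moreover have "(\<lambda>i. m (binaryset A B i)) sums (m A + m B)"
    by (rule binaryset_sums) (simp add: assms)
  ultimately show ?thesis
    by (metis UN_binaryset_eq sums_unique2)
qed

lemma radon_Diff:
  assumes "m \<in> radon_measures" "A \<in> sets borel" "B \<in> sets borel" "B \<subseteq> A"
  shows "m (A - B) = m A - m B"
  using radon_Un[OF assms(1) assms(3), of "A - B"] assms by (simp add: Un_absorb1)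

lemma radon_Int_Diff:
  assumes "m \<in> radon_measures" "A \<in> sets borel" "B \<in> sets borel"
  shows "m A = m (A \<inter> B) + m (A - B)"
  using radon_Diff[OF assms(1,2), of "A \<inter> B"] assms by (simp add: Diff_Int)

lemma radon_Un_Int:
  assumes "m \<in> radon_measures" "A \<in> sets borel" "B \<in> sets borel"
  shows "m (A \<union> B) + m (A \<inter> B) = m A + m B"
  using radon_Un[OF assms(1) assms(2), of "B - A"] radon_Int_Diff[OF assms(1,3,2)] assms
  by (simp add: Int_commute)

lemma radon_incseq:
  assumes m: "m \<in> radon_measures" and A: "\<And>i. A i \<in> sets borel" "incseq A"
  shows "(\<lambda>i. m (A i)) \<longlonglongrightarrow> m (\<Union>i. A i)"
proof -
  have D: "disjointed A i \<in> sets borel" for i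
    using A sets.range_disjointed_sets[of A borel] by auto
  have "(\<lambda>i. m (disjointed A i)) sums m (\<Union>i. disjointed A i)"
    by (rule radon_sums[OF m D]) (rule disjoint_family_disjointed)
  then have "(\<lambda>n. \<Sum>i\<le>n. m (disjointed A i)) \<longlonglongrightarrow> m (\<Union>i. A i)"
    by (simp add: sums_def_le UN_disjointed_eq)
  moreover have "(\<Sum>i\<le>n. m (disjointed A i)) = m (A n)" for n
  proof (induction n)
    case 0
    then show ?case by (simp add: disjointed_0)
  next
    case (Suc n)
    have "A n \<subseteq> A (Suc n)" using A(2) by (simp add: incseq_SucD)
    then show ?case
      using Suc radon_Diff[OF m A(1)[of "Suc n"] A(1)[of n]] by (simp add: disjointed_mono[OF A(2)])
  qed
  ultimately show ?thesis by simp
qed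

lemma radon_decseq:
  assumes m: "m \<in> radon_measures" and A: "\<And>i. A i \<in> sets borel" "decseq A"
  shows "(\<lambda>i. m (A i)) \<longlonglongrightarrow> m (\<Inter>i. A i)"
proof -
  have "(\<lambda>i. m UNIV - m (- A i)) \<longlonglongrightarrow> m UNIV - m (\<Union>i. - A i)"
    using A by (intro tendsto_intros radon_incseq[OF m]) (auto simp: incseq_def decseq_def)
  moreover have C: "m UNIV - m (- B) = m B" if "B \<in> sets borel" for B
    using radon_Diff[OF m, of UNIV "- B"] that by (simp add: Compl_eq_Diff_UNIV Diff_Diff_Int)
  moreover have "m UNIV - m (\<Union>i. - A i) = m (\<Inter>i. A i)"
    using C[of "\<Inter>i. A i"] A(1) by (simp add: Compl_INT)
  ultimately show ?thesis
    using A(1) by simp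
qed

text \<open>If the values on subsets of \<open>A\<close> are unbounded, \<open>A\<close> has a subset with the same property whose
  complement in \<open>A\<close> has large measure; iterating contradicts summability.\<close>

lemma radon_bounded:
  assumes m: "m \<in> radon_measures"
  obtains R where "\<And>A. \<bar>m A\<bar> \<le> R"
proof -
  define U where "U A \<longleftrightarrow> A \<in> sets borel \<and> (\<forall>R. \<exists>B\<in>sets borel. B \<subseteq> A \<and> \<bar>m B\<bar> > R)" for A
  have nU: "\<exists>R. \<forall>B. B \<in> sets borel \<longrightarrow> B \<subseteq> C \<longrightarrow> \<bar>m B\<bar> \<le> R"
    if "C \<in> sets borel" "\<not> U C" for C
    using that unfolding U_def by (meson not_less)
  have split: "\<exists>C. U C \<and> C \<subseteq> A \<and> \<bar>m (A - C)\<bar> \<ge> 1" if UA: "U A" for A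
  proof -
    have A: "A \<in> sets borel" using UA by (simp add: U_def)
    \<comment> \<open>The excess over |m A| + 1 makes both |m B| and |m (A - B)| at least 1, so
      whichever of the two pieces stays unbounded, the discarded one is large.\<close>
    obtain B where B: "B \<in> sets borel" "B \<subseteq> A" "\<bar>m B\<bar> > \<bar>m A\<bar> + 1"
      using UA unfolding U_def by blast
    have AB: "m (A - B) = m A - m B" by (rule radon_Diff[OF m A B(1,2)])
    have "U B \<or> U (A - B)"
    proof (rule ccontr)
      assume "\<not> ?thesis"
      then obtain R1 R2 where R: "\<And>C. C \<in> sets borel \<Longrightarrow> C \<subseteq> B \<Longrightarrow> \<bar>m C\<bar> \<le> R1"
        "\<And>C. C \<in> sets borel \<Longrightarrow> C \<subseteq> A - B \<Longrightarrow> \<bar>m C\<bar> \<le> R2"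
        using A B(1) nU[of B] nU[of "A - B"] by auto
      have "\<bar>m C\<bar> \<le> R1 + R2" if "C \<in> sets borel" "C \<subseteq> A" for C
      proof -
        have "\<bar>m (C \<inter> B)\<bar> \<le> R1" "\<bar>m (C - B)\<bar> \<le> R2"
          using that B(1) by (auto intro!: R)
        then show ?thesis using radon_Int_Diff[OF m that(1) B(1)] by linarith
      qed
      then show False using \<open>U A\<close> unfolding U_def by (meson not_less)
    qed
    then show ?thesis
    proof
      assume "U B"
      then show ?thesis using B(2,3) AB by (intro exI[of _ B]) auto
    next
      assume "U (A - B)"
      moreover have "A - (A - B) = B" using B(2) by auto
      ultimately show ?thesis using B(3) by (intro exI[of _ "A - B"]) auto
    qed
  qed
  have "\<not> U UNIV"
  proof
    assume "U UNIV"
    obtain c where c: "\<And>A. U A \<Longrightarrow> U (c A) \<and> c A \<subseteq> A \<and> \<bar>m (A - c A)\<bar> \<ge> 1"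
      using split by metis
    define A where "A n = (c ^^ n) UNIV" for n
    have A1: "U (A n)" for n
      by (induction n) (use \<open>U UNIV\<close> c in \<open>auto simp: A_def\<close>)
    have A2: "A (Suc n) \<subseteq> A n \<and> \<bar>m (A n - A (Suc n))\<bar> \<ge> 1" for n
      using c[OF A1[of n]] by (simp add: A_def)
    note A = A1 A2
    have anti: "A j \<subseteq> A i" if "i \<le> j" for i j
      using that by (rule lift_Suc_antimono_le[of A, rotated]) (use A(2) in blast)
    have "disjoint_family (\<lambda>n. A n - A (Suc n))"
    proof -
      have "(A i - A (Suc i)) \<inter> (A j - A (Suc j)) = {}" if "i < j" for i j
        using anti[of "Suc i" j] that by auto
      then show ?thesis unfolding disjoint_family_on_def by (metis Int_commute linorder_neqE_nat)
    qed
    then have "(\<lambda>n. m (A n - A (Suc n))) sums m (\<Union>n. A n - A (Suc n))"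
      using A(1) by (intro radon_sums[OF m]) (auto simp: U_def)
    then have "(\<lambda>n. m (A n - A (Suc n))) \<longlonglongrightarrow> 0"
      using summable_LIMSEQ_zero sums_summable by blast
    then obtain n where "\<bar>m (A n - A (Suc n))\<bar> < 1"
      using LIMSEQ_D[of _ "0::real" 1] by fastforce
    then show False using A(2)[of n] by simp
  qed
  then obtain R where R: "\<And>B. B \<in> sets borel \<Longrightarrow> \<bar>m B\<bar> \<le> R"
    using nU[of UNIV] by auto
  have "\<bar>m A\<bar> \<le> R" for A
    using R[of A] R[of "{}"] radon_notin_sets[OF m, of A] by (cases "A \<in> sets borel") auto
  then show ?thesis by (rule that)
qed

text \<open>The positive set is the limit inferior of sets \<open>B\<^sub>n\<close> with \<open>m(B\<^sub>n) > sup m - 2\<^sup>-\<^sup>n\<close>.\<close>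

lemma radon_Hahn:
  assumes m: "m \<in> radon_measures"
  obtains P where "P \<in> sets borel"
    "\<And>B. B \<in> sets borel \<Longrightarrow> B \<subseteq> P \<Longrightarrow> m B \<ge> 0"
    "\<And>B. B \<in> sets borel \<Longrightarrow> B \<inter> P = {} \<Longrightarrow> m B \<le> 0"
proof -
  obtain R where R: "\<And>A. \<bar>m A\<bar> \<le> R" using radon_bounded[OF m] by blast
  define s where "s = (SUP A\<in>sets borel. m A)"
  have bdd: "bdd_above (m ` sets borel)"
    using R by (intro bdd_aboveI[of _ R]) (auto simp: abs_le_iff)
  have s: "m A \<le> s" if "A \<in> sets borel" for A
    unfolding s_def by (rule cSUP_upper[OF that bdd])
  have "\<exists>A\<in>sets borel. s - (1/2)^n < m A" for n
    using less_cSUP_iff[OF _ bdd, of "s - (1/2)^n"] unfolding s_def[symmetric] by auto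
  then obtain B where B: "\<And>n. B n \<in> sets borel" "\<And>n. s - (1/2)^n < m (B n)"
    by metis
  define C where "C n k = (\<Inter>j\<in>{n..n+k}. B j)" for n k
  have C_sets: "C n k \<in> sets borel" for n k
    unfolding C_def using B(1) by (intro sets.finite_INT) auto
  \<comment> \<open>The union with the next set has measure at most s, so by modularity the
    intersection loses at most (1/2)^(n + Suc k). The formula is the geometric sum of these
    losses.\<close>
  have C: "m (C n k) \<ge> s - 2 * (1/2)^n + (1/2)^(n+k)" for n k
  proof (induction k)
    case 0
    then show ?case using B(2)[of n] by (simp add: C_def)
  next
    case (Suc k)
    have "{n..n + Suc k} = insert (n + Suc k) {n..n+k}" by auto
    then have "C n (Suc k) = C n k \<inter> B (n + Suc k)" by (auto simp: C_def)
    moreover have "m (C n k \<union> B (n + Suc k)) \<le> s"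
      using C_sets B(1) by (intro s) auto
    ultimately show ?case
      using radon_Un_Int[OF m C_sets[of n k] B(1)[of "n + Suc k"]] B(2)[of "n + Suc k"] Suc
      by simp
  qed
  define D where "D n = (\<Inter>k. C n k)" for n
  have D_sets: "D n \<in> sets borel" for n
    unfolding D_def using C_sets by auto
  have D: "m (D n) \<ge> s - 2 * (1/2)^n" for n
  proof -
    have "(\<lambda>k. m (C n k)) \<longlonglongrightarrow> m (D n)"
      unfolding D_def by (rule radon_decseq[OF m C_sets]) (auto simp: decseq_def C_def)
    moreover have "s - 2 * (1/2)^n \<le> m (C n k)" for k
      using C[of n k] zero_le_power[of "1/2::real" "n+k"] by linarith
    ultimately show ?thesis by (intro LIMSEQ_le_const) auto
  qed
  define P where "P = (\<Union>n. D n)"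
  have P_sets: "P \<in> sets borel" unfolding P_def using D_sets by auto
  have "incseq D"
    unfolding D_def C_def incseq_def
  proof safe
    fix i j k l x assume "i \<le> j" "x \<in> (\<Inter>k. \<Inter>j\<in>{i..i+k}. B j)" "l \<in> {j..j+k}"
    then show "x \<in> B l" by (auto dest!: spec[of _ "l - i"])
  qed
  then have "(\<lambda>n. m (D n)) \<longlonglongrightarrow> m P"
    unfolding P_def by (rule radon_incseq[OF m D_sets])
  moreover have "(\<lambda>n. s - 2 * (1/2)^n) \<longlonglongrightarrow> s - 2 * 0"
    by (intro tendsto_intros LIMSEQ_power_zero) auto
  ultimately have "s \<le> m P"
    using D by (auto intro: LIMSEQ_le)
  then have P: "m P = s" using s[OF P_sets] by simp
  show ?thesis
  proof (rule that[OF P_sets])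
    \<comment> \<open>A set of the wrong sign, removed from P or added to it, would produce a value
      above the supremum s.\<close>
    fix A assume A: "(A::circle set) \<in> sets borel"
    show "m A \<ge> 0" if "A \<subseteq> P"
      using radon_Diff[OF m P_sets A that] s[of "P - A"] A P_sets P by simp
    show "m A \<le> 0" if "A \<inter> P = {}"
      using radon_Un[OF m A P_sets that] s[of "A \<union> P"] A P_sets P by simp
  qed
qed

section \<open>The Jordan decomposition\<close>

lemma sets_pos_part [simp, measurable_cong]: "sets (pos_part m) = sets borel"
  unfolding pos_part_def using sets.sigma_sets_eq[of "borel :: circle measure"] by simp

lemma sets_neg_part [simp, measurable_cong]: "sets (neg_part m) = sets borel"
  by (simp add: neg_part_def)

lemma space_pos_part [simp]: "space (pos_part m) = UNIV"
  by (simp add: pos_part_def)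

lemma space_neg_part [simp]: "space (neg_part m) = UNIV"
  by (simp add: neg_part_def)

text \<open>With a Hahn set P the supremum is attained at \<open>A \<inter> P\<close>: cutting B
  down to P discards nonpositive mass, and enlarging to \<open>A \<inter> P\<close> adds nonnegative
  mass. This closed form proves countable additivity, without which \<open>measure_of\<close> would
  return the zero measure.\<close>

lemma emeasure_pos_part:
  assumes m: "m \<in> radon_measures" and P: "P \<in> sets borel"
    and pos: "\<And>B. B \<in> sets borel \<Longrightarrow> B \<subseteq> P \<Longrightarrow> m B \<ge> 0"
    and neg: "\<And>B. B \<in> sets borel \<Longrightarrow> B \<inter> P = {} \<Longrightarrow> m B \<le> 0"
    and A: "A \<in> sets borel"
  shows "emeasure (pos_part m) A = ennreal (m (A \<inter> P))"
proof -
  let ?\<mu> = "\<lambda>A. SUP B\<in>{B \<in> sets borel. B \<subseteq> A}. ennreal (m B)"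
  have \<mu>: "?\<mu> A = ennreal (m (A \<inter> P))" if A: "A \<in> sets borel" for A
  proof (rule antisym)
    show "ennreal (m (A \<inter> P)) \<le> ?\<mu> A"
      using A P by (intro SUP_upper) auto
    show "?\<mu> A \<le> ennreal (m (A \<inter> P))"
    proof (rule SUP_least)
      fix B assume "B \<in> {B \<in> sets borel. B \<subseteq> A}"
      then have B: "B \<in> sets borel" "B \<subseteq> A" by auto
      have "m B = m (B \<inter> P) + m (B - P)" by (rule radon_Int_Diff[OF m B(1) P])
      moreover have "m (B - P) \<le> 0" using B P by (intro neg) auto
      moreover have "m (A \<inter> P) = m (B \<inter> P) + m (A \<inter> P - B)"
        using radon_Int_Diff[OF m, of "A \<inter> P" B] A B P
        by (metis inf.absorb2 inf.assoc inf.commute sets.Int)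
      moreover have "m (A \<inter> P - B) \<ge> 0" using A B P by (intro pos) auto
      ultimately show "ennreal (m B) \<le> ennreal (m (A \<inter> P))" by (intro ennreal_leI) simp
    qed
  qed
  have "countably_additive (sets borel) ?\<mu>"
  proof (rule countably_additiveI)
    fix S :: "nat \<Rightarrow> circle set"
    assume S: "range S \<subseteq> sets borel" "disjoint_family S" "\<Union> (range S) \<in> sets borel"
    then have Si: "S i \<in> sets borel" for i by auto
    have "(\<lambda>i. m (S i \<inter> P)) sums m (\<Union>i. S i \<inter> P)"
      using Si S(2) P by (intro radon_sums[OF m]) (auto simp: disjoint_family_on_def)
    then have "(\<Sum>i. ennreal (m (S i \<inter> P))) = ennreal (m (\<Union>i. S i \<inter> P))"
      using Si P by (intro suminf_ennreal_eq pos) auto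
    then show "(\<Sum>i. ?\<mu> (S i)) = ?\<mu> (\<Union> (range S))"
      using S(3) Si by (simp add: \<mu>)
  qed
  moreover have "positive (sets borel) ?\<mu>"
    using m by (auto simp: positive_def)
  ultimately have "emeasure (pos_part m) A = ?\<mu> A"
    using A by (intro emeasure_measure_of[OF pos_part_def]) auto
  then show ?thesis using \<mu>[OF A] by simp
qed

lemma radon_uminus:
  assumes "m \<in> radon_measures" shows "(\<lambda>A. - m A) \<in> radon_measures"
  using assms unfolding radon_measures_def by (auto intro: sums_minus)

text \<open>The complement of a Hahn set of m is a Hahn set of -m, so one formula yields both
  parts.\<close>

lemma radon_Jordan_Hahn:
  assumes m: "m \<in> radon_measures"
  obtains P where "P \<in> sets borel"
    "\<And>A. A \<in> sets borel \<Longrightarrow> measure (pos_part m) A = m (A \<inter> P)"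
    "\<And>A. A \<in> sets borel \<Longrightarrow> measure (neg_part m) A = - m (A - P)"
    "finite_measure (pos_part m)" "finite_measure (neg_part m)"
proof -
  obtain P where P: "P \<in> sets borel"
    "\<And>B. B \<in> sets borel \<Longrightarrow> B \<subseteq> P \<Longrightarrow> m B \<ge> 0"
    "\<And>B. B \<in> sets borel \<Longrightarrow> B \<inter> P = {} \<Longrightarrow> m B \<le> 0"
    using radon_Hahn[OF m] by blast
  have p: "emeasure (pos_part m) A = ennreal (m (A \<inter> P))" if "A \<in> sets borel" for A
    by (rule emeasure_pos_part[OF m P that])
  have n: "emeasure (neg_part m) A = ennreal (- m (A - P))" if "A \<in> sets borel" for A
    unfolding neg_part_def Diff_eq
    using P(1) that by (intro emeasure_pos_part radon_uminus m) (auto intro!: P(2,3))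
  show ?thesis
  proof (rule that[OF P(1)])
    fix A assume A: "(A :: circle set) \<in> sets borel"
    have "m (A \<inter> P) \<ge> 0" "m (A - P) \<le> 0" using A P(1) by (auto intro!: P(2,3))
    then show "measure (pos_part m) A = m (A \<inter> P)" "measure (neg_part m) A = - m (A - P)"
      using p[OF A] n[OF A] by (auto simp: measure_def)
  next
    show "finite_measure (pos_part m)" "finite_measure (neg_part m)"
      using p[of UNIV] n[of UNIV] by (auto intro!: finite_measureI)
  qed
qed

lemma finite_measure_pos_part [simp]: "m \<in> radon_measures \<Longrightarrow> finite_measure (pos_part m)"
  using radon_Jordan_Hahn by metis

lemma finite_measure_neg_part [simp]: "m \<in> radon_measures \<Longrightarrow> finite_measure (neg_part m)"
  using radon_Jordan_Hahn by metis

lemma radon_Jordan: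
  assumes m: "m \<in> radon_measures"
  shows "m A = measure (pos_part m) A - measure (neg_part m) A"
proof (cases "A \<in> sets borel")
  case True
  then show ?thesis
    using radon_Jordan_Hahn[OF m] radon_Int_Diff[OF m True]
    by (metis (no_types, lifting) diff_minus_eq_add)
next
  case False
  then show ?thesis by (simp add: radon_notin_sets[OF m] measure_notin_sets)
qed

lemma radon_linear:
  assumes "m1 \<in> radon_measures" "m2 \<in> radon_measures"
  shows "(\<lambda>A. a * m1 A + b * m2 A) \<in> radon_measures"
  using assms unfolding radon_measures_def by (simp add: sums_add sums_mult)

lemma radon_measure:
  assumes "finite_measure M" "sets M = sets borel"
  shows "measure M \<in> radon_measures"
proof -
  interpret finite_measure M by fact
  show ?thesis unfolding radon_measures_def
    using assms(2) by (auto simp: measure_notin_sets finite_measure_UNION)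
qed

lemma scaled_dirac_eq: "scaled_dirac a z = (\<lambda>A. a * measure (return borel z) A)"
proof
  fix A
  show "scaled_dirac a z A = a * measure (return borel z) A"
    by (cases "A \<in> sets borel")
       (auto simp: scaled_dirac_def measure_return measure_notin_sets indicator_def)
qed

lemma scaled_dirac_radon: "scaled_dirac a z \<in> radon_measures"
  using radon_linear[OF radon_measure radon_measure, of "return borel z" "return borel z" a 0]
    prob_space.finite_measure[OF prob_space_return[of z "borel :: circle measure"]]
  by (simp add: scaled_dirac_eq)

subsection \<open>Integration against signed measures\<close>

text \<open>The Jordan parts of a combination of signed measures are not the combinations of the
  Jordan parts. A linear relation among finite positive measures avoids computing them: it passes
  from sets to simple functions and, by dominated convergence, to bounded Borel functions.\<close>

lemma sum_list_integral_eq_0: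
  fixes f :: "circle \<Rightarrow> real"
  assumes fin: "\<And>c M. (c, M) \<in> set xs \<Longrightarrow> finite_measure M \<and> sets M = sets borel"
    and zero: "\<And>A. A \<in> sets borel \<Longrightarrow> (\<Sum>(c, M)\<leftarrow>xs. c * measure M A) = 0"
    and f: "f \<in> borel_measurable borel" and B: "\<And>x. \<bar>f x\<bar> \<le> B"
  shows "(\<Sum>(c, M)\<leftarrow>xs. c * (LINT x|M. f x)) = 0"
proof -
  define n where "n = length xs"
  define c where "c i = fst (xs ! i)" for i
  define M where "M i = snd (xs ! i)" for i
  have fin': "finite_measure (M i)" "sets (M i) = sets borel" if "i < n" for i
    using fin[of "c i" "M i"] that by (auto simp: c_def M_def n_def)
  have conv: "(\<Sum>(c, M)\<leftarrow>xs. c * h M) = (\<Sum>i<n. c i * h (M i))" for h :: "circle measure \<Rightarrow> real"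
    unfolding sum_list_sum_nth by (auto simp: n_def c_def M_def case_prod_beta lessThan_atLeast0 intro!: sum.cong)
  have simple: "(\<Sum>i<n. c i * (LINT x|M i. g x)) = 0"
    if g: "simple_function borel g" for g :: "circle \<Rightarrow> real"
  proof -
    have fr: "finite (range g)" using g by (auto simp: simple_function_def)
    have gs: "g -` {y} \<in> sets borel" for y
      using g simple_functionD(2)[OF g, of "{y}"] by simp
    have g_eq: "g x = (\<Sum>y\<in>range g. y * indicator (g -` {y}) x)" for x
    proof -
      have "(\<Sum>y\<in>range g. y * indicator (g -` {y}) x) = (\<Sum>y\<in>range g. if y = g x then y else 0)"
        by (intro sum.cong) (auto simp: indicator_def)
      then show ?thesis using fr by simp
    qed
    have "(LINT x|M i. g x) = (\<Sum>y\<in>range g. y * measure (M i) (g -` {y}))" if "i < n" for i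
    proof -
      interpret finite_measure "M i" by (rule fin'[OF that])
      have [simp]: "space (M i) = UNIV" using sets_eq_imp_space_eq[OF fin'(2)[OF that]] by simp
      have i: "integrable (M i) (\<lambda>x. y * indicator (g -` {y}) x :: real)" for y
        using gs[of y] fin'(2)[OF that]
        by (intro integrable_mult_right integrable_real_indicator) (auto simp: emeasure_eq_measure)
      show ?thesis
        by (subst g_eq, subst Bochner_Integration.integral_sum) (rule i, simp add: mult.commute)
    qed
    then have "(\<Sum>i<n. c i * (LINT x|M i. g x))
        = (\<Sum>i<n. \<Sum>y\<in>range g. y * (c i * measure (M i) (g -` {y})))"
      by (intro sum.cong refl) (simp add: sum_distrib_left mult_ac)
    also have "\<dots> = (\<Sum>y\<in>range g. y * (\<Sum>i<n. c i * measure (M i) (g -` {y})))"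
      by (subst sum.swap) (simp add: sum_distrib_left)
    also have "\<dots> = 0"
      using zero[OF gs] by (simp add: conv)
    finally show ?thesis .
  qed
  obtain F where F: "\<And>i. simple_function borel (F i)"
    "\<And>x. (\<lambda>i. F i x) \<longlonglongrightarrow> f x" "\<And>i x. dist (F i x) 0 \<le> 2 * dist (f x) 0"
    using borel_measurable_implies_sequence_metric[OF f, of 0] by auto
  have "(\<lambda>k. LINT x|M i. F k x) \<longlonglongrightarrow> (LINT x|M i. f x)" if "i < n" for i
  proof (rule integral_dominated_convergence[where w="\<lambda>x. 2 * B"])
    interpret finite_measure "M i" by (rule fin'[OF that])
    show "integrable (M i) (\<lambda>x. 2 * B)" by simp
    show "f \<in> borel_measurable (M i)" "F k \<in> borel_measurable (M i)" for k
      using f borel_measurable_simple_function[OF F(1)[of k]] fin'(2)[OF that]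
      by (simp_all cong: measurable_cong_sets)
    show "AE x in M i. norm (F k x) \<le> 2 * B" for k
      using F(3)[of k] B by (auto simp: dist_real_def intro!: AE_I2) (meson mult_left_mono order_trans zero_le_numeral)
  qed (auto simp: F(2))
  then have "(\<lambda>k. \<Sum>i<n. c i * (LINT x|M i. F k x)) \<longlonglongrightarrow> (\<Sum>i<n. c i * (LINT x|M i. f x))"
    by (intro tendsto_intros) auto
  then show ?thesis
    unfolding conv simple[OF F(1)] by (simp add: LIMSEQ_const_iff)
qed

text \<open>Any representation of m by finite measures, minimal or not, computes the integral: bring
  the Jordan parts to the same side and the relation vanishes on Borel sets.\<close>

lemma signed_integral_eqI:
  fixes f :: "circle \<Rightarrow> real"
  assumes m: "m \<in> radon_measures"
    and fin: "\<And>c M. (c, M) \<in> set xs \<Longrightarrow> finite_measure M \<and> sets M = sets borel"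
    and eq: "\<And>A. A \<in> sets borel \<Longrightarrow> m A = (\<Sum>(c, M)\<leftarrow>xs. c * measure M A)"
    and f: "f \<in> borel_measurable borel" and B: "\<And>x. \<bar>f x\<bar> \<le> B"
  shows "signed_integral m f = (\<Sum>(c, M)\<leftarrow>xs. c * (LINT x|M. f x))"
proof -
  have "(\<Sum>(c, M)\<leftarrow>((- 1, pos_part m) # (1, neg_part m) # xs). c * (LINT x|M. f x)) = 0"
  proof (rule sum_list_integral_eq_0[OF _ _ f B])
    show "finite_measure M \<and> sets M = sets borel"
      if "(c, M) \<in> set ((- 1, pos_part m) # (1, neg_part m) # xs)" for c M
      using that fin m by auto
    show "(\<Sum>(c, M)\<leftarrow>((- 1, pos_part m) # (1, neg_part m) # xs). c * measure M A) = 0"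
      if "A \<in> sets borel" for A
      using eq[OF that] radon_Jordan[OF m, of A] by simp
  qed
  then show ?thesis by (simp add: signed_integral_def)
qed

lemma signed_integral_linear:
  assumes m: "m1 \<in> radon_measures" "m2 \<in> radon_measures"
    and f: "f \<in> borel_measurable borel" and B: "\<And>x. \<bar>f x\<bar> \<le> B"
  shows "signed_integral (\<lambda>A. a * m1 A + b * m2 A) f = a * signed_integral m1 f + b * signed_integral m2 f"
proof -
  have "signed_integral (\<lambda>A. a * m1 A + b * m2 A) f = (\<Sum>(c, M)\<leftarrow>[(a, pos_part m1), (- a, neg_part m1),
    (b, pos_part m2), (- b, neg_part m2)]. c * (LINT x|M. f x))"
    using m
    by (intro signed_integral_eqI[OF radon_linear[OF m] _ _ f B])
      (auto simp: radon_Jordan[OF m(1)] radon_Jordan[OF m(2)] algebra_simps)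
  then show ?thesis by (simp add: signed_integral_def algebra_simps)
qed

lemma signed_integral_scaled_dirac:
  assumes f: "f \<in> borel_measurable borel" and B: "\<And>x. \<bar>f x\<bar> \<le> B"
  shows "signed_integral (scaled_dirac a z) f = a * f z"
proof -
  have "signed_integral (scaled_dirac a z) f = (\<Sum>(c, M)\<leftarrow>[(a, return borel z)]. c * (LINT x|M. f x))"
    using prob_space.finite_measure[OF prob_space_return[of z "borel :: circle measure"]]
    by (intro signed_integral_eqI[OF scaled_dirac_radon _ _ f B]) (auto simp: scaled_dirac_eq)
  then show ?thesis using f by (simp add: integral_return)
qed

lemma integrable_continuous_circle:
  assumes "finite_measure M" "sets M = sets borel" "continuous_on UNIV (f :: circle \<Rightarrow> real)"
  shows "integrable M f"
proof -
  obtain B where "\<And>x. \<bar>f x\<bar> \<le> B"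
    using continuous_circle_bounded[OF assms(3)] by blast
  moreover have "f \<in> borel_measurable M"
    using borel_measurable_continuous_onI[OF assms(3)] assms(2) by (simp cong: measurable_cong_sets)
  ultimately show ?thesis
    by (intro finite_measure.integrable_const_bound[OF assms(1), where B=B]) auto
qed

lemma signed_integral_diff:
  assumes m: "m \<in> radon_measures" and "continuous_on UNIV f" "continuous_on UNIV g"
  shows "signed_integral m (\<lambda>x. f x - g x) = signed_integral m f - signed_integral m g"
  unfolding signed_integral_def
  using assms by (simp add: integrable_continuous_circle)

lemma signed_integral_bound:
  assumes m: "m \<in> radon_measures" and f: "continuous_on UNIV f" "\<And>x. \<bar>f x\<bar> \<le> B"
  shows "\<bar>signed_integral m f\<bar> \<le> B * total_variation m UNIV"
proof -
  have b: "\<bar>LINT x|M. f x\<bar> \<le> B * measure M UNIV" if "finite_measure M" "sets M = sets borel" for M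
  proof -
    interpret finite_measure M by fact
    have "\<bar>LINT x|M. f x\<bar> \<le> (LINT x|M. B)"
      using integrable_continuous_circle[OF that f(1)] f(2)
      by (intro order_trans[OF integral_abs_bound] integral_mono) auto
    then show ?thesis using sets_eq_imp_space_eq[OF that(2)] by (simp add: mult.commute)
  qed
  have "\<bar>LINT x|pos_part m. f x\<bar> \<le> B * measure (pos_part m) UNIV"
    "\<bar>LINT x|neg_part m. f x\<bar> \<le> B * measure (neg_part m) UNIV"
    using m by (auto intro!: b)
  then show ?thesis
    unfolding signed_integral_def total_variation_def by (simp add: algebra_simps)
qed

section \<open>The dual norm and the total variation\<close>

lemma tv_norm_bdd_above:
  assumes m: "m \<in> radon_measures"
  shows "bdd_above (signed_integral m ` {\<psi>. continuous_on UNIV \<psi> \<and> (\<forall>x. \<bar>\<psi> x\<bar> \<le> 1)})"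
  using signed_integral_bound[OF m, of _ 1]
  by (intro bdd_aboveI[of _ "total_variation m UNIV"]) (auto simp: abs_le_iff)

lemma signed_integral_le_tv_norm:
  assumes m: "m \<in> radon_measures" and f: "continuous_on UNIV f" "\<And>x. \<bar>f x\<bar> \<le> 1"
  shows "signed_integral m f \<le> tv_norm m"
  unfolding tv_norm_def using f by (intro cSUP_upper tv_norm_bdd_above[OF m]) auto

lemma tv_norm_leI:
  assumes "\<And>\<psi>. continuous_on UNIV \<psi> \<Longrightarrow> (\<And>x. \<bar>\<psi> x\<bar> \<le> 1) \<Longrightarrow> signed_integral m \<psi> \<le> c"
  shows "tv_norm m \<le> c"
  unfolding tv_norm_def
  by (rule cSUP_least) (auto intro!: assms exI[of _ "\<lambda>x. 0"])

text \<open>The Hahn set is approximated from inside by a compact set and so is its complement; a Urysohn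
  function of the two compact sets nearly attains the total variation.\<close>

lemma tv_norm_eq_total_variation:
  assumes m: "m \<in> radon_measures"
  shows "tv_norm m = total_variation m UNIV"
proof (rule antisym)
  show "tv_norm m \<le> total_variation m UNIV"
    by (rule tv_norm_leI) (use signed_integral_bound[OF m, of _ 1] in \<open>auto simp: abs_le_iff\<close>)
next
  show "total_variation m UNIV \<le> tv_norm m"
  proof (rule field_le_epsilon)
    fix e :: real assume e: "e > 0"
    obtain P where P: "P \<in> sets borel"
      "\<And>A. A \<in> sets borel \<Longrightarrow> measure (pos_part m) A = m (A \<inter> P)"
      "\<And>A. A \<in> sets borel \<Longrightarrow> measure (neg_part m) A = - m (A - P)"
      using radon_Jordan_Hahn[OF m] by metis
    interpret p: finite_measure "pos_part m" by (simp add: m)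
    interpret n: finite_measure "neg_part m" by (simp add: m)
    \<comment> \<open>Mass outside the compact sets counts twice, because there the test function
      may take the opposite sign. Two losses of e/4, doubled, add up to e.\<close>
    have compact_approx: "\<exists>K. K \<subseteq> B \<and> compact K \<and> measure M B - e / 4 < measure M K"
      if "finite_measure M" "sets M = sets borel" "B \<in> sets borel" for M and B :: "circle set"
    proof -
      interpret finite_measure M by fact
      show ?thesis
      \<comment> \<open>In \<open>ennreal\<close> a negative bound would be truncated to 0 and the
        strict inequality could fail, so this case takes the empty set.\<close>
      proof (cases "measure M B - e / 4 < 0")
        case True
        then show ?thesis by (intro exI[of _ "{}"]) auto
      next
        case False
        have "emeasure M B = (SUP K\<in>{K. K \<subseteq> B \<and> compact K}. emeasure M K)"
          using that by (intro inner_regular) (auto simp: emeasure_eq_measure)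
        moreover have "ennreal (measure M B - e / 4) < emeasure M B"
          using e False by (simp add: emeasure_eq_measure ennreal_less_iff)
        ultimately obtain K where "K \<subseteq> B" "compact K" "ennreal (measure M B - e / 4) < emeasure M K"
          by (auto simp: less_SUP_iff)
        then show ?thesis
          using False by (intro exI[of _ K]) (simp add: emeasure_eq_measure ennreal_less_iff)
      qed
    qed
    obtain K1 where K1: "K1 \<subseteq> P" "compact K1" "measure (pos_part m) P - e / 4 < measure (pos_part m) K1"
      using compact_approx[of "pos_part m" P] P(1) p.finite_measure_axioms by auto
    obtain K2 where K2: "K2 \<subseteq> - P" "compact K2"
      "measure (neg_part m) (- P) - e / 4 < measure (neg_part m) K2"
      using compact_approx[of "neg_part m" "- P"] P(1) n.finite_measure_axioms by auto
    have P': "measure (pos_part m) P = measure (pos_part m) UNIV"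
      "measure (neg_part m) (- P) = measure (neg_part m) UNIV"
      using P by (auto simp: Compl_eq_Diff_UNIV Diff_Diff_Int)
    have K_sets: "K1 \<in> sets borel" "K2 \<in> sets borel"
      using K1(2) K2(2) by (auto intro: borel_compact)
    have "normal_space (euclidean :: circle topology)"
      by (simp add: metrizable_imp_normal_space metrizable_space_euclidean)
    then obtain \<psi> where \<psi>: "continuous_map euclidean (top_of_set {-1..1::real}) \<psi>"
      "\<psi> ` K2 \<subseteq> {-1}" "\<psi> ` K1 \<subseteq> {1}"
      by (rule Urysohn_lemma[of euclidean K2 K1 "-1" 1])
         (use K1 K2 in \<open>auto simp: disjnt_def intro: compact_imp_closed\<close>)
    have c: "continuous_on UNIV \<psi>" and b: "\<bar>\<psi> x\<bar> \<le> 1" for x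
      using \<psi>(1) by (auto simp: continuous_map_in_subtopology abs_le_iff)
    have i: "integrable (pos_part m) \<psi>" "integrable (neg_part m) \<psi>"
      using m c by (auto intro: integrable_continuous_circle)
    \<comment> \<open>The lower bound is 1 on K1 and -1 elsewhere, which is all that is known of the
      Urysohn function.\<close>
    have "(LINT x|pos_part m. 2 * indicator K1 x - 1) \<le> (LINT x|pos_part m. \<psi> x)"
    proof (rule integral_mono[OF _ i(1)])
      show "2 * indicator K1 x - 1 \<le> \<psi> x" for x
        using b[of x] \<psi>(3) by (auto simp: indicator_def abs_le_iff)
    qed (use K_sets in \<open>auto simp: p.emeasure_eq_measure\<close>)
    moreover have "(LINT x|neg_part m. \<psi> x) \<le> (LINT x|neg_part m. 1 - 2 * indicator K2 x)"
    proof (rule integral_mono[OF i(2)])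
      show "\<psi> x \<le> 1 - 2 * indicator K2 x" for x
        using b[of x] \<psi>(2) by (auto simp: indicator_def abs_le_iff)
    qed (use K_sets in \<open>auto simp: n.emeasure_eq_measure\<close>)
    moreover have "(LINT x|pos_part m. 2 * indicator K1 x - 1) =
        2 * measure (pos_part m) K1 - measure (pos_part m) UNIV"
      using K_sets by (subst Bochner_Integration.integral_diff) (auto simp: p.emeasure_eq_measure)
    moreover have "(LINT x|neg_part m. 1 - 2 * indicator K2 x) =
        measure (neg_part m) UNIV - 2 * measure (neg_part m) K2"
      using K_sets by (subst Bochner_Integration.integral_diff) (auto simp: n.emeasure_eq_measure)
    ultimately have "total_variation m UNIV - e \<le> signed_integral m \<psi>"
      using K1(3) K2(3) P' unfolding signed_integral_def total_variation_def by linarith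
    also have "\<dots> \<le> tv_norm m" by (rule signed_integral_le_tv_norm[OF m c b])
    finally show "total_variation m UNIV \<le> tv_norm m + e" by simp
  qed
qed

lemma total_variation_nonneg: "total_variation m A \<ge> 0"
  by (simp add: total_variation_def)

lemma tv_norm_nonneg: "m \<in> radon_measures \<Longrightarrow> tv_norm m \<ge> 0"
  by (simp add: tv_norm_eq_total_variation total_variation_nonneg)

lemma signed_integral_abs_le:
  assumes "m \<in> radon_measures" "continuous_on UNIV f" "\<And>x. \<bar>f x\<bar> \<le> B"
  shows "\<bar>signed_integral m f\<bar> \<le> B * tv_norm m"
  using signed_integral_bound[OF assms] by (simp add: tv_norm_eq_total_variation assms(1))

text \<open>Equality makes the integrals of 1 - \<eta> against the positive part and of 1 + \<eta>
  against the negative part add up to 0. Both are nonnegative, hence both vanish.\<close>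

lemma tv_norm_saturated:
  assumes m: "m \<in> radon_measures" and c: "continuous_on UNIV \<eta>" and b: "\<And>x. \<bar>\<eta> x\<bar> \<le> 1"
    and eq: "signed_integral m \<eta> = tv_norm m"
  shows "AE x in pos_part m. \<eta> x = 1" "AE x in neg_part m. \<eta> x = - 1"
proof -
  interpret p: finite_measure "pos_part m" by (simp add: m)
  interpret n: finite_measure "neg_part m" by (simp add: m)
  have i: "integrable (pos_part m) \<eta>" "integrable (neg_part m) \<eta>"
    using m c by (auto intro: integrable_continuous_circle)
  have b': "0 \<le> 1 - \<eta> x" "0 \<le> 1 + \<eta> x" for x using b[of x] by (auto simp: abs_le_iff)
  have 1: "(LINT x|pos_part m. 1 - \<eta> x) = measure (pos_part m) UNIV - (LINT x|pos_part m. \<eta> x)"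
    using i by simp
  have 2: "(LINT x|neg_part m. 1 + \<eta> x) = measure (neg_part m) UNIV + (LINT x|neg_part m. \<eta> x)"
    using i by simp
  have ge: "(LINT x|pos_part m. 1 - \<eta> x) \<ge> 0" "(LINT x|neg_part m. 1 + \<eta> x) \<ge> 0"
    by (rule Bochner_Integration.integral_nonneg, rule b')+
  have "(LINT x|pos_part m. 1 - \<eta> x) + (LINT x|neg_part m. 1 + \<eta> x) = 0"
    using eq 1 2 unfolding tv_norm_eq_total_variation[OF m] signed_integral_def total_variation_def
    by linarith
  then have z: "(LINT x|pos_part m. 1 - \<eta> x) = 0" "(LINT x|neg_part m. 1 + \<eta> x) = 0"
    using ge by linarith+
  have "AE x in pos_part m. 1 - \<eta> x = 0"
    using z(1) integral_nonneg_eq_0_iff_AE[of "pos_part m" "\<lambda>x. 1 - \<eta> x"] i b'(1) by simp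
  then show "AE x in pos_part m. \<eta> x = 1" by eventually_elim simp
  have "AE x in neg_part m. 1 + \<eta> x = 0"
    using z(2) integral_nonneg_eq_0_iff_AE[of "neg_part m" "\<lambda>x. 1 + \<eta> x"] i b'(2) by simp
  then show "AE x in neg_part m. \<eta> x = - 1" by eventually_elim simp
qed

section \<open>The Hilbert space of square-integrable functions\<close>

lemma L2_D:
  assumes "f \<in> L2"
  shows "f \<in> borel_measurable borel" "integrable haar (\<lambda>x. (f x)\<^sup>2)"
  using assms by (auto simp: L2_def cong: measurable_cong_sets)

lemma L2_I:
  assumes "f \<in> borel_measurable borel" "integrable haar (\<lambda>x. (f x)\<^sup>2)"
  shows "f \<in> L2"
  using assms by (auto simp: L2_def cong: measurable_cong_sets)

lemma L2_mult_integrable: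
  assumes "f \<in> L2" "g \<in> L2"
  shows "integrable haar (\<lambda>x. f x * g x)"
proof (rule Bochner_Integration.integrable_bound)
  show "integrable haar (\<lambda>x. (f x)\<^sup>2 + (g x)\<^sup>2)"
    using assms by (auto dest: L2_D)
  show "(\<lambda>x. f x * g x) \<in> borel_measurable haar"
    using L2_D(1)[OF assms(1)] L2_D(1)[OF assms(2)] by (simp cong: measurable_cong_sets)
  have "\<bar>a * b\<bar> \<le> a\<^sup>2 + b\<^sup>2" for a b :: real
    using zero_le_power2[of "a - b"] zero_le_power2[of "a + b"] zero_le_power2[of a] zero_le_power2[of b]
    unfolding power2_diff power2_sum abs_le_iff by linarith
  then show "AE x in haar. norm (f x * g x) \<le> norm ((f x)\<^sup>2 + (g x)\<^sup>2)"
    by (intro AE_I2) simp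
qed

lemma L2_lin:
  assumes "f \<in> L2" "g \<in> L2"
  shows "(\<lambda>x. a * f x + b * g x) \<in> L2"
proof (rule L2_I)
  show "(\<lambda>x. a * f x + b * g x) \<in> borel_measurable borel"
    using L2_D(1)[OF assms(1)] L2_D(1)[OF assms(2)] by simp
  have "integrable haar (\<lambda>x. a\<^sup>2 * (f x)\<^sup>2 + b\<^sup>2 * (g x)\<^sup>2 + 2 * a * b * (f x * g x))"
    using L2_D(2)[OF assms(1)] L2_D(2)[OF assms(2)] L2_mult_integrable[OF assms] by auto
  then show "integrable haar (\<lambda>x. (a * f x + b * g x)\<^sup>2)"
    by (simp add: power2_eq_square algebra_simps)
qed

lemma L2_add: "f \<in> L2 \<Longrightarrow> g \<in> L2 \<Longrightarrow> (\<lambda>x. f x + g x) \<in> L2"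
  using L2_lin[of f g 1 1] by simp

lemma L2_diff: "f \<in> L2 \<Longrightarrow> g \<in> L2 \<Longrightarrow> (\<lambda>x. f x - g x) \<in> L2"
  using L2_lin[of f g 1 "-1"] by simp

lemma L2_scale: "f \<in> L2 \<Longrightarrow> (\<lambda>x. c * f x) \<in> L2"
  using L2_lin[of f f c 0] by simp

lemma L2_continuous: "continuous_on UNIV f \<Longrightarrow> f \<in> L2"
  by (intro L2_I borel_measurable_continuous_onI integrable_continuous_circle haar.finite_measure_axioms
      continuous_intros) auto

lemma L2_inner_commute: "L2_inner f g = L2_inner g f"
  by (simp add: L2_inner_def mult.commute)

lemma L2_inner_lin:
  assumes "f \<in> L2" "g \<in> L2" "h \<in> L2"
  shows "L2_inner (\<lambda>x. a * f x + b * g x) h = a * L2_inner f h + b * L2_inner g h"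
proof -
  have "L2_inner (\<lambda>x. a * f x + b * g x) h = (LINT x|haar. a * (f x * h x) + b * (g x * h x))"
    unfolding L2_inner_def by (intro Bochner_Integration.integral_cong) (auto simp: algebra_simps)
  then show ?thesis
    using L2_mult_integrable[OF assms(1,3)] L2_mult_integrable[OF assms(2,3)]
    by (simp add: L2_inner_def)
qed

lemma L2_inner_lin_right:
  assumes "f \<in> L2" "g \<in> L2" "h \<in> L2"
  shows "L2_inner h (\<lambda>x. a * f x + b * g x) = a * L2_inner h f + b * L2_inner h g"
  using L2_inner_lin[OF assms] by (simp only: L2_inner_commute[of h])

lemma L2_inner_add: "f \<in> L2 \<Longrightarrow> g \<in> L2 \<Longrightarrow> h \<in> L2 \<Longrightarrow>
    L2_inner (\<lambda>x. f x + g x) h = L2_inner f h + L2_inner g h"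
  using L2_inner_lin[of f g h 1 1] by simp

lemma L2_inner_diff: "f \<in> L2 \<Longrightarrow> g \<in> L2 \<Longrightarrow> h \<in> L2 \<Longrightarrow>
    L2_inner (\<lambda>x. f x - g x) h = L2_inner f h - L2_inner g h"
  using L2_inner_lin[of f g h 1 "-1"] by simp

lemma L2_inner_scale: "f \<in> L2 \<Longrightarrow> h \<in> L2 \<Longrightarrow> L2_inner (\<lambda>x. c * f x) h = c * L2_inner f h"
  using L2_inner_lin[of f f h c 0] by simp

lemma L2_inner_diff_right: "f \<in> L2 \<Longrightarrow> g \<in> L2 \<Longrightarrow> h \<in> L2 \<Longrightarrow>
    L2_inner h (\<lambda>x. f x - g x) = L2_inner h f - L2_inner h g"
  using L2_inner_lin_right[of f g h 1 "-1"] by simp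

lemma L2_inner_quadratic:
  assumes "f \<in> L2" "g \<in> L2"
  shows "L2_inner (\<lambda>x. a * f x + b * g x) (\<lambda>x. a * f x + b * g x)
    = a\<^sup>2 * L2_inner f f + 2 * a * b * L2_inner f g + b\<^sup>2 * L2_inner g g"
  using assms
  by (simp add: L2_inner_lin L2_inner_lin_right L2_lin L2_inner_commute[of g f]
      power2_eq_square algebra_simps)

lemma L2_inner_nonneg [simp]: "L2_inner f f \<ge> 0"
  unfolding L2_inner_def by (rule Bochner_Integration.integral_nonneg) simp

lemma L2_norm_nonneg [simp]: "L2_norm f \<ge> 0"
  by (simp add: L2_norm_def)

lemma L2_norm_power2: "(L2_norm f)\<^sup>2 = L2_inner f f"
  by (simp add: L2_norm_def)

lemma L2_norm_power2_integral: "(L2_norm f)\<^sup>2 = (LINT x|haar. (f x)\<^sup>2)"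
  by (simp only: L2_norm_power2 L2_inner_def) (simp only: power2_eq_square)

lemma L2_Cauchy_Schwarz:
  assumes "f \<in> L2" "g \<in> L2"
  shows "\<bar>L2_inner f g\<bar> \<le> L2_norm f * L2_norm g"
proof -
  have q: "0 \<le> a\<^sup>2 * L2_inner f f + 2 * a * b * L2_inner f g + b\<^sup>2 * L2_inner g g" for a b
    unfolding L2_inner_quadratic[OF assms, symmetric] by simp
  have "(L2_inner f g)\<^sup>2 \<le> L2_inner f f * L2_inner g g"
  proof (cases "L2_inner g g = 0")
    case True
    have "L2_inner f g = 0"
    proof (rule ccontr)
      assume n: "L2_inner f g \<noteq> 0"
      \<comment> \<open>In this degenerate case the quadratic form is affine in b, and the chosen b
        gives it the value -1.\<close>
      show False
        using q[of 1 "- (L2_inner f f + 1) / (2 * L2_inner f g)"] n True by (simp add: field_simps)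
    qed
    then show ?thesis by (simp add: True)
  next
    case False
    then have "L2_inner g g > 0" using L2_inner_nonneg[of g] by linarith
    \<comment> \<open>The minimising combination of f and g, cleared of denominators.\<close>
    moreover have "0 \<le> L2_inner g g * (L2_inner f f * L2_inner g g - (L2_inner f g)\<^sup>2)"
      using q[of "L2_inner g g" "- L2_inner f g"] by (simp add: power2_eq_square algebra_simps)
    ultimately show ?thesis by (simp add: zero_le_mult_iff)
  qed
  then have "sqrt ((L2_inner f g)\<^sup>2) \<le> sqrt (L2_inner f f * L2_inner g g)" by (rule real_sqrt_le_mono)
  then show ?thesis by (simp add: L2_norm_def real_sqrt_mult)
qed

lemma L2_norm_add_le:
  assumes "f \<in> L2" "g \<in> L2"
  shows "L2_norm (\<lambda>x. f x + g x) \<le> L2_norm f + L2_norm g"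
proof (rule power2_le_imp_le)
  show "(L2_norm (\<lambda>x. f x + g x))\<^sup>2 \<le> (L2_norm f + L2_norm g)\<^sup>2"
    using L2_inner_quadratic[OF assms, of 1 1] L2_Cauchy_Schwarz[OF assms]
    by (simp add: L2_norm_power2 power2_sum)
qed simp

lemma L2_norm_diff_commute: "L2_norm (\<lambda>x. f x - g x) = L2_norm (\<lambda>x. g x - f x)"
  unfolding L2_norm_def L2_inner_def by (simp add: algebra_simps)

lemma L2_norm_diff_le:
  assumes "f \<in> L2" "g \<in> L2"
  shows "L2_norm (\<lambda>x. f x - g x) \<le> L2_norm f + L2_norm g"
  using L2_norm_add_le[OF assms(1) L2_scale[OF assms(2), of "-1"]]
  by (simp add: L2_norm_def L2_inner_def)

lemma L2_norm_triangle_diff: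
  assumes "f \<in> L2" "g \<in> L2"
  shows "\<bar>L2_norm f - L2_norm g\<bar> \<le> L2_norm (\<lambda>x. f x - g x)"
  using L2_norm_add_le[OF L2_diff[OF assms] assms(2)]
    L2_norm_add_le[OF L2_diff[OF assms(2,1)] assms(1)] L2_norm_diff_commute[of f g]
  by (simp add: abs_le_iff)

lemma L2_norm_scale: "L2_norm (\<lambda>x. c * f x) = \<bar>c\<bar> * L2_norm f"
proof -
  have "L2_inner (\<lambda>x. c * f x) (\<lambda>x. c * f x) = c\<^sup>2 * L2_inner f f"
    unfolding L2_inner_def by (subst integral_mult_right_zero[symmetric]) (simp add: power2_eq_square mult_ac)
  then show ?thesis by (simp add: L2_norm_def real_sqrt_mult)
qed

lemma L2_norm_eq_0_iff:
  assumes "f \<in> L2"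
  shows "L2_norm f = 0 \<longleftrightarrow> (AE x in haar. f x = 0)"
  using L2_D(2)[OF assms] unfolding L2_norm_def L2_inner_def
  by (simp add: power2_eq_square[symmetric] integral_nonneg_eq_0_iff_AE)

text \<open>Cauchy-Schwarz against the constant 1, whose norm is 1 because Haar measure is a
  probability.\<close>

lemma L2_integral_abs_le:
  assumes "f \<in> L2"
  shows "integrable haar f" "(LINT x|haar. \<bar>f x\<bar>) \<le> L2_norm f"
proof -
  have 1: "(\<lambda>x. 1) \<in> L2" by (intro L2_continuous continuous_intros)
  show "integrable haar f" using L2_mult_integrable[OF assms 1] by simp
  have "(\<lambda>x. \<bar>f x\<bar>) \<in> L2" using L2_D[OF assms] by (intro L2_I) auto
  from L2_Cauchy_Schwarz[OF this 1] show "(LINT x|haar. \<bar>f x\<bar>) \<le> L2_norm f"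
    by (simp add: L2_inner_def L2_norm_def haar.prob_space[simplified])
qed

text \<open>Riesz-Fischer: the sequence is also Cauchy in the mean, so a subsequence converges
  almost everywhere. Fatou's lemma along this subsequence bounds the distance of each late term to
  the limit, which gives norm convergence of the whole sequence.\<close>

lemma L2_complete:
  assumes s: "\<And>n. s n \<in> L2"
    and cauchy: "\<And>e. e > 0 \<Longrightarrow> \<exists>N. \<forall>i\<ge>N. \<forall>j\<ge>N. L2_norm (\<lambda>x. s i x - s j x) < e"
  obtains f where "f \<in> L2" "(\<lambda>n. L2_norm (\<lambda>x. s n x - f x)) \<longlonglongrightarrow> 0"
proof -
  have [measurable]: "s n \<in> borel_measurable haar" for n
    using L2_D(1)[OF s] by (simp cong: measurable_cong_sets)
  have L1: "\<exists>N. \<forall>i\<ge>N. \<forall>j\<ge>N. LINT x|haar. norm (s i x - s j x) < e" if "e > 0" for e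
  proof -
    obtain N where "\<forall>i\<ge>N. \<forall>j\<ge>N. L2_norm (\<lambda>x. s i x - s j x) < e" using cauchy[OF \<open>e > 0\<close>] by blast
    moreover have "(LINT x|haar. norm (s i x - s j x)) \<le> L2_norm (\<lambda>x. s i x - s j x)" for i j
      using L2_integral_abs_le(2)[OF L2_diff[OF s s]] by simp
    ultimately show ?thesis by (meson order_le_less_trans)
  qed
  obtain r where r: "strict_mono r" "AE x in haar. Cauchy (\<lambda>i. s (r i) x)"
    using cauchy_L1_AE_cauchy_subseq[OF L2_integral_abs_le(1)[OF s] L1] by blast
  define f where "f x = lim (\<lambda>i. s (r i) x)" for x
  have f_meas [measurable]: "f \<in> borel_measurable haar"
    unfolding f_def by measurable
  have lim: "AE x in haar. (\<lambda>i. s (r i) x) \<longlonglongrightarrow> f x"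
    using r(2) by eventually_elim (simp add: f_def Cauchy_convergent_iff convergent_LIMSEQ_iff)
  have key: "(\<integral>\<^sup>+x. ennreal ((s n x - f x)\<^sup>2) \<partial>haar) \<le> ennreal (e\<^sup>2)"
    if N: "\<And>i j. i \<ge> N \<Longrightarrow> j \<ge> N \<Longrightarrow> L2_norm (\<lambda>x. s i x - s j x) < e" and "n \<ge> N" for N n e
  proof -
    have "(\<integral>\<^sup>+x. ennreal ((s n x - f x)\<^sup>2) \<partial>haar)
        = (\<integral>\<^sup>+x. liminf (\<lambda>i. ennreal ((s n x - s (r i) x)\<^sup>2)) \<partial>haar)"
    proof (rule nn_integral_cong_AE)
      show "AE x in haar. ennreal ((s n x - f x)\<^sup>2) = liminf (\<lambda>i. ennreal ((s n x - s (r i) x)\<^sup>2))"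
        using lim
      proof eventually_elim
        case (elim x)
        then have "(\<lambda>i. ennreal ((s n x - s (r i) x)\<^sup>2)) \<longlonglongrightarrow> ennreal ((s n x - f x)\<^sup>2)"
          by (intro tendsto_intros) auto
        from lim_imp_Liminf[OF _ this] show ?case by simp
      qed
    qed
    also have "\<dots> \<le> liminf (\<lambda>i. \<integral>\<^sup>+x. ennreal ((s n x - s (r i) x)\<^sup>2) \<partial>haar)"
      by (rule nn_integral_liminf) simp
    also have "\<dots> \<le> liminf (\<lambda>i. ennreal (e\<^sup>2))"
    proof (rule Liminf_mono)
      show "\<forall>\<^sub>F i in sequentially. (\<integral>\<^sup>+x. ennreal ((s n x - s (r i) x)\<^sup>2) \<partial>haar) \<le> ennreal (e\<^sup>2)"
        using eventually_ge_at_top[of N]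
      proof eventually_elim
        case (elim i)
        have "r i \<ge> N" using elim seq_suble[OF r(1), of i] by simp
        have "(\<integral>\<^sup>+x. ennreal ((s n x - s (r i) x)\<^sup>2) \<partial>haar) = ennreal ((L2_norm (\<lambda>x. s n x - s (r i) x))\<^sup>2)"
          using L2_D(2)[OF L2_diff[OF s s, of n "r i"]]
          by (subst nn_integral_eq_integral) (auto simp: L2_norm_power2_integral)
        also have "\<dots> \<le> ennreal (e\<^sup>2)"
          using N[OF \<open>n \<ge> N\<close> \<open>r i \<ge> N\<close>] by (intro ennreal_leI power_mono) auto
        finally show ?case .
      qed
    qed
    finally show ?thesis by (simp add: Liminf_const)
  qed
  have diffL2: "(\<lambda>x. s n x - f x) \<in> L2" and small: "L2_norm (\<lambda>x. s n x - f x) \<le> e"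
    if N: "\<And>i j. i \<ge> N \<Longrightarrow> j \<ge> N \<Longrightarrow> L2_norm (\<lambda>x. s i x - s j x) < e" and "n \<ge> N" for N n e
  proof -
    have e: "e \<ge> 0" using N[of N N] L2_norm_nonneg[of "\<lambda>x. s N x - s N x"] by linarith
    have "integrable haar (\<lambda>x. (s n x - f x)\<^sup>2)"
      using key[OF that] by (intro integrableI_bounded) (auto simp: order_le_less_trans[OF _ ennreal_less_top])
    then show L: "(\<lambda>x. s n x - f x) \<in> L2" by (auto simp: L2_def)
    have "ennreal ((L2_norm (\<lambda>x. s n x - f x))\<^sup>2) \<le> ennreal (e\<^sup>2)"
      using key[OF that] nn_integral_eq_integral[OF L2_D(2)[OF L]] by (simp add: L2_norm_power2_integral)
    then show "L2_norm (\<lambda>x. s n x - f x) \<le> e"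
      using e by (auto simp: ennreal_le_iff2 intro: power2_le_imp_le)
  qed
  have "f \<in> L2"
  proof -
    obtain N where N: "\<forall>i\<ge>N. \<forall>j\<ge>N. L2_norm (\<lambda>x. s i x - s j x) < 1" using cauchy[of 1] by auto
    then have "(\<lambda>x. s N x - f x) \<in> L2" by (intro diffL2[of N 1 N]) auto
    from L2_diff[OF s[of N] this] show ?thesis by simp
  qed
  moreover have "(\<lambda>n. L2_norm (\<lambda>x. s n x - f x)) \<longlonglongrightarrow> 0"
  proof (rule LIMSEQ_I)
    fix e :: real assume "e > 0"
    then obtain N where "\<forall>i\<ge>N. \<forall>j\<ge>N. L2_norm (\<lambda>x. s i x - s j x) < e / 2" using cauchy[of "e/2"] by auto
    then have "L2_norm (\<lambda>x. s n x - f x) \<le> e / 2" if "n \<ge> N" for n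
      using that by (intro small[of N]) auto
    then show "\<exists>N. \<forall>n\<ge>N. norm (L2_norm (\<lambda>x. s n x - f x) - 0) < e"
      using \<open>e > 0\<close> by (intro exI[of _ N] allI impI) (simp add: order_le_less_trans[of _ "e / 2"])
  qed
  ultimately show ?thesis by (rule that)
qed

lemma L2_norm_tendsto:
  assumes "\<And>n. s n \<in> L2" "f \<in> L2" "(\<lambda>n. L2_norm (\<lambda>x. s n x - f x)) \<longlonglongrightarrow> 0"
  shows "(\<lambda>n. L2_norm (s n)) \<longlonglongrightarrow> L2_norm f"
proof -
  have "(\<lambda>n. L2_norm (s n) - L2_norm f) \<longlonglongrightarrow> 0"
    using L2_norm_triangle_diff[OF assms(1,2)] by (intro Lim_null_comparison[OF _ assms(3)]) simp
  then show ?thesis by (simp add: LIM_zero_iff)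
qed

lemma L2_inner_tendsto:
  assumes "\<And>n. s n \<in> L2" "f \<in> L2" "g \<in> L2" "(\<lambda>n. L2_norm (\<lambda>x. s n x - f x)) \<longlonglongrightarrow> 0"
  shows "(\<lambda>n. L2_inner g (s n)) \<longlonglongrightarrow> L2_inner g f"
proof -
  have "norm (L2_inner g (s n) - L2_inner g f) \<le> L2_norm g * L2_norm (\<lambda>x. s n x - f x)" for n
    using L2_Cauchy_Schwarz[OF assms(3) L2_diff[OF assms(1,2)], of n] assms
    by (simp add: L2_inner_diff_right)
  then have "(\<lambda>n. L2_inner g (s n) - L2_inner g f) \<longlonglongrightarrow> 0"
    by (rule Lim_null_comparison[OF always_eventually[OF allI] tendsto_mult_right_zero[OF assms(4)]])
  then show ?thesis by (simp add: LIM_zero_iff)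
qed

lemma L2_parallelogram:
  assumes "f \<in> L2" "g \<in> L2"
  shows "L2_inner (\<lambda>x. f x - g x) (\<lambda>x. f x - g x) + 4 * L2_inner (\<lambda>x. (f x + g x) / 2) (\<lambda>x. (f x + g x) / 2)
    = 2 * L2_inner f f + 2 * L2_inner g g"
  using L2_inner_quadratic[OF assms, of 1 "-1"] L2_inner_quadratic[OF assms, of "1/2" "1/2"]
  by (simp add: power2_eq_square algebra_simps add_divide_distrib)

text \<open>Almost minimal elements of the sets form a Cauchy sequence by the parallelogram law.\<close>

lemma L2_nested_convex:
  fixes C :: "nat \<Rightarrow> (circle \<Rightarrow> real) set"
  assumes sub: "\<And>n. C n \<subseteq> L2" and dec: "decseq C"
    and mid: "\<And>n f g. f \<in> C n \<Longrightarrow> g \<in> C n \<Longrightarrow> (\<lambda>x. (f x + g x) / 2) \<in> C n"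
    and closed: "\<And>n s f. (\<And>k. s k \<in> C n) \<Longrightarrow> f \<in> L2 \<Longrightarrow>
      (\<lambda>k. L2_norm (\<lambda>x. s k x - f x)) \<longlonglongrightarrow> 0 \<Longrightarrow> f \<in> C n"
    and ne: "\<And>n. \<exists>f\<in>C n. L2_inner f f \<le> B"
  obtains p where "\<And>n. p \<in> C n"
    "\<And>e. e > 0 \<Longrightarrow> \<exists>n. \<forall>f\<in>C n. L2_inner p p - e < L2_inner f f"
proof -
  define d where "d n = (INF f\<in>C n. L2_inner f f)" for n
  have C_ne: "C n \<noteq> {}" for n using ne by blast
  have bdd: "bdd_below ((\<lambda>f. L2_inner f f) ` C n)" for n
    by (intro bdd_belowI[of _ 0]) auto
  have d_le: "d n \<le> L2_inner f f" if "f \<in> C n" for n f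
    unfolding d_def by (rule cINF_lower[OF bdd that])
  have d_mono: "incseq d"
    unfolding d_def incseq_def
    using C_ne decseqD[OF dec] by (intro allI impI cINF_superset_mono bdd) auto
  have dB: "d n \<le> B" for n
    using ne[of n] d_le by (meson order_trans)
  obtain D where D: "d \<longlonglongrightarrow> D" "\<And>n. d n \<le> D"
    using incseq_convergent[OF d_mono, of B] dB by auto
  have "\<exists>f\<in>C n. L2_inner f f < d n + 1 / (n + 1)" for n
    using cINF_less_iff[OF C_ne bdd, of n "d n + 1 / (n + 1)"] unfolding d_def[symmetric]
    by (simp add: add.commute)
  then obtain q where q: "\<And>n. q n \<in> C n" "\<And>n. L2_inner (q n) (q n) < d n + 1 / (n + 1)"
    by metis
  have qL: "q n \<in> L2" for n using q(1) sub by blast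
  \<comment> \<open>The midpoint lies in the larger set \<open>C i\<close>, so its squared norm is
    at least \<open>d i\<close>. The parallelogram law subtracts four times this value, and
    \<open>d j \<le> D\<close>.\<close>
  have near: "L2_inner (\<lambda>x. q i x - q j x) (\<lambda>x. q i x - q j x) \<le> 2 * (D - d i) + 4 / (i + 1)"
    if "i \<le> j" for i j
  proof -
    have "q j \<in> C i" using q(1)[of j] decseqD[OF dec that] by blast
    then have "d i \<le> L2_inner (\<lambda>x. (q i x + q j x) / 2) (\<lambda>x. (q i x + q j x) / 2)"
      using q(1) by (intro d_le mid)
    moreover have "1 / (real j + 1) \<le> 1 / (real i + 1)"
      using that by (intro divide_left_mono) auto
    ultimately show ?thesis
      using L2_parallelogram[OF qL[of i] qL[of j]] q(2)[of i] q(2)[of j] D(2)[of j]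
      by (simp add: algebra_simps)
  qed
  have lim0: "(\<lambda>i. 2 * (D - d i) + 4 / (real i + 1)) \<longlonglongrightarrow> 2 * (D - D) + 0"
    using tendsto_mult[OF tendsto_const[of 4] LIMSEQ_inverse_real_of_nat]
    by (intro tendsto_intros D(1)) (simp add: divide_inverse add.commute)
  have cauchy: "\<exists>N. \<forall>i\<ge>N. \<forall>j\<ge>N. L2_norm (\<lambda>x. q i x - q j x) < e" if e: "e > 0" for e
  proof -
    obtain N where N: "\<And>i. i \<ge> N \<Longrightarrow> 2 * (D - d i) + 4 / (real i + 1) < e\<^sup>2"
      using order_tendstoD(2)[OF lim0, of "e\<^sup>2"] e by (auto simp: eventually_sequentially)
    have *: "L2_norm (\<lambda>x. q i x - q j x) < e" if "N \<le> i" "i \<le> j" for i j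
      using near[OF that(2)] N[OF that(1)] e
      by (intro power2_less_imp_less[of _ e]) (auto simp: L2_norm_power2)
    have "L2_norm (\<lambda>x. q i x - q j x) < e" if "N \<le> i" "N \<le> j" for i j
    proof (cases "i \<le> j")
      case True
      then show ?thesis using *[OF that(1)] by blast
    next
      case False
      then show ?thesis using *[OF that(2), of i] L2_norm_diff_commute[of "q i" "q j"] by simp
    qed
    then show ?thesis by blast
  qed
  obtain p where p: "p \<in> L2" "(\<lambda>n. L2_norm (\<lambda>x. q n x - p x)) \<longlonglongrightarrow> 0"
    using L2_complete[OF qL cauchy] by blast
  have pC: "p \<in> C n" for n
  proof (rule closed[OF _ p(1)])
    show "q (k + n) \<in> C n" for k using q(1)[of "k + n"] decseqD[OF dec, of n "k+n"] by auto
    show "(\<lambda>k. L2_norm (\<lambda>x. q (k + n) x - p x)) \<longlonglongrightarrow> 0" by (rule LIMSEQ_ignore_initial_segment[OF p(2)])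
  qed
  have "(\<lambda>n. (L2_norm (q n))\<^sup>2) \<longlonglongrightarrow> (L2_norm p)\<^sup>2"
    by (intro tendsto_intros L2_norm_tendsto[OF qL p])
  moreover have "(\<lambda>n. d n + (2 * (D - d n) + 4 / (real n + 1))) \<longlonglongrightarrow> D + (2 * (D - D) + 0)"
    by (intro tendsto_add D(1) lim0)
  ultimately have "(L2_norm p)\<^sup>2 \<le> D + (2 * (D - D) + 0)"
  proof (rule LIMSEQ_le)
    have "(L2_norm (q n))\<^sup>2 \<le> d n + (2 * (D - d n) + 4 / (real n + 1))" for n
    proof -
      have "d n + 1 / (real n + 1) \<le> d n + (0 + 4 / (real n + 1))"
        by (simp add: divide_right_mono)
      also have "\<dots> \<le> d n + (2 * (D - d n) + 4 / (real n + 1))"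
        using D(2)[of n] by (intro add_left_mono add_right_mono) simp
      finally show ?thesis using q(2)[of n] unfolding L2_norm_power2 by linarith
    qed
    then show "\<exists>N. \<forall>n\<ge>N. (L2_norm (q n))\<^sup>2 \<le> d n + (2 * (D - d n) + 4 / (real n + 1))" by blast
  qed
  then have pD: "L2_inner p p \<le> D" by (simp add: L2_norm_power2)
  show ?thesis
  \<comment> \<open>The squared norm of p is at most D, and the infima \<open>d n\<close> come
    within e of D.\<close>
  proof (rule that[OF pC])
    fix e :: real assume "e > 0"
    then obtain n where "D - e < d n"
      using order_tendstoD(1)[OF D(1), of "D - e"] by (auto simp: eventually_sequentially)
    then show "\<exists>n. \<forall>f\<in>C n. L2_inner p p - e < L2_inner f f"
      using pD d_le by (intro exI[of _ n]) force
  qed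
qed

section \<open>The convolution operator and its adjoint\<close>

lemma continuous_circle_compose_minus:
  fixes \<phi> :: "circle \<Rightarrow> real"
  assumes "continuous_on UNIV \<phi>"
  shows "continuous_on UNIV (\<lambda>x. \<phi> (x - t))" "continuous_on UNIV (\<lambda>x. \<phi> (t - x))"
  by (rule continuous_on_compose2[OF assms], intro continuous_intros, simp)+

lemma continuous_circle_uniform:
  fixes \<phi> :: "circle \<Rightarrow> real"
  assumes "continuous_on UNIV \<phi>" "e > 0"
  obtains d where "d > 0" "\<And>u v. dist u v < d \<Longrightarrow> \<bar>\<phi> u - \<phi> v\<bar> < e"
  using compact_uniformly_continuous[OF assms(1) compact_UNIV_circle] assms(2)
  unfolding uniformly_continuous_on_def dist_real_def by (metis UNIV_I)

lemma Phi_adj_eq_inner: "Phi_adj \<phi> p t = L2_inner (\<lambda>x. \<phi> (t - x)) p"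
  by (simp add: Phi_adj_def L2_inner_def)

lemma Phi_adj_integrable:
  assumes "continuous_on UNIV \<phi>" "p \<in> L2"
  shows "integrable haar (\<lambda>x. \<phi> (t - x) * p x)"
  by (intro L2_mult_integrable L2_continuous continuous_circle_compose_minus assms)

lemma Phi_adj_lin:
  assumes "continuous_on UNIV \<phi>" "p \<in> L2" "q \<in> L2"
  shows "Phi_adj \<phi> (\<lambda>x. a * p x + b * q x) t = a * Phi_adj \<phi> p t + b * Phi_adj \<phi> q t"
  unfolding Phi_adj_eq_inner
  by (intro L2_inner_lin_right L2_continuous continuous_circle_compose_minus assms)

lemma integral_mult_L2_bound:
  assumes "p \<in> L2" "continuous_on UNIV f" "\<And>x. \<bar>f x\<bar> \<le> B"
  shows "\<bar>LINT x|haar. f x * p x\<bar> \<le> B * L2_norm p"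
proof -
  have B: "B \<ge> 0" using assms(3)[of undefined] abs_ge_zero order_trans by blast
  have i: "integrable haar (\<lambda>x. f x * p x)"
    by (intro L2_mult_integrable L2_continuous assms)
  have "\<bar>LINT x|haar. f x * p x\<bar> \<le> (LINT x|haar. \<bar>f x * p x\<bar>)"
    by (rule integral_abs_bound)
  also have "\<dots> \<le> (LINT x|haar. B * \<bar>p x\<bar>)"
    using integrable_abs[OF i] L2_integral_abs_le(1)[OF assms(1)] assms(3)
    by (intro integral_mono) (auto simp: abs_mult mult_right_mono)
  also have "\<dots> \<le> B * L2_norm p"
    using L2_integral_abs_le(2)[OF assms(1)] B by (simp add: mult_left_mono)
  finally show ?thesis .
qed

lemma Phi_adj_bound:
  assumes "continuous_on UNIV \<phi>" "\<And>x. \<bar>\<phi> x\<bar> \<le> B" "p \<in> L2"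
  shows "\<bar>Phi_adj \<phi> p t\<bar> \<le> B * L2_norm p"
  unfolding Phi_adj_def
  by (intro integral_mult_L2_bound continuous_circle_compose_minus assms)

lemma Phi_adj_diff_bound:
  assumes "continuous_on UNIV \<phi>" "\<And>x. \<bar>\<phi> x\<bar> \<le> B" "p \<in> L2" "q \<in> L2"
  shows "\<bar>Phi_adj \<phi> p t - Phi_adj \<phi> q t\<bar> \<le> B * L2_norm (\<lambda>x. p x - q x)"
  using Phi_adj_bound[OF assms(1,2) L2_diff[OF assms(3,4)], of t]
    Phi_adj_lin[OF assms(1,3,4), of 1 "-1" t] by simp

lemma continuous_Phi_adj:
  assumes c: "continuous_on UNIV \<phi>" and p: "p \<in> L2"
  shows "continuous_on UNIV (Phi_adj \<phi> p)"
  unfolding continuous_on_iff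
proof safe
  fix t :: circle and e :: real assume e: "e > 0"
  define e' where "e' = e / (L2_norm p + 1)"
  have "L2_norm p + 1 > 0" using L2_norm_nonneg[of p] by linarith
  then have e': "e' > 0" "e' * L2_norm p < e"
    using e by (auto simp: e'_def field_simps)
  obtain d where d: "d > 0" "\<And>u v. dist u v < d \<Longrightarrow> \<bar>\<phi> u - \<phi> v\<bar> < e'"
    using continuous_circle_uniform[OF c e'(1)] by blast
  show "\<exists>d>0. \<forall>s\<in>UNIV. dist s t < d \<longrightarrow> dist (Phi_adj \<phi> p s) (Phi_adj \<phi> p t) < e"
  proof (intro exI[of _ d] conjI ballI impI d(1))
    fix s assume "dist s t < d"
    then have "\<bar>\<phi> (s - x) - \<phi> (t - x)\<bar> \<le> e'" for x
      using d(2)[of "s - x" "t - x"] dist_circle_translate[of s "- x" t] by simp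
    then have "\<bar>LINT x|haar. (\<phi> (s - x) - \<phi> (t - x)) * p x\<bar> \<le> e' * L2_norm p"
      by (intro integral_mult_L2_bound p continuous_on_diff continuous_circle_compose_minus c)
    moreover have "(LINT x|haar. (\<phi> (s - x) - \<phi> (t - x)) * p x) = Phi_adj \<phi> p s - Phi_adj \<phi> p t"
      unfolding Phi_adj_def left_diff_distrib
      by (intro Bochner_Integration.integral_diff Phi_adj_integrable c p)
    ultimately show "dist (Phi_adj \<phi> p s) (Phi_adj \<phi> p t) < e"
      using e'(2) by (simp add: dist_real_def)
  qed
qed

text \<open>The first-order remainder of \<phi> is at most e' |h| uniformly in the base point, so
  its integral against p is at most e' |h| times the norm of p; no dominating function is
  needed.\<close>

lemma Phi_adj_deriv:
  assumes \<phi>: "circle_differentiable \<phi>" and c': "continuous_on UNIV (circle_deriv \<phi>)" and p: "p \<in> L2"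
  shows "circle_differentiable (Phi_adj \<phi> p)"
    "circle_deriv (Phi_adj \<phi> p) = Phi_adj (circle_deriv \<phi>) p"
proof -
  have c: "continuous_on UNIV \<phi>" by (rule circle_differentiable_continuous[OF \<phi>])
  have "((\<lambda>s. Phi_adj \<phi> p (t + circ s)) has_real_derivative Phi_adj (circle_deriv \<phi>) p t) (at 0)" for t
    unfolding has_field_derivative_def has_derivative_at_alt
  proof (intro conjI allI impI bounded_linear_mult_right)
    fix e :: real assume e: "e > 0"
    define e' where "e' = e / (L2_norm p + 1)"
    have "L2_norm p + 1 > 0" using L2_norm_nonneg[of p] by linarith
    then have e': "e' > 0" "e' * L2_norm p \<le> e"
      using e by (auto simp: e'_def field_simps)
    obtain d where d: "d > 0"
      "\<And>u h. \<bar>h\<bar> < d \<Longrightarrow> \<bar>\<phi> (u + circ h) - \<phi> u - h * circle_deriv \<phi> u\<bar> \<le> e' * \<bar>h\<bar>"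
      using circle_deriv_uniform[OF \<phi> c' e'(1)] by blast
    show "\<exists>d>0. \<forall>y. norm (y - 0) < d \<longrightarrow> norm (Phi_adj \<phi> p (t + circ y) - Phi_adj \<phi> p (t + circ 0) -
            Phi_adj (circle_deriv \<phi>) p t * (y - 0)) \<le> e * norm (y - 0)"
    proof (intro exI[of _ d] conjI allI impI d(1))
      fix h :: real assume "norm (h - 0) < d"
      then have h: "\<bar>h\<bar> < d" by simp
      have "\<bar>\<phi> (t + circ h - x) - \<phi> (t - x) - h * circle_deriv \<phi> (t - x)\<bar> \<le> e' * \<bar>h\<bar>" for x
        using d(2)[OF h, of "t - x"] by (simp add: algebra_simps)
      then have "\<bar>LINT x|haar. (\<phi> (t + circ h - x) - \<phi> (t - x) - h * circle_deriv \<phi> (t - x)) * p x\<bar>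
          \<le> (e' * \<bar>h\<bar>) * L2_norm p"
        by (intro integral_mult_L2_bound p continuous_on_diff continuous_on_mult continuous_on_const
            continuous_circle_compose_minus c c')
      also have "\<dots> = (e' * L2_norm p) * \<bar>h\<bar>" by simp
      also have "\<dots> \<le> e * \<bar>h\<bar>" using e'(2) by (rule mult_right_mono) simp
      also have "(LINT x|haar. (\<phi> (t + circ h - x) - \<phi> (t - x) - h * circle_deriv \<phi> (t - x)) * p x)
          = (LINT x|haar. \<phi> (t + circ h - x) * p x - \<phi> (t - x) * p x - h * (circle_deriv \<phi> (t - x) * p x))"
        by (simp add: algebra_simps)
      also have "\<dots> = Phi_adj \<phi> p (t + circ h) - Phi_adj \<phi> p t - h * Phi_adj (circle_deriv \<phi>) p t"
        using Phi_adj_integrable[OF c p] Phi_adj_integrable[OF c' p] by (simp add: Phi_adj_def)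
      finally show "norm (Phi_adj \<phi> p (t + circ h) - Phi_adj \<phi> p (t + circ 0) -
            Phi_adj (circle_deriv \<phi>) p t * (h - 0)) \<le> e * norm (h - 0)"
        by (simp add: circ_0 mult.commute)
    qed
  qed
  then show "circle_differentiable (Phi_adj \<phi> p)"
    "circle_deriv (Phi_adj \<phi> p) = Phi_adj (circle_deriv \<phi>) p"
    by (rule circle_derivI)+
qed

lemma Phi_adj_deriv2:
  assumes "C2_circle \<phi>" "p \<in> L2"
  shows "circle_differentiable (Phi_adj \<phi> p)" "circle_differentiable (circle_deriv (Phi_adj \<phi> p))"
    "circle_deriv (circle_deriv (Phi_adj \<phi> p)) = Phi_adj (circle_deriv (circle_deriv \<phi>)) p"
  using assms C2_circle_continuous[OF assms(1)] by (auto simp: C2_circle_def Phi_adj_deriv)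

lemma continuous_Phi:
  assumes c: "continuous_on UNIV \<phi>" and m: "m \<in> radon_measures"
  shows "continuous_on UNIV (Phi \<phi> m)"
  unfolding continuous_on_iff
proof safe
  fix t :: circle and e :: real assume e: "e > 0"
  define e' where "e' = e / (tv_norm m + 1)"
  have "tv_norm m + 1 > 0" using tv_norm_nonneg[OF m] by linarith
  then have e': "e' > 0" "e' * tv_norm m < e"
    using e by (auto simp: e'_def field_simps)
  obtain d where d: "d > 0" "\<And>u v. dist u v < d \<Longrightarrow> \<bar>\<phi> u - \<phi> v\<bar> < e'"
    using continuous_circle_uniform[OF c e'(1)] by blast
  show "\<exists>d>0. \<forall>s\<in>UNIV. dist s t < d \<longrightarrow> dist (Phi \<phi> m s) (Phi \<phi> m t) < e"
  proof (intro exI[of _ d] conjI ballI impI d(1))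
    fix s assume "dist s t < d"
    then have "\<bar>\<phi> (x - s) - \<phi> (x - t)\<bar> \<le> e'" for x
      using d(2)[of "x - s" "x - t"] dist_circle_reflect[of x s t] by simp
    then have "\<bar>signed_integral m (\<lambda>x. \<phi> (x - s) - \<phi> (x - t))\<bar> \<le> e' * tv_norm m"
      by (intro signed_integral_abs_le m continuous_on_diff continuous_circle_compose_minus c)
    then show "dist (Phi \<phi> m s) (Phi \<phi> m t) < e"
      using e'(2) signed_integral_diff[OF m continuous_circle_compose_minus(1)[OF c, of s]
          continuous_circle_compose_minus(1)[OF c, of t]]
      by (simp add: dist_real_def Phi_def)
  qed
qed

lemma Phi_L2: "continuous_on UNIV \<phi> \<Longrightarrow> m \<in> radon_measures \<Longrightarrow> Phi \<phi> m \<in> L2"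
  by (intro L2_continuous continuous_Phi)

lemma Phi_linear:
  assumes c: "continuous_on UNIV \<phi>" and m: "m1 \<in> radon_measures" "m2 \<in> radon_measures"
  shows "Phi \<phi> (\<lambda>A. a * m1 A + b * m2 A) t = a * Phi \<phi> m1 t + b * Phi \<phi> m2 t"
proof -
  obtain B where "\<And>x. \<bar>\<phi> x\<bar> \<le> B" using continuous_circle_bounded[OF c] by blast
  then show ?thesis
    unfolding Phi_def
    by (intro signed_integral_linear m borel_measurable_continuous_onI continuous_circle_compose_minus c)
qed

text \<open>Joint integrability holds because the inner integral of |\<phi>(x - t) q(t)| is bounded
  uniformly in x and M is finite. Positive M suffices, since the result is applied to each Jordan
  part.\<close>

lemma Fubini_convolution:
  assumes c: "continuous_on UNIV \<phi>" and q: "q \<in> L2"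
    and M: "finite_measure M" "sets M = sets (borel :: circle measure)"
  shows "(LINT t|haar. (LINT x|M. \<phi> (x - t)) * q t) = (LINT x|M. Phi_adj \<phi> q x)"
    "integrable haar (\<lambda>t. (LINT x|M. \<phi> (x - t)) * q t)"
proof -
  interpret M: finite_measure M by fact
  interpret P: pair_sigma_finite M haar ..
  \<comment> \<open>The kernel is continuous in both variables jointly, hence measurable for the
    Borel sets of the product, which are those of the product measure.\<close>
  have sM: "sets (M \<Otimes>\<^sub>M haar) = sets (borel :: (circle \<times> circle) measure)"
    using M(2) by (subst borel_prod[symmetric]) (intro sets_pair_measure_cong, simp_all)
  have "continuous_on UNIV (\<lambda>z::circle \<times> circle. \<phi> (fst z - snd z))"
    by (rule continuous_on_compose2[OF c]) (auto intro!: continuous_intros)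
  then have "(\<lambda>z. \<phi> (fst z - snd z)) \<in> borel_measurable (M \<Otimes>\<^sub>M haar)"
    using borel_measurable_continuous_onI measurable_cong_sets[OF sM refl] by blast
  moreover have "(\<lambda>z. q (snd z)) \<in> borel_measurable (M \<Otimes>\<^sub>M haar)"
    using L2_D(1)[OF q] measurable_snd''[of q haar borel M] by (simp cong: measurable_cong_sets)
  ultimately have meas: "(\<lambda>z. \<phi> (fst z - snd z) * q (snd z)) \<in> borel_measurable (M \<Otimes>\<^sub>M haar)"
    by simp
  obtain B where B: "\<And>x. \<bar>\<phi> x\<bar> \<le> B" using continuous_circle_bounded[OF c] by blast
  have aq: "(\<lambda>x. \<bar>q x\<bar>) \<in> L2" using L2_D[OF q] by (intro L2_I) auto
  have int: "integrable (M \<Otimes>\<^sub>M haar) (\<lambda>z. \<phi> (fst z - snd z) * q (snd z))"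
  proof (rule P.Fubini_integrable[OF meas])
    have "\<bar>LINT t|haar. \<bar>\<phi> (x - t)\<bar> * \<bar>q t\<bar>\<bar> \<le> B * L2_norm (\<lambda>x. \<bar>q x\<bar>)" for x
      using B by (intro integral_mult_L2_bound aq continuous_on_rabs continuous_circle_compose_minus c) auto
    moreover have "(\<lambda>x. LINT t|haar. \<bar>\<phi> (x - t) * q t\<bar>) \<in> borel_measurable M"
      using haar.borel_measurable_lebesgue_integral[of "\<lambda>x t. \<bar>\<phi> (x - t) * q t\<bar>" M] meas
      by (simp add: case_prod_beta')
    ultimately show "integrable M (\<lambda>x. LINT t|haar. norm (\<phi> (fst (x, t) - snd (x, t)) * q (snd (x, t))))"
      by (intro M.integrable_const_bound[of _ "B * L2_norm (\<lambda>x. \<bar>q x\<bar>)"]) (auto simp: abs_mult)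
    show "AE x in M. integrable haar (\<lambda>t. \<phi> (fst (x, t) - snd (x, t)) * q (snd (x, t)))"
      using Phi_adj_integrable[OF c q] by simp
  qed
  then have int': "integrable (M \<Otimes>\<^sub>M haar) (\<lambda>(x, t). \<phi> (x - t) * q t)"
    by (simp add: case_prod_beta')
  show "(LINT t|haar. (LINT x|M. \<phi> (x - t)) * q t) = (LINT x|M. Phi_adj \<phi> q x)"
    using P.Fubini_integral[OF int'] by (simp add: Phi_adj_def)
  show "integrable haar (\<lambda>t. (LINT x|M. \<phi> (x - t)) * q t)"
    using P.integrable_snd[OF int'] by simp
qed

lemma Phi_adjoint:
  assumes c: "continuous_on UNIV \<phi>" and q: "q \<in> L2" and m: "m \<in> radon_measures"
  shows "L2_inner (Phi \<phi> m) q = signed_integral m (Phi_adj \<phi> q)"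
proof -
  note F = Fubini_convolution[OF c q]
  have "L2_inner (Phi \<phi> m) q = (LINT t|haar. (LINT x|pos_part m. \<phi> (x - t)) * q t
      - (LINT x|neg_part m. \<phi> (x - t)) * q t)"
    by (simp add: L2_inner_def Phi_def signed_integral_def left_diff_distrib)
  also have "\<dots> = signed_integral m (Phi_adj \<phi> q)"
    using F[of "pos_part m"] F[of "neg_part m"] m by (simp add: signed_integral_def)
  finally show ?thesis .
qed

section \<open>Optimality conditions\<close>

lemma D0_feasible_iff: "p \<in> D0_feasible \<phi> \<longleftrightarrow> p \<in> L2 \<and> (\<forall>t. \<bar>Phi_adj \<phi> p t\<bar> \<le> 1)"
  by (simp add: D0_feasible_def)

lemma D0_feasible_inner_le:
  assumes c: "continuous_on UNIV \<phi>" and q: "q \<in> D0_feasible \<phi>" and m: "m \<in> radon_measures"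
  shows "L2_inner (Phi \<phi> m) q \<le> tv_norm m"
  using q signed_integral_le_tv_norm[OF m continuous_Phi_adj[OF c]] Phi_adjoint[OF c _ m]
  by (simp add: D0_feasible_iff)

text \<open>Division by t and t \<rightarrow> 0 remove the quadratic term. The restriction t \<le> 1
  leaves room for perturbations that rescale a measure by 1 - t.\<close>

lemma le_of_quadratic_perturbation:
  fixes a L C :: real
  assumes "\<And>t. 0 < t \<Longrightarrow> t \<le> 1 \<Longrightarrow> t * a \<le> t * L + t\<^sup>2 * C"
  shows "a \<le> L"
proof (rule field_le_epsilon)
  fix e :: real assume e: "e > 0"
  define t where "t = min 1 (e / (\<bar>C\<bar> + 1))"
  have t: "0 < t" "t \<le> 1" "t \<le> e / (\<bar>C\<bar> + 1)" using e by (auto simp: t_def)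
  have "t * a \<le> t * (L + t * C)"
    using assms[OF t(1,2)] by (simp add: power2_eq_square algebra_simps)
  then have "a \<le> L + t * C" using t(1) by simp
  also have "t * C \<le> t * (\<bar>C\<bar> + 1)" using t(1) by (intro mult_left_mono) auto
  also have "\<dots> \<le> e" using t(3) by (simp add: field_simps)
  finally show "a \<le> L + e" by simp
qed

text \<open>The fidelity is expanded exactly, while the change of the norm is left to be estimated
  for each kind of perturbation. The factor 1 keeps the shape of \<open>radon_linear\<close> and
  \<open>Phi_linear\<close>.\<close>

lemma P_objective_perturb:
  assumes c: "continuous_on UNIV \<phi>" and y: "y \<in> L2"
    and m: "m \<in> radon_measures" and n: "n \<in> radon_measures"
  shows "P_objective \<phi> lam y (\<lambda>A. 1 * m A + t * n A) - P_objective \<phi> lam y m =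
    t\<^sup>2 / 2 * L2_inner (Phi \<phi> n) (Phi \<phi> n) - t * L2_inner (Phi \<phi> n) (\<lambda>x. y x - Phi \<phi> m x)
    + lam * (tv_norm (\<lambda>A. 1 * m A + t * n A) - tv_norm m)"
proof -
  let ?r = "\<lambda>x. y x - Phi \<phi> m x"
  have r: "?r \<in> L2" by (intro L2_diff y Phi_L2 c m)
  have n': "Phi \<phi> n \<in> L2" by (intro Phi_L2 c n)
  have "(L2_norm (\<lambda>x. Phi \<phi> (\<lambda>A. 1 * m A + t * n A) x - y x))\<^sup>2
      = L2_inner (\<lambda>x. t * Phi \<phi> n x + (- 1) * ?r x) (\<lambda>x. t * Phi \<phi> n x + (- 1) * ?r x)"
    unfolding L2_norm_power2 Phi_linear[OF c m n] by (simp add: algebra_simps)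
  also have "\<dots> = t\<^sup>2 * L2_inner (Phi \<phi> n) (Phi \<phi> n) - 2 * t * L2_inner (Phi \<phi> n) ?r + L2_inner ?r ?r"
    using L2_inner_quadratic[OF n' r, of t "-1"] by simp
  also have "L2_inner ?r ?r = (L2_norm (\<lambda>x. Phi \<phi> m x - y x))\<^sup>2"
    by (simp add: L2_norm_power2 L2_inner_def algebra_simps)
  finally show ?thesis
    by (simp add: P_objective_def algebra_simps)
qed

lemma tv_norm_add_dirac_le:
  assumes m: "m \<in> radon_measures"
  shows "tv_norm (\<lambda>A. 1 * m A + t * scaled_dirac 1 z A) \<le> tv_norm m + \<bar>t\<bar>"
proof (rule tv_norm_leI)
  fix \<psi> :: "circle \<Rightarrow> real" assume \<psi>: "continuous_on UNIV \<psi>" "\<And>x. \<bar>\<psi> x\<bar> \<le> 1"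
  note b = borel_measurable_continuous_onI[OF \<psi>(1)]
  have "signed_integral (\<lambda>A. 1 * m A + t * scaled_dirac 1 z A) \<psi> = signed_integral m \<psi> + t * \<psi> z"
    using signed_integral_linear[OF m scaled_dirac_radon b \<psi>(2), of 1 t]
      signed_integral_scaled_dirac[OF b \<psi>(2)] by simp
  moreover have "t * \<psi> z \<le> \<bar>t\<bar> * 1"
    using mult_left_mono[OF \<psi>(2)[of z] abs_ge_zero[of t]] abs_ge_self[of "t * \<psi> z"]
    by (simp add: abs_mult)
  ultimately show "signed_integral (\<lambda>A. 1 * m A + t * scaled_dirac 1 z A) \<psi> \<le> tv_norm m + \<bar>t\<bar>"
    using signed_integral_le_tv_norm[OF m \<psi>] by simp
qed

text \<open>With 1 + t nonnegative the bound is linear in t on both sides of 0, so the first-order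
  condition in this direction becomes an equality.\<close>

lemma tv_norm_rescale_le:
  assumes m: "m \<in> radon_measures" and t: "t \<ge> - 1"
  shows "tv_norm (\<lambda>A. 1 * m A + t * m A) \<le> (1 + t) * tv_norm m"
proof (rule tv_norm_leI)
  fix \<psi> :: "circle \<Rightarrow> real" assume \<psi>: "continuous_on UNIV \<psi>" "\<And>x. \<bar>\<psi> x\<bar> \<le> 1"
  have "signed_integral (\<lambda>A. 1 * m A + t * m A) \<psi> = (1 + t) * signed_integral m \<psi>"
    using signed_integral_linear[OF m m borel_measurable_continuous_onI[OF \<psi>(1)] \<psi>(2), of 1 t]
    by (simp add: algebra_simps)
  also have "\<dots> \<le> (1 + t) * tv_norm m"
    using t signed_integral_le_tv_norm[OF m \<psi>] by (intro mult_left_mono) auto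
  finally show "signed_integral (\<lambda>A. 1 * m A + t * m A) \<psi> \<le> (1 + t) * tv_norm m" .
qed

text \<open>First-order conditions, from adding multiples of a Dirac mass and from rescaling the solution.\<close>

lemma P_solution_dual:
  assumes c: "continuous_on UNIV \<phi>" and y: "y \<in> L2" and lam: "lam > 0"
    and sol: "P_solution \<phi> lam y m"
  defines "p \<equiv> \<lambda>t. (1 / lam) * (y t - Phi \<phi> m t)"
  shows "p \<in> D0_feasible \<phi>" "signed_integral m (Phi_adj \<phi> p) = tv_norm m"
proof -
  let ?r = "\<lambda>t. y t - Phi \<phi> m t"
  have m: "m \<in> radon_measures"
    and opt: "\<And>m'. m' \<in> radon_measures \<Longrightarrow> P_objective \<phi> lam y m \<le> P_objective \<phi> lam y m'"
    using sol lam by (auto simp: P_solution_def)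
  have r: "?r \<in> L2" by (intro L2_diff y Phi_L2 c m)
  have pert: "t * L2_inner (Phi \<phi> n) ?r \<le> lam * (tv_norm (\<lambda>A. 1 * m A + t * n A) - tv_norm m)
      + t\<^sup>2 * (L2_inner (Phi \<phi> n) (Phi \<phi> n) / 2)" if n: "n \<in> radon_measures" for n t
    using P_objective_perturb[OF c y m n, of lam t] opt[OF radon_linear[OF m n, of 1 t]]
    by (simp add: algebra_simps)
  have "\<bar>Phi_adj \<phi> ?r z\<bar> \<le> lam" for z
  proof -
    let ?n = "scaled_dirac 1 z"
    let ?C = "L2_inner (Phi \<phi> ?n) (Phi \<phi> ?n) / 2"
    obtain B where B: "\<And>x. \<bar>Phi_adj \<phi> ?r x\<bar> \<le> B"
      using continuous_circle_bounded[OF continuous_Phi_adj[OF c r]] by blast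
    have in_eq: "L2_inner (Phi \<phi> ?n) ?r = Phi_adj \<phi> ?r z"
      using Phi_adjoint[OF c r scaled_dirac_radon, of 1 z]
        signed_integral_scaled_dirac[OF borel_measurable_continuous_onI[OF continuous_Phi_adj[OF c r]] B, of 1 z]
      by simp
    \<comment> \<open>The mass added at z costs at most lam times |t|; the two signs of t bound the
      adjoint at z from both sides.\<close>
    have q: "t * Phi_adj \<phi> ?r z \<le> \<bar>t\<bar> * lam + t\<^sup>2 * ?C" for t
    proof -
      have "lam * (tv_norm (\<lambda>A. 1 * m A + t * ?n A) - tv_norm m) \<le> lam * \<bar>t\<bar>"
        using tv_norm_add_dirac_le[OF m, of t z] lam by (intro mult_left_mono) auto
      then show ?thesis using pert[OF scaled_dirac_radon, of t 1 z] by (simp add: in_eq mult.commute)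
    qed
    have "Phi_adj \<phi> ?r z \<le> lam"
    proof (rule le_of_quadratic_perturbation[of _ _ ?C])
      show "t * Phi_adj \<phi> ?r z \<le> t * lam + t\<^sup>2 * ?C" if "0 < t" for t
        using q[of t] that by simp
    qed
    moreover have "- Phi_adj \<phi> ?r z \<le> lam"
    proof (rule le_of_quadratic_perturbation[of _ _ ?C])
      show "t * - Phi_adj \<phi> ?r z \<le> t * lam + t\<^sup>2 * ?C" if "0 < t" for t
        using q[of "- t"] that by simp
    qed
    ultimately show ?thesis by (simp add: abs_le_iff)
  qed
  moreover have p_eq: "Phi_adj \<phi> p z = (1 / lam) * Phi_adj \<phi> ?r z" for z
    unfolding p_def using Phi_adj_lin[OF c r r, of "1/lam" 0 z] by simp
  moreover have "p \<in> L2" unfolding p_def by (rule L2_scale[OF r])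
  ultimately show p: "p \<in> D0_feasible \<phi>"
    using lam by (simp add: D0_feasible_iff abs_mult)
  let ?C = "L2_inner (Phi \<phi> m) (Phi \<phi> m) / 2"
  \<comment> \<open>Both signs of t have the same slope \<open>lam * tv_norm m\<close> here, in
    contrast to the Dirac perturbation, so the two inequalities combine to an equality.\<close>
  have q: "t * L2_inner (Phi \<phi> m) ?r \<le> t * (lam * tv_norm m) + t\<^sup>2 * ?C" if "t \<ge> - 1" for t
  proof -
    have "lam * (tv_norm (\<lambda>A. 1 * m A + t * m A) - tv_norm m) \<le> lam * (t * tv_norm m)"
      using tv_norm_rescale_le[OF m that] lam by (intro mult_left_mono) (auto simp: algebra_simps)
    then show ?thesis using pert[OF m, of t] by (simp add: mult_ac)
  qed
  have "L2_inner (Phi \<phi> m) ?r \<le> lam * tv_norm m"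
    by (rule le_of_quadratic_perturbation[of _ _ ?C]) (rule q, simp)
  moreover have "- L2_inner (Phi \<phi> m) ?r \<le> - (lam * tv_norm m)"
  proof (rule le_of_quadratic_perturbation[of _ _ ?C])
    show "t * - L2_inner (Phi \<phi> m) ?r \<le> t * - (lam * tv_norm m) + t\<^sup>2 * ?C" if "t \<le> 1" for t
      using q[of "- t"] that by simp
  qed
  ultimately have "L2_inner (Phi \<phi> m) ?r = lam * tv_norm m" by simp
  moreover have "L2_inner (Phi \<phi> m) p = (1 / lam) * L2_inner (Phi \<phi> m) ?r"
    unfolding p_def using L2_inner_lin_right[OF r r Phi_L2[OF c m], of "1/lam" 0] by simp
  ultimately have "L2_inner (Phi \<phi> m) p = tv_norm m" using lam by simp
  then show "signed_integral m (Phi_adj \<phi> p) = tv_norm m"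
    using Phi_adjoint[OF c \<open>p \<in> L2\<close> m] by simp
qed

section \<open>Convergence of the dual solutions to the minimal norm certificate\<close>

lemma L2_inner_tendsto_const:
  assumes "\<And>n. s n \<in> L2" "f \<in> L2" "g \<in> L2" "(\<lambda>n. L2_norm (\<lambda>x. s n x - f x)) \<longlonglongrightarrow> 0"
    "\<And>n. a \<le> L2_inner g (s n)"
  shows "a \<le> L2_inner g f"
  using L2_inner_tendsto[OF assms(1-4)] assms(5) by (intro LIMSEQ_le_const) auto

text \<open>Evaluating the adjoint at a point is an inner product with a fixed element, hence
  continuous in the norm.\<close>

lemma D0_feasible_closed:
  assumes c: "continuous_on UNIV \<phi>" and s: "\<And>k. s k \<in> D0_feasible \<phi>" and f: "f \<in> L2"
    and lim: "(\<lambda>k. L2_norm (\<lambda>x. s k x - f x)) \<longlonglongrightarrow> 0"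
  shows "f \<in> D0_feasible \<phi>"
proof -
  have sL: "s k \<in> L2" for k using s by (simp add: D0_feasible_iff)
  have "(\<lambda>k. \<bar>Phi_adj \<phi> (s k) t\<bar>) \<longlonglongrightarrow> \<bar>Phi_adj \<phi> f t\<bar>" for t
    unfolding Phi_adj_eq_inner
    by (intro tendsto_rabs L2_inner_tendsto sL f lim L2_continuous continuous_circle_compose_minus c)
  moreover have "\<bar>Phi_adj \<phi> (s k) t\<bar> \<le> 1" for k t using s by (simp add: D0_feasible_iff)
  ultimately have "\<bar>Phi_adj \<phi> f t\<bar> \<le> 1" for t by (meson LIMSEQ_le_const2)
  then show ?thesis using f by (simp add: D0_feasible_iff)
qed

lemma D0_feasible_midpoint:
  assumes c: "continuous_on UNIV \<phi>" and "f \<in> D0_feasible \<phi>" "g \<in> D0_feasible \<phi>"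
  shows "(\<lambda>x. (f x + g x) / 2) \<in> D0_feasible \<phi>"
proof -
  have L: "f \<in> L2" "g \<in> L2" and b: "\<bar>Phi_adj \<phi> f t\<bar> \<le> 1" "\<bar>Phi_adj \<phi> g t\<bar> \<le> 1" for t
    using assms by (auto simp: D0_feasible_iff)
  have "(\<lambda>x. 1/2 * f x + 1/2 * g x) \<in> D0_feasible \<phi>"
    unfolding D0_feasible_iff Phi_adj_lin[OF c L]
  proof (intro conjI allI L2_lin L)
    show "\<bar>1 / 2 * Phi_adj \<phi> f t + 1 / 2 * Phi_adj \<phi> g t\<bar> \<le> 1" for t
      using b[of t] by (auto simp: abs_le_iff)
  qed
  then show ?thesis by (simp add: add_divide_distrib)
qed

lemma L2_inner_midpoint:
  assumes "f \<in> L2" "g \<in> L2" "h \<in> L2"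
  shows "L2_inner h (\<lambda>x. (f x + g x) / 2) = (L2_inner h f + L2_inner h g) / 2"
  using L2_inner_lin_right[OF assms, of "1/2" "1/2"] by (simp add: add_divide_distrib)

text \<open>Superlevel sets of the dual objective as nested convex sets. A constant level produces
  the minimal norm solution; levels rising to the optimal value control the norm of almost optimal
  points.\<close>

lemma D0_superlevel_nested:
  assumes c: "continuous_on UNIV \<phi>" and y: "y \<in> L2" and p: "p \<in> D0_feasible \<phi>"
    and v: "\<And>n. v n \<le> L2_inner y p" and v_mono: "incseq v"
  shows "\<exists>q\<in>D0_feasible \<phi>. (\<forall>n. v n \<le> L2_inner y q) \<and>
    (\<forall>e>0. \<exists>n::nat. \<forall>f\<in>D0_feasible \<phi>. v n \<le> L2_inner y f \<longrightarrow> L2_inner q q - e < L2_inner f f)"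
proof -
  let ?C = "\<lambda>n. {q \<in> D0_feasible \<phi>. v n \<le> L2_inner y q}"
  have L: "f \<in> L2" if "f \<in> D0_feasible \<phi>" for f using that by (simp add: D0_feasible_iff)
  have "\<exists>q. (\<forall>n. q \<in> ?C n) \<and> (\<forall>e>0. \<exists>n. \<forall>f\<in>?C n. L2_inner q q - e < L2_inner f f)"
  proof (rule L2_nested_convex[of ?C "L2_inner p p"])
    show "?C n \<subseteq> L2" for n using L by auto
    show "decseq ?C" unfolding decseq_def using incseqD[OF v_mono] order_trans by fastforce
    show "(\<lambda>x. (f x + g x) / 2) \<in> ?C n" if "f \<in> ?C n" "g \<in> ?C n" for n f g
      using that D0_feasible_midpoint[OF c, of f g] L2_inner_midpoint[OF L L y, of f g] by simp
    show "f \<in> ?C n" if "\<And>k. s k \<in> ?C n" "f \<in> L2" "(\<lambda>k. L2_norm (\<lambda>x. s k x - f x)) \<longlonglongrightarrow> 0" for n s f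
      using that D0_feasible_closed[OF c, of s f] L2_inner_tendsto_const[of s f y "v n"] L y by auto
    show "\<exists>f\<in>?C n. L2_inner f f \<le> L2_inner p p" for n
      using p v by (intro bexI[of _ p]) auto
  qed blast
  then obtain q where q: "\<And>n. q \<in> ?C n"
    "\<And>e. e > 0 \<Longrightarrow> \<exists>n. \<forall>f\<in>?C n. L2_inner q q - e < L2_inner f f" by blast
  have "\<exists>n. \<forall>f\<in>D0_feasible \<phi>. v n \<le> L2_inner y f \<longrightarrow> L2_inner q q - e < L2_inner f f" if "e > 0" for e
    using q(2)[OF that] by auto
  then show ?thesis using q(1) by (intro bexI[of _ q]) auto
qed

text \<open>At the constant level of the optimal value the superlevel set is the set of solutions.
  Existence is what gives the choice in \<open>min_norm_certificate\<close> its meaning.\<close>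

lemma D0_min_norm_exists:
  assumes c: "continuous_on UNIV \<phi>" and y: "y \<in> L2" and p: "D0_solution \<phi> y p"
  shows "\<exists>q. D0_min_norm_solution \<phi> y q"
proof -
  have pf: "p \<in> D0_feasible \<phi>" and opt: "\<And>q. q \<in> D0_feasible \<phi> \<Longrightarrow> L2_inner y q \<le> L2_inner y p"
    using p by (auto simp: D0_solution_def)
  obtain q where q: "q \<in> D0_feasible \<phi>" "L2_inner y p \<le> L2_inner y q"
    "\<And>e. e > 0 \<Longrightarrow> \<forall>f\<in>D0_feasible \<phi>. L2_inner y p \<le> L2_inner y f \<longrightarrow> L2_inner q q - e < L2_inner f f"
    using D0_superlevel_nested[OF c y pf, of "\<lambda>n. L2_inner y p"] by (auto simp: incseq_def)
  have "D0_solution \<phi> y q"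
    using q(1,2) opt by (auto simp: D0_solution_def intro: order_trans)
  moreover have "L2_norm q \<le> L2_norm f" if "D0_solution \<phi> y f" for f
  proof -
    have "f \<in> D0_feasible \<phi>" "L2_inner y p \<le> L2_inner y f"
      using that pf by (auto simp: D0_solution_def)
    then have *: "L2_inner q q - e < L2_inner f f" if "e > 0" for e
      using q(3)[OF \<open>e > 0\<close>] by blast
    have "L2_inner q q \<le> L2_inner f f"
      by (rule field_le_epsilon) (use * in \<open>force simp: diff_less_eq\<close>)
    then show ?thesis by (simp add: L2_norm_def)
  qed
  ultimately show ?thesis by (auto simp: D0_min_norm_solution_def)
qed

text \<open>The inequality assumed of p is the variational inequality of the projection of (y + w) /
  lam, tested at p0 only. It bounds the norm of p and makes p almost optimal. Then the midpoint of p
  and p0 is almost optimal too, so its norm is hardly below that of p0 and the parallelogram law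
  bounds the distance.\<close>

lemma dual_convergence:
  assumes c: "continuous_on UNIV \<phi>" and y: "y \<in> L2" and p0: "D0_min_norm_solution \<phi> y p0"
    and \<delta>: "\<delta> > 0"
  shows "\<exists>\<alpha>>0. \<exists>l0>0. \<forall>lam w p.
      0 < lam \<and> lam \<le> l0 \<and> w \<in> L2 \<and> L2_norm w \<le> \<alpha> * lam \<and> p \<in> D0_feasible \<phi> \<and>
      L2_inner (\<lambda>x. (y x + w x) - lam * p x) p0 \<le> L2_inner (\<lambda>x. (y x + w x) - lam * p x) p \<longrightarrow>
      L2_norm (\<lambda>x. p x - p0 x) \<le> \<delta>"
proof -
  have p0f: "p0 \<in> D0_feasible \<phi>" and opt: "\<And>q. q \<in> D0_feasible \<phi> \<Longrightarrow> L2_inner y q \<le> L2_inner y p0"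
    and minn: "\<And>q. D0_solution \<phi> y q \<Longrightarrow> L2_norm p0 \<le> L2_norm q"
    using p0 by (auto simp: D0_solution_def D0_min_norm_solution_def)
  have L: "f \<in> L2" if "f \<in> D0_feasible \<phi>" for f using that by (simp add: D0_feasible_iff)
  define N where "N = L2_norm p0"
  have N: "N \<ge> 0" by (simp add: N_def)
  define v where "v n = L2_inner y p0 - 1 / (real n + 1)" for n
  have v_lim: "v \<longlonglongrightarrow> L2_inner y p0 - 0"
    unfolding v_def using LIMSEQ_inverse_real_of_nat
    by (intro tendsto_intros) (simp add: divide_inverse add.commute)
  obtain q where q: "q \<in> D0_feasible \<phi>" "\<And>n. v n \<le> L2_inner y q"
    "\<And>e. e > 0 \<Longrightarrow> \<exists>n. \<forall>f\<in>D0_feasible \<phi>. v n \<le> L2_inner y f \<longrightarrow> L2_inner q q - e < L2_inner f f"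
  proof -
    have "v n \<le> L2_inner y p0" for n by (simp add: v_def)
    moreover have "incseq v" unfolding v_def incseq_def by (auto intro!: divide_left_mono)
    ultimately show ?thesis
      using D0_superlevel_nested[OF c y p0f, of v] that by blast
  qed
  have "L2_inner y p0 \<le> L2_inner y q"
    using LIMSEQ_le_const2[OF v_lim, of "L2_inner y q"] q(2) by auto
  then have "D0_solution \<phi> y q"
    using q(1) opt by (auto simp: D0_solution_def intro: order_trans)
  then have "N\<^sup>2 \<le> (L2_norm q)\<^sup>2" using minn N by (intro power_mono) (auto simp: N_def)
  then have Nq: "N\<^sup>2 \<le> L2_inner q q" by (simp add: L2_norm_power2)
  \<comment> \<open>The parallelogram law multiplies this defect by 4, which uses up half of the
    square of \<delta>.\<close>
  obtain n where n: "\<And>f. f \<in> D0_feasible \<phi> \<Longrightarrow> v n \<le> L2_inner y f \<Longrightarrow> N\<^sup>2 - \<delta>\<^sup>2 / 8 < L2_inner f f"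
    using q(3)[of "\<delta>\<^sup>2 / 8"] \<delta> Nq by fastforce
  \<comment> \<open>The bound N + 2 \<alpha> on the norm of p contributes 8 \<alpha> (N + 1) to the
    squared distance, the other half of the square of \<delta>.\<close>
  define \<alpha> where "\<alpha> = min 1 (\<delta>\<^sup>2 / (16 * (N + 1)))"
  have \<alpha>: "\<alpha> > 0" "\<alpha> \<le> 1" "\<alpha> * (16 * (N + 1)) \<le> \<delta>\<^sup>2"
  proof -
    show "\<alpha> > 0" "\<alpha> \<le> 1" using N \<delta> by (auto simp: \<alpha>_def)
    have "\<alpha> \<le> \<delta>\<^sup>2 / (16 * (N + 1))" by (simp add: \<alpha>_def)
    then show "\<alpha> * (16 * (N + 1)) \<le> \<delta>\<^sup>2" using N by (subst (asm) pos_le_divide_eq) auto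
  qed
  \<comment> \<open>Bounds \<alpha> (P + N) + P N - P * P: the first term is at most 2 N + 2, the
    rest at most N * N. Then \<open>l0\<close> makes the loss of dual value at most 1 / (n +
    1).\<close>
  define K where "K = N\<^sup>2 + 2 * N + 2"
  have K: "K > 0" using N by (simp add: K_def add_nonneg_pos)
  define l0 where "l0 = 1 / ((real n + 1) * K)"
  have l0: "l0 > 0" using K by (simp add: l0_def)
  have "L2_norm (\<lambda>x. p x - p0 x) \<le> \<delta>"
    if lam: "0 < lam" "lam \<le> l0" and w: "w \<in> L2" "L2_norm w \<le> \<alpha> * lam" and p: "p \<in> D0_feasible \<phi>"
      and ineq: "L2_inner (\<lambda>x. (y x + w x) - lam * p x) p0 \<le> L2_inner (\<lambda>x. (y x + w x) - lam * p x) p"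
    for lam w p
  proof -
    define P where "P = L2_norm p"
    have P: "P \<ge> 0" by (simp add: P_def)
    note pL = L[OF p] and p0L = L[OF p0f]
    have ex: "L2_inner (\<lambda>x. (y x + w x) - lam * p x) f = L2_inner y f + L2_inner w f - lam * L2_inner p f"
      if "f \<in> L2" for f
      using that y w pL by (simp add: L2_inner_diff L2_inner_add L2_inner_scale L2_add L2_scale)
    have cs: "L2_inner p p0 \<le> P * N" "L2_inner w p - L2_inner w p0 \<le> \<alpha> * lam * (P + N)"
    proof -
      show "L2_inner p p0 \<le> P * N"
        using L2_Cauchy_Schwarz[OF pL p0L] by (simp add: P_def N_def)
      have "L2_inner w p - L2_inner w p0 = L2_inner w (\<lambda>x. p x - p0 x)"
        using L2_inner_diff_right[OF pL p0L w(1)] by simp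
      also have "\<dots> \<le> L2_norm w * L2_norm (\<lambda>x. p x - p0 x)"
        using L2_Cauchy_Schwarz[OF w(1) L2_diff[OF pL p0L]] by simp
      also have "\<dots> \<le> (\<alpha> * lam) * (P + N)"
        using w(2) L2_norm_diff_le[OF pL p0L] \<alpha>(1) lam(1)
        by (intro mult_mono) (auto simp: P_def N_def)
      finally show "L2_inner w p - L2_inner w p0 \<le> \<alpha> * lam * (P + N)" .
    qed
    have PP: "L2_inner p p = P\<^sup>2" by (simp add: P_def L2_norm_power2)
    have main: "L2_inner y p0 + lam * (P\<^sup>2 - P * N) \<le> L2_inner y p + \<alpha> * lam * (P + N)"
    proof -
      have "lam * L2_inner p p0 \<le> lam * (P * N)" using cs(1) lam by simp
      then show ?thesis
        using ineq cs(2) unfolding ex[OF pL] ex[OF p0L] PP by (simp add: algebra_simps)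
    qed
    \<comment> \<open>Optimality of p0 removes the terms with y. After division by lam, P (P - N) is
      at most \<alpha> (P + N), hence at most 2 \<alpha> P when N < P.\<close>
    have PN: "P \<le> N + 2 * \<alpha>"
    proof (cases "P \<le> N")
      case True
      then show ?thesis using \<alpha>(1) by simp
    next
      case False
      have "lam * (P\<^sup>2 - P * N) \<le> lam * (\<alpha> * (P + N))"
        using main opt[OF p] by (simp add: algebra_simps)
      then have "P\<^sup>2 - P * N \<le> \<alpha> * (P + N)"
        using lam(1) by (simp only: mult_le_cancel_left_pos)
      then have "P * (P - N) \<le> \<alpha> * (P + N)"
        by (simp add: power2_eq_square right_diff_distrib)
      also have "\<dots> \<le> \<alpha> * (2 * P)" using False \<alpha>(1) by (intro mult_left_mono) auto
      finally have "P * (P - N) \<le> P * (2 * \<alpha>)" by (simp add: mult_ac)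
      then show ?thesis using False N by (simp add: mult_le_cancel_left)
    qed
    have yp: "v n \<le> L2_inner y p"
    proof -
      have "\<alpha> * (P + N) \<le> 1 * (2 * N + 2)"
        using \<alpha> PN P N by (intro mult_mono) auto
      moreover have "P * N - P\<^sup>2 \<le> N\<^sup>2"
        using zero_le_power2[of "P - N"] zero_le_power2[of P] mult_nonneg_nonneg[OF P N]
        unfolding power2_diff by linarith
      ultimately have "\<alpha> * (P + N) - (P\<^sup>2 - P * N) \<le> K" by (simp add: K_def)
      then have "lam * (\<alpha> * (P + N) - (P\<^sup>2 - P * N)) \<le> l0 * K"
        using lam K by (intro order_trans[OF mult_left_mono mult_right_mono]) auto
      moreover have "l0 * K = 1 / (real n + 1)" using K by (simp add: l0_def)
      ultimately show ?thesis using main by (simp add: v_def algebra_simps)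
    qed
    let ?h = "\<lambda>x. (p x + p0 x) / 2"
    have "v n \<le> L2_inner y ?h"
      using yp opt[OF p] L2_inner_midpoint[OF pL p0L y] by simp
    then have "N\<^sup>2 - \<delta>\<^sup>2 / 8 < L2_inner ?h ?h"
      by (intro n D0_feasible_midpoint c p p0f)
    then have "(L2_norm (\<lambda>x. p x - p0 x))\<^sup>2 \<le> 2 * P\<^sup>2 - 2 * N\<^sup>2 + \<delta>\<^sup>2 / 2"
      using L2_parallelogram[OF pL p0L] PP by (simp add: L2_norm_power2 N_def)
    also have "P\<^sup>2 \<le> (N + 2 * \<alpha>)\<^sup>2" using P PN by (intro power_mono)
    also have "(N + 2 * \<alpha>)\<^sup>2 = N\<^sup>2 + 4 * \<alpha> * (N + \<alpha>)"
      by (simp add: power2_eq_square algebra_simps)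
    also have "4 * \<alpha> * (N + \<alpha>) \<le> 4 * \<alpha> * (N + 1)" using \<alpha> by (intro mult_left_mono) auto
    finally have "(L2_norm (\<lambda>x. p x - p0 x))\<^sup>2 \<le> 8 * (\<alpha> * (N + 1)) + \<delta>\<^sup>2 / 2" by simp
    also have "\<dots> \<le> \<delta>\<^sup>2" using \<alpha>(3) by (simp add: algebra_simps)
    finally show "L2_norm (\<lambda>x. p x - p0 x) \<le> \<delta>"
      by (rule power2_le_imp_le) (use \<delta> in simp)
  qed
  then show ?thesis using \<alpha>(1) l0 by blast
qed

section \<open>Weak compactness of bounded sets of measures\<close>

text \<open>A section of the quotient map with values in [0, 1): \<open>rep_circle\<close> chooses
  an arbitrary representative and \<open>frac\<close> normalises it. It is Borel but not continuous
  at 0.\<close>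

definition circle_lift :: "circle \<Rightarrow> real"
  where "circle_lift c = frac (rep_circle c)"

lemma circle_lift_bounds: "0 \<le> circle_lift c" "circle_lift c < 1"
  by (simp_all add: circle_lift_def frac_lt_1)

lemma circ_circle_lift [simp]: "circ (circle_lift c) = c"
  by (simp add: circle_lift_def circ_frac)

lemma circle_lift_circ:
  assumes "0 \<le> s" "s < 1"
  shows "circle_lift (circ s) = s"
proof -
  have "rep_circle (circ s) - s \<in> \<int>"
    using circ_eq_iff[of "rep_circle (circ s)" s] by simp
  then show ?thesis
    using assms by (simp add: circle_lift_def frac_unique_iff)
qed

text \<open>The nontrivial sublevel sets are images of compact intervals under \<open>circ\<close>,
  hence compact.\<close>

lemma measurable_circle_lift: "circle_lift \<in> borel_measurable borel"
proof (rule borel_measurableI_le)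
  fix a :: real
  consider "a < 0" | "0 \<le> a" "a < 1" | "1 \<le> a" by linarith
  then have "{c. circle_lift c \<le> a} \<in> sets borel"
  proof cases
    case 1
    then have "{c. circle_lift c \<le> a} = {}"
      using circle_lift_bounds(1) by (auto simp: not_le intro: less_le_trans)
    then show ?thesis by simp
  next
    case 2
    have "{c. circle_lift c \<le> a} = circ ` {0..a}"
    proof (intro equalityI subsetI)
      fix c assume "c \<in> {c. circle_lift c \<le> a}"
      then show "c \<in> circ ` {0..a}"
        using circle_lift_bounds(1)[of c] by (intro image_eqI[of _ _ "circle_lift c"]) auto
    next
      fix c assume "c \<in> circ ` {0..a}"
      then show "c \<in> {c. circle_lift c \<le> a}"
        using 2 by (auto simp: circle_lift_circ)
    qed
    moreover have "compact (circ ` {0..a})"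
      by (intro compact_continuous_image continuous_on_circ compact_Icc)
    ultimately show ?thesis by (simp add: borel_compact)
  next
    case 3
    then have "{c. circle_lift c \<le> a} = UNIV"
      using circle_lift_bounds(2) by (auto intro: less_imp_le less_le_trans)
    then show ?thesis by simp
  qed
  then show "{c \<in> space borel. circle_lift c \<le> a} \<in> sets borel" by simp
qed

text \<open>Probability measures on the circle are lifted to \<open>[0, 1)\<close>, where Helly's selection theorem
  applies; the limit is pushed back along the quotient map.\<close>

lemma prob_circle_weak_compact:
  fixes N :: "nat \<Rightarrow> circle measure"
  assumes N: "\<And>n. prob_space (N n)" "\<And>n. sets (N n) = sets borel"
  shows "\<exists>r N'. strict_mono r \<and> prob_space N' \<and> sets N' = sets borel \<and>
    (\<forall>f :: circle \<Rightarrow> real. continuous_on UNIV f \<longrightarrow> (\<lambda>n. LINT x|N (r n). f x) \<longlonglongrightarrow> (LINT x|N'. f x))"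
proof -
  have lift: "circle_lift \<in> borel_measurable (N n)" for n
    using measurable_circle_lift N(2) by (simp cong: measurable_cong_sets)
  define \<mu> where "\<mu> n = distr (N n) borel circle_lift" for n
  have rd: "real_distribution (\<mu> n)" for n
    unfolding \<mu>_def by (rule prob_space.real_distribution_distr[OF N(1) lift])
  \<comment> \<open>Tightness is formulated with half-open intervals; this one carries all lifted
    measures completely.\<close>
  have "measure (\<mu> n) {-1<..1} = 1" for n
  proof -
    have "measure (\<mu> n) {-1<..1} = measure (N n) (circle_lift -` {-1<..1} \<inter> space (N n))"
      unfolding \<mu>_def by (rule measure_distr[OF lift]) simp
    also have "circle_lift -` {-1<..1} \<inter> space (N n) = space (N n)"
      using circle_lift_bounds by (force intro: less_imp_le order_less_le_trans[of "-1" 0])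
    finally show ?thesis using prob_space.prob_space[OF N(1)] by simp
  qed
  then have "tight \<mu>"
    unfolding tight_def using rd by (intro conjI allI impI exI[of _ "-1::real"] exI[of _ "1::real"]) auto
  then obtain r M where r: "strict_mono r" and M: "real_distribution M" and conv: "weak_conv_m (\<mu> \<circ> r) M"
    using tight_imp_convergent_subsubsequence[of \<mu> id] by (auto simp: strict_mono_def)
  interpret M: real_distribution M by fact
  \<comment> \<open>The limit M may charge the end point 1, which the lifts avoid;
    \<open>circ\<close> sends that mass to 0.\<close>
  define N' where "N' = distr M borel circ"
  have circM: "circ \<in> measurable M borel"
    using measurable_circ by (simp cong: measurable_cong_sets)
  have "prob_space N'"
    unfolding N'_def by (rule M.prob_space_distr[OF circM])
  moreover have "(\<lambda>n. LINT x|N (r n). f x) \<longlonglongrightarrow> (LINT x|N'. f x)"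
    if f: "continuous_on UNIV f" for f :: "circle \<Rightarrow> real"
  proof -
    obtain B where B: "\<And>x. \<bar>f x\<bar> \<le> B" using continuous_circle_bounded[OF f] by blast
    \<comment> \<open>The lift is discontinuous, yet the lifted measures are tested only against f
      composed with \<open>circ\<close>, which is continuous on the line.\<close>
    have cf: "continuous_on UNIV (\<lambda>s. f (circ s))"
      by (rule continuous_on_compose2[OF f continuous_on_circ]) simp
    have mf: "f \<in> borel_measurable borel" by (rule borel_measurable_continuous_onI[OF f])
    have "(\<lambda>n. LINT s|(\<mu> \<circ> r) n. f (circ s)) \<longlonglongrightarrow> (LINT s|M. f (circ s))"
    proof (rule weak_conv_imp_integral_bdd_continuous_conv[OF _ M conv])
      show "isCont (\<lambda>s. f (circ s)) s" for s
        using cf by (simp add: continuous_on_eq_continuous_at)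
      show "norm (f (circ s)) \<le> B" for s using B by simp
    qed (simp add: rd)
    moreover have "(LINT s|\<mu> n. f (circ s)) = (LINT x|N n. f x)" for n
      unfolding \<mu>_def
      using borel_measurable_continuous_onI[OF cf] by (subst integral_distr[OF lift]) auto
    moreover have "(LINT s|M. f (circ s)) = (LINT x|N'. f x)"
      unfolding N'_def using mf by (subst integral_distr[OF circM]) auto
    ultimately show ?thesis by simp
  qed
  ultimately show ?thesis
    using r by (intro exI[of _ r] exI[of _ N']) (simp add: N'_def)
qed

text \<open>Separates mass and shape so that the compactness of probability measures applies. The
  zero measure receives Haar measure as its shape, with factor 0.\<close>

lemma finite_measure_normalize:
  assumes "finite_measure M" "sets M = sets (borel :: circle measure)"
  shows "\<exists>N. prob_space N \<and> sets N = sets borel \<and>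
    (\<forall>f :: circle \<Rightarrow> real. continuous_on UNIV f \<longrightarrow> (LINT x|M. f x) = measure M UNIV * (LINT x|N. f x))"
proof (cases "measure M UNIV = 0")
  case True
  interpret finite_measure M by fact
  have sp: "space M = UNIV" using sets_eq_imp_space_eq[OF assms(2)] by simp
  have "emeasure M (space M) = 0" using True sp by (simp add: emeasure_eq_measure)
  then have "AE x in M. False"
    by (intro AE_I[of _ _ "space M"]) auto
  then have "(LINT x|M. f x) = 0" for f :: "circle \<Rightarrow> real"
    by (intro integral_eq_zero_AE) auto
  then show ?thesis
    using True by (intro exI[of _ haar]) (auto intro: prob_space_haar)
next
  case False
  interpret finite_measure M by fact
  have sp: "space M = UNIV" using sets_eq_imp_space_eq[OF assms(2)] by simp
  define c where "c = measure M UNIV"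
  have c: "c > 0" using False by (simp add: c_def zero_less_measure_iff)
  define N where "N = density M (\<lambda>x. ennreal (1 / c))"
  have "emeasure N (space N) = ennreal (1 / c) * ennreal c"
    unfolding N_def using emeasure_eq_measure[of UNIV] sets.top[of M]
    by (simp add: emeasure_density sp c_def nn_integral_cmult_indicator)
  also have "\<dots> = 1" using c by (simp add: ennreal_mult[symmetric])
  finally have "prob_space N" by (rule prob_spaceI)
  moreover have "(LINT x|M. f x) = c * (LINT x|N. f x)" if "continuous_on UNIV f" for f :: "circle \<Rightarrow> real"
  proof -
    have "f \<in> borel_measurable M"
      using borel_measurable_continuous_onI[OF that] assms(2) by (simp cong: measurable_cong_sets)
    then have "(LINT x|N. f x) = (LINT x|M. (1 / c) * f x)"
      unfolding N_def using c by (subst integral_density) auto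
    then show ?thesis using c by simp
  qed
  ultimately show ?thesis
    using assms(2) by (intro exI[of _ N]) (auto simp: c_def N_def)
qed

text \<open>The masses of the Jordan parts lie in a compact square, and the normalised parts are
  treated by successive subsequences. The limits of the two parts may overlap and need not be the
  Jordan parts of the limit, hence the appeal to \<open>signed_integral_eqI\<close>.\<close>

lemma radon_weak_compact:
  assumes m: "\<And>n. m n \<in> radon_measures" and R: "\<And>n. tv_norm (m n) \<le> R"
  shows "\<exists>r m'. strict_mono (r :: nat \<Rightarrow> nat) \<and> m' \<in> radon_measures \<and>
    (\<forall>f. continuous_on UNIV f \<longrightarrow> (\<lambda>n. signed_integral (m (r n)) f) \<longlonglongrightarrow> signed_integral m' f)"
proof -
  define a where "a n = measure (pos_part (m n)) UNIV" for n
  define b where "b n = measure (neg_part (m n)) UNIV" for n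
  have "\<exists>N. prob_space N \<and> sets N = sets borel \<and>
    (\<forall>f :: circle \<Rightarrow> real. continuous_on UNIV f \<longrightarrow> (LINT x|pos_part (m n). f x) = a n * (LINT x|N. f x))" for n
    unfolding a_def using m by (intro finite_measure_normalize) auto
  then obtain P where P: "\<And>n. prob_space (P n)" "\<And>n. sets (P n) = sets borel"
    "\<And>n f. continuous_on UNIV f \<Longrightarrow> (LINT x|pos_part (m n). f x) = a n * (LINT x|P n. f x)"
    by metis
  have "\<exists>N. prob_space N \<and> sets N = sets borel \<and>
    (\<forall>f :: circle \<Rightarrow> real. continuous_on UNIV f \<longrightarrow> (LINT x|neg_part (m n). f x) = b n * (LINT x|N. f x))" for n
    unfolding b_def using m by (intro finite_measure_normalize) auto
  then obtain Q where Q: "\<And>n. prob_space (Q n)" "\<And>n. sets (Q n) = sets borel"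
    "\<And>n f. continuous_on UNIV f \<Longrightarrow> (LINT x|neg_part (m n). f x) = b n * (LINT x|Q n. f x)"
    by metis
  have ab: "a n \<in> {0..R}" "b n \<in> {0..R}" for n
    using R[of n] unfolding tv_norm_eq_total_variation[OF m] total_variation_def a_def b_def
    by (auto intro: order_trans[rotated] simp: add_increasing add_increasing2)
  have "compact ({0..R} \<times> {0..R})" by (intro compact_Times compact_Icc)
  moreover have "\<forall>n. (a n, b n) \<in> {0..R} \<times> {0..R}" using ab by auto
  ultimately have "\<exists>l\<in>{0..R} \<times> {0..R}. \<exists>r. strict_mono r \<and> ((\<lambda>n. (a n, b n)) \<circ> r) \<longlonglongrightarrow> l"
    unfolding compact_def by (elim allE[of _ "\<lambda>n. (a n, b n)"] impE)
  then obtain l r1 where r1: "strict_mono r1" "((\<lambda>n. (a n, b n)) \<circ> r1) \<longlonglongrightarrow> l"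
    by blast
  have a1: "(\<lambda>n. a (r1 n)) \<longlonglongrightarrow> fst l" and b1: "(\<lambda>n. b (r1 n)) \<longlonglongrightarrow> snd l"
    using tendsto_fst[OF r1(2)] tendsto_snd[OF r1(2)] by (simp_all add: o_def)
  obtain r2 P' where r2: "strict_mono r2" and P': "prob_space P'" "sets P' = sets borel"
    and P_lim: "\<And>f :: circle \<Rightarrow> real. continuous_on UNIV f \<Longrightarrow> (\<lambda>n. LINT x|P (r1 (r2 n)). f x) \<longlonglongrightarrow> (LINT x|P'. f x)"
    using prob_circle_weak_compact[of "\<lambda>n. P (r1 n)"] P by blast
  obtain r3 Q' where r3: "strict_mono r3" and Q': "prob_space Q'" "sets Q' = sets borel"
    and Q_lim: "\<And>f :: circle \<Rightarrow> real. continuous_on UNIV f \<Longrightarrow>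
      (\<lambda>n. LINT x|Q (r1 (r2 (r3 n))). f x) \<longlonglongrightarrow> (LINT x|Q'. f x)"
    using prob_circle_weak_compact[of "\<lambda>n. Q (r1 (r2 n))"] Q by blast
  define r where "r n = r1 (r2 (r3 n))" for n
  have r: "strict_mono r"
    unfolding r_def using r1(1) r2 r3 by (simp add: strict_mono_def)
  have r23: "strict_mono (\<lambda>n. r2 (r3 n))"
    using r2 r3 by (simp add: strict_mono_def)
  define m' where "m' A = fst l * measure P' A + (- snd l) * measure Q' A" for A
  have fin: "finite_measure P'" "finite_measure Q'"
    using P'(1) Q'(1) by (auto intro: prob_space.finite_measure)
  have m': "m' \<in> radon_measures"
    unfolding m'_def by (intro radon_linear radon_measure fin P' Q')
  show ?thesis
  proof (intro exI conjI allI impI)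
    show "strict_mono r" "m' \<in> radon_measures" by (fact r, fact m')
    fix f :: "circle \<Rightarrow> real" assume f: "continuous_on UNIV f"
    obtain B where B: "\<And>x. \<bar>f x\<bar> \<le> B" using continuous_circle_bounded[OF f] by blast
    have "signed_integral m' f = (\<Sum>(c, M)\<leftarrow>[(fst l, P'), (- snd l, Q')]. c * (LINT x|M. f x))"
      by (rule signed_integral_eqI[OF m' _ _ borel_measurable_continuous_onI[OF f] B])
        (use fin P' Q' in \<open>auto simp: m'_def\<close>)
    then have eq: "signed_integral m' f = fst l * (LINT x|P'. f x) - snd l * (LINT x|Q'. f x)" by simp
    have "(\<lambda>n. a (r n) * (LINT x|P (r n). f x) - b (r n) * (LINT x|Q (r n). f x)) \<longlonglongrightarrow>
        fst l * (LINT x|P'. f x) - snd l * (LINT x|Q'. f x)"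
      unfolding r_def
      using LIMSEQ_subseq_LIMSEQ[OF a1 r23] LIMSEQ_subseq_LIMSEQ[OF b1 r23]
        LIMSEQ_subseq_LIMSEQ[OF P_lim[OF f] r3] Q_lim[OF f]
      by (intro tendsto_intros) (simp_all add: o_def)
    then show "(\<lambda>n. signed_integral (m (r n)) f) \<longlonglongrightarrow> signed_integral m' f"
      unfolding eq by (simp add: signed_integral_def P(3)[OF f] Q(3)[OF f])
  qed
qed

text \<open>A supremum of weakly continuous functionals is weakly lower semicontinuous. The bounds
  vary with n because estimates along a sequence may be sharp only in the limit.\<close>

lemma tv_norm_weak_limit_le:
  assumes m: "\<And>n. m n \<in> radon_measures"
    and conv: "\<And>f. continuous_on UNIV f \<Longrightarrow> (\<lambda>n. signed_integral (m n) f) \<longlonglongrightarrow> signed_integral m' f"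
    and t: "\<And>n. tv_norm (m n) \<le> t n" "t \<longlonglongrightarrow> T"
  shows "tv_norm m' \<le> T"
proof (rule tv_norm_leI)
  fix \<psi> :: "circle \<Rightarrow> real" assume \<psi>: "continuous_on UNIV \<psi>" "\<And>x. \<bar>\<psi> x\<bar> \<le> 1"
  show "signed_integral m' \<psi> \<le> T"
    using conv[OF \<psi>(1)] t(2)
  proof (rule LIMSEQ_le)
    show "\<exists>N. \<forall>n\<ge>N. signed_integral (m n) \<psi> \<le> t n"
      using signed_integral_le_tv_norm[OF m \<psi>] t(1) order_trans by blast
  qed
qed

text \<open>Every translate of \<phi> is a test function, so weak convergence gives pointwise
  convergence of the images. The uniform bound B R then allows dominated convergence: the operator
  turns weak into strong convergence.\<close>

lemma Phi_weak_limit: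
  assumes c: "continuous_on UNIV \<phi>" and y: "y \<in> L2"
    and m: "\<And>n. m n \<in> radon_measures" "m' \<in> radon_measures" and R: "\<And>n. tv_norm (m n) \<le> R"
    and conv: "\<And>f. continuous_on UNIV f \<Longrightarrow> (\<lambda>n. signed_integral (m n) f) \<longlonglongrightarrow> signed_integral m' f"
  shows "(\<lambda>n. L2_norm (\<lambda>t. Phi \<phi> (m n) t - y t)) \<longlonglongrightarrow> L2_norm (\<lambda>t. Phi \<phi> m' t - y t)"
proof -
  obtain B where B: "B > 0" "\<And>x. \<bar>\<phi> x\<bar> \<le> B" using continuous_circle_bounded[OF c] by blast
  have bound: "\<bar>Phi \<phi> (m n) t\<bar> \<le> B * R" for n t
  proof -
    have "\<bar>Phi \<phi> (m n) t\<bar> \<le> B * tv_norm (m n)"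
      unfolding Phi_def by (intro signed_integral_abs_le m continuous_circle_compose_minus c B)
    also have "\<dots> \<le> B * R" using R B(1) by (intro mult_left_mono) auto
    finally show ?thesis .
  qed
  have meas: "(\<lambda>t. Phi \<phi> n t - y t) \<in> borel_measurable haar" if "n \<in> radon_measures" for n
    using L2_D(1)[OF L2_diff[OF Phi_L2[OF c that] y]] by (simp cong: measurable_cong_sets)
  have "(\<lambda>n. LINT t|haar. (Phi \<phi> (m n) t - y t)\<^sup>2) \<longlonglongrightarrow> (LINT t|haar. (Phi \<phi> m' t - y t)\<^sup>2)"
  proof (rule integral_dominated_convergence[where w="\<lambda>t. 2 * (B * R)\<^sup>2 + 2 * (y t)\<^sup>2"])
    show "integrable haar (\<lambda>t. 2 * (B * R)\<^sup>2 + 2 * (y t)\<^sup>2)"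
      using L2_D(2)[OF y] by simp
    show "AE t in haar. (\<lambda>n. (Phi \<phi> (m n) t - y t)\<^sup>2) \<longlonglongrightarrow> (Phi \<phi> m' t - y t)\<^sup>2"
      unfolding Phi_def
      by (intro AE_I2 tendsto_intros conv continuous_circle_compose_minus c)
    show "AE t in haar. norm ((Phi \<phi> (m n) t - y t)\<^sup>2) \<le> 2 * (B * R)\<^sup>2 + 2 * (y t)\<^sup>2" for n
    proof (intro AE_I2)
      fix t
      have "(Phi \<phi> (m n) t)\<^sup>2 \<le> (B * R)\<^sup>2"
        using bound[of n t] by (metis abs_ge_zero power2_abs power_mono)
      moreover have "(Phi \<phi> (m n) t - y t)\<^sup>2 \<le> 2 * (Phi \<phi> (m n) t)\<^sup>2 + 2 * (y t)\<^sup>2"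
        using zero_le_power2[of "Phi \<phi> (m n) t + y t"] unfolding power2_diff power2_sum by linarith
      ultimately show "norm ((Phi \<phi> (m n) t - y t)\<^sup>2) \<le> 2 * (B * R)\<^sup>2 + 2 * (y t)\<^sup>2" by simp
    qed
  qed (use meas m in simp_all)
  then have "(\<lambda>n. sqrt ((L2_norm (\<lambda>t. Phi \<phi> (m n) t - y t))\<^sup>2)) \<longlonglongrightarrow> sqrt ((L2_norm (\<lambda>t. Phi \<phi> m' t - y t))\<^sup>2)"
    unfolding L2_norm_power2_integral by (rule tendsto_real_sqrt)
  then show ?thesis by simp
qed

section \<open>Existence of solutions and strong duality\<close>

text \<open>Direct method: the norm term bounds a minimising sequence, the fidelity converges along
  a weak limit, and the norm is lower semicontinuous.\<close>

lemma P_solution_exists: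
  assumes c: "continuous_on UNIV \<phi>" and y: "y \<in> L2" and lam: "lam > 0"
  shows "\<exists>m. P_solution \<phi> lam y m"
proof -
  let ?J = "P_objective \<phi> lam y"
  define I where "I = (INF m\<in>radon_measures. ?J m)"
  have J: "?J m = 1 / 2 * (L2_norm (\<lambda>t. Phi \<phi> m t - y t))\<^sup>2 + lam * tv_norm m" for m
    by (simp add: P_objective_def)
  have J_ge: "lam * tv_norm m \<le> ?J m" for m
    by (simp add: J)
  have bdd: "bdd_below (?J ` radon_measures)"
  proof (rule bdd_belowI)
    fix x assume "x \<in> ?J ` radon_measures"
    then obtain m where "m \<in> radon_measures" "x = ?J m" by blast
    moreover from this have "0 \<le> lam * tv_norm m" using lam tv_norm_nonneg by simp
    ultimately show "0 \<le> x" using J_ge[of m] by simp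
  qed
  have ne: "radon_measures \<noteq> {}" using scaled_dirac_radon by blast
  have "\<exists>m\<in>radon_measures. ?J m < I + 1 / real (Suc n)" for n
    using cINF_less_iff[OF ne bdd, of "I + 1 / real (Suc n)"] unfolding I_def[symmetric] by simp
  then obtain m where m: "\<And>n. m n \<in> radon_measures" "\<And>n. ?J (m n) < I + 1 / real (Suc n)"
    by metis
  have "tv_norm (m n) \<le> (I + 1) / lam" for n
  proof -
    have "1 / real (Suc n) \<le> 1" by simp
    then have "lam * tv_norm (m n) \<le> I + 1"
      using m(2)[of n] J_ge[of "m n"] by linarith
    then show ?thesis using lam by (simp add: field_simps)
  qed
  note R = this
  obtain r m' where r: "strict_mono r" and m': "m' \<in> radon_measures"
    and "\<forall>f. continuous_on UNIV f \<longrightarrow> (\<lambda>n. signed_integral (m (r n)) f) \<longlonglongrightarrow> signed_integral m' f"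
    using radon_weak_compact[of m, OF m(1) R] by (elim exE conjE)
  then have conv: "continuous_on UNIV f \<Longrightarrow>
      (\<lambda>n. signed_integral (m (r n)) f) \<longlonglongrightarrow> signed_integral m' f" for f by blast
  define N where "N n = (L2_norm (\<lambda>t. Phi \<phi> (m (r n)) t - y t))\<^sup>2" for n
  have N: "N \<longlonglongrightarrow> (L2_norm (\<lambda>t. Phi \<phi> m' t - y t))\<^sup>2" (is "_ \<longlonglongrightarrow> ?N'")
    unfolding N_def by (intro tendsto_power Phi_weak_limit[OF c y m(1) m' R conv])
  have small: "(\<lambda>n. 1 / real (Suc (r n))) \<longlonglongrightarrow> 0"
    using LIMSEQ_subseq_LIMSEQ[OF LIMSEQ_inverse_real_of_nat r] by (simp add: o_def divide_inverse)
  have "(\<lambda>n. (I + 1 / real (Suc (r n)) - 1 / 2 * N n) / lam) \<longlonglongrightarrow> (I + 0 - 1 / 2 * ?N') / lam"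
    using lam by (intro tendsto_intros N small) simp
  \<comment> \<open>Near-minimality is solved for the norm, so that the convergent fidelity becomes
    part of the varying bound in \<open>tv_norm_weak_limit_le\<close>.\<close>
  moreover have "tv_norm (m (r n)) \<le> (I + 1 / real (Suc (r n)) - 1 / 2 * N n) / lam" for n
    using m(2)[of "r n"] lam unfolding J N_def by (simp add: pos_le_divide_eq mult.commute)
  ultimately have "tv_norm m' \<le> (I + 0 - 1 / 2 * ?N') / lam"
    by (intro tv_norm_weak_limit_le[OF m(1) conv])
  then have "?J m' \<le> I"
    using lam unfolding J by (simp add: pos_le_divide_eq mult.commute)
  moreover have "I \<le> ?J n" if "n \<in> radon_measures" for n
    unfolding I_def by (rule cINF_lower[OF bdd that])
  ultimately show ?thesis
    using m' lam by (intro exI[of _ m']) (auto simp: P_solution_def intro: order_trans)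
qed

text \<open>Comparison with the competitor m0, whose residual is exactly the noise.\<close>

lemma P_solution_objective_bounds:
  assumes lam: "lam > 0" and sol: "P_solution \<phi> lam (\<lambda>t. Phi \<phi> m0 t + w t) m" and m0: "m0 \<in> radon_measures"
  shows "1 / 2 * (L2_norm (\<lambda>t. Phi \<phi> m t - (Phi \<phi> m0 t + w t)))\<^sup>2 + lam * tv_norm m
    \<le> 1 / 2 * (L2_norm w)\<^sup>2 + lam * tv_norm m0"
proof -
  have "P_objective \<phi> lam (\<lambda>t. Phi \<phi> m0 t + w t) m \<le> P_objective \<phi> lam (\<lambda>t. Phi \<phi> m0 t + w t) m0"
    using sol lam m0 by (simp add: P_solution_def)
  moreover have "L2_norm (\<lambda>t. Phi \<phi> m0 t - (Phi \<phi> m0 t + w t)) = L2_norm w"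
    using L2_norm_scale[of "-1" w] by simp
  ultimately show ?thesis by (simp add: P_objective_def)
qed

lemma P0_feasible_of_L2_norm_zero:
  assumes "continuous_on UNIV \<phi>" "m \<in> radon_measures" "y \<in> L2" "L2_norm (\<lambda>t. Phi \<phi> m t - y t) = 0"
  shows "m \<in> P0_feasible \<phi> y"
  using assms(2,4) L2_norm_eq_0_iff[OF L2_diff[OF Phi_L2[OF assms(1,2)] assms(3)]]
  by (simp add: P0_feasible_def)

text \<open>There is no duality gap: along \<open>\<lambda> \<rightarrow> 0\<close> the solutions of the penalised problems have total variation
  at most the value of the dual problem and converge weakly to a feasible measure.\<close>

lemma strong_duality:
  assumes c: "continuous_on UNIV \<phi>" and m0: "m0 \<in> radon_measures" and p0: "D0_solution \<phi> (Phi \<phi> m0) p0"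
  shows "\<exists>m\<in>P0_feasible \<phi> (Phi \<phi> m0). tv_norm m \<le> L2_inner (Phi \<phi> m0) p0"
proof -
  let ?y = "Phi \<phi> m0"
  have y: "?y \<in> L2" by (rule Phi_L2[OF c m0])
  define lam where "lam n = inverse (real (Suc n))" for n
  have lam: "lam n > 0" for n by (simp add: lam_def)
  have lam0: "lam \<longlonglongrightarrow> 0" unfolding lam_def by (rule LIMSEQ_inverse_real_of_nat)
  obtain m where sol: "\<And>n. P_solution \<phi> (lam n) ?y (m n)"
    using P_solution_exists[OF c y lam] by metis
  have m: "m n \<in> radon_measures" for n using sol[of n] lam[of n] by (simp add: P_solution_def)
  let ?v = "L2_inner ?y p0"
  have tv: "tv_norm (m n) \<le> ?v" for n
  proof -
    define p where "p = (\<lambda>t. (1 / lam n) * (?y t - Phi \<phi> (m n) t))"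
    have p: "p \<in> D0_feasible \<phi>" "signed_integral (m n) (Phi_adj \<phi> p) = tv_norm (m n)"
      using P_solution_dual[OF c y lam sol] unfolding p_def by auto
    have pL: "p \<in> L2" using p(1) by (simp add: D0_feasible_iff)
    have "Phi \<phi> (m n) = (\<lambda>t. ?y t - lam n * p t)"
      using lam[of n] by (simp add: p_def)
    \<comment> \<open>By saturation the norm is the pairing of \<open>Phi \<phi> (m n)\<close> with
      p. The quadratic term only lowers it, so the dual value bounds all these norms at
      once.\<close>
    then have "tv_norm (m n) = L2_inner ?y p - lam n * L2_inner p p"
      using p(2) Phi_adjoint[OF c pL m, of n] L2_inner_diff[OF y L2_scale[OF pL] pL, of "lam n"]
        L2_inner_scale[OF pL pL] by simp
    also have "\<dots> \<le> L2_inner ?y p" using lam[of n] by simp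
    also have "\<dots> \<le> ?v" using p0 p(1) by (simp add: D0_solution_def)
    finally show ?thesis .
  qed
  have resid: "(L2_norm (\<lambda>t. Phi \<phi> (m n) t - ?y t))\<^sup>2 \<le> 2 * lam n * tv_norm m0" for n
  proof -
    have "1 / 2 * (L2_norm (\<lambda>t. Phi \<phi> (m n) t - ?y t))\<^sup>2 + lam n * tv_norm (m n)
        \<le> 1 / 2 * (L2_norm (\<lambda>t. 0))\<^sup>2 + lam n * tv_norm m0"
      using P_solution_objective_bounds[OF lam _ m0, of \<phi> n "\<lambda>t. 0" "m n"] sol[of n] by simp
    moreover have "0 \<le> lam n * tv_norm (m n)"
      using lam[of n] tv_norm_nonneg[OF m] by simp
    moreover have "L2_norm (\<lambda>t. 0) = 0" by (simp add: L2_norm_def L2_inner_def)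
    ultimately show ?thesis by simp
  qed
  obtain r m' where r: "strict_mono r" and m': "m' \<in> radon_measures"
    and "\<forall>f. continuous_on UNIV f \<longrightarrow> (\<lambda>n. signed_integral (m (r n)) f) \<longlonglongrightarrow> signed_integral m' f"
    using radon_weak_compact[of m, OF m tv] by (elim exE conjE)
  then have conv: "continuous_on UNIV f \<Longrightarrow>
      (\<lambda>n. signed_integral (m (r n)) f) \<longlonglongrightarrow> signed_integral m' f" for f by blast
  have "(\<lambda>n. (L2_norm (\<lambda>t. Phi \<phi> (m (r n)) t - ?y t))\<^sup>2) \<longlonglongrightarrow> (L2_norm (\<lambda>t. Phi \<phi> m' t - ?y t))\<^sup>2"
    by (intro tendsto_power Phi_weak_limit[OF c y m m' tv conv])
  moreover have "(\<lambda>n. 2 * lam (r n) * tv_norm m0) \<longlonglongrightarrow> 2 * 0 * tv_norm m0"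
    using LIMSEQ_subseq_LIMSEQ[OF lam0 r] by (intro tendsto_intros) (simp add: o_def)
  ultimately have "(L2_norm (\<lambda>t. Phi \<phi> m' t - ?y t))\<^sup>2 \<le> 2 * 0 * tv_norm m0"
    using resid by (intro LIMSEQ_le) auto
  then have "m' \<in> P0_feasible \<phi> ?y"
    by (intro P0_feasible_of_L2_norm_zero[OF c m' y]) simp
  moreover have "tv_norm m' \<le> ?v"
    using tv by (intro tv_norm_weak_limit_le[OF m conv _ tendsto_const])
  ultimately show ?thesis by blast
qed

text \<open>The noise-free counterpart of \<open>P_solution_dual\<close>: weak duality bounds the
  pairing by the norm, and the absence of a gap gives the converse.\<close>

lemma P0_solution_saturates:
  assumes c: "continuous_on UNIV \<phi>" and m0: "m0 \<in> radon_measures" and p0: "D0_solution \<phi> (Phi \<phi> m0) p0"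
    and sol: "P_solution \<phi> 0 (Phi \<phi> m0) m"
  shows "signed_integral m (Phi_adj \<phi> p0) = tv_norm m"
proof -
  have m: "m \<in> radon_measures" and eq: "AE t in haar. Phi \<phi> m t = Phi \<phi> m0 t"
    and opt: "\<And>n. n \<in> P0_feasible \<phi> (Phi \<phi> m0) \<Longrightarrow> tv_norm m \<le> tv_norm n"
    using sol by (auto simp: P_solution_def P0_feasible_def)
  have p0f: "p0 \<in> D0_feasible \<phi>" using p0 by (simp add: D0_solution_def)
  then have p0L: "p0 \<in> L2" by (simp add: D0_feasible_iff)
  have "L2_inner (Phi \<phi> m) p0 = L2_inner (Phi \<phi> m0) p0"
    unfolding L2_inner_def
  proof (rule integral_cong_AE)
    show "(\<lambda>x. Phi \<phi> m x * p0 x) \<in> borel_measurable haar" "(\<lambda>x. Phi \<phi> m0 x * p0 x) \<in> borel_measurable haar"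
      using L2_mult_integrable[OF Phi_L2[OF c] p0L] m m0 by auto
    show "AE x in haar. Phi \<phi> m x * p0 x = Phi \<phi> m0 x * p0 x" using eq by eventually_elim simp
  qed
  moreover have "tv_norm m \<le> L2_inner (Phi \<phi> m0) p0"
    using strong_duality[OF c m0 p0] opt by (meson order_trans)
  ultimately show ?thesis
    using D0_feasible_inner_le[OF c p0f m] Phi_adjoint[OF c p0L m] by simp
qed

section \<open>Local structure of the solutions\<close>

lemma saturation_point_deriv_zero:
  assumes \<eta>: "circle_differentiable \<eta>" and b: "\<And>x. \<bar>\<eta> x\<bar> \<le> 1" and z: "\<bar>\<eta> z\<bar> = 1"
  shows "circle_deriv \<eta> z = 0"
proof -
  have D: "DERIV (\<lambda>s. \<eta> (z + circ s)) 0 :> circle_deriv \<eta> z"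
    using circle_differentiable_DERIV[OF \<eta>, of z 0] by (simp add: circ_0)
  have b': "\<eta> x \<le> 1" "- 1 \<le> \<eta> x" for x using b[of x] by (auto simp: abs_le_iff)
  from z consider "\<eta> z = 1" | "\<eta> z = - 1" by (auto simp: abs_if split: if_splits)
  then show ?thesis
  proof cases
    case 1
    then show ?thesis using b' by (intro DERIV_local_max[OF D, of 1]) (auto simp: circ_0)
  next
    case 2
    then show ?thesis using b' by (intro DERIV_local_min[OF D, of 1]) (auto simp: circ_0)
  qed
qed

text \<open>Two saturation points are critical points of \<open>\<eta>\<close>, so \<open>\<eta>''\<close> vanishes in between.\<close>

lemma saturation_point_unique:
  assumes \<eta>: "circle_differentiable \<eta>" "circle_differentiable (circle_deriv \<eta>)"
    and b: "\<And>x. \<bar>\<eta> x\<bar> \<le> 1"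
    and nz: "\<And>z. z \<in> arc_around x \<epsilon> \<Longrightarrow> circle_deriv (circle_deriv \<eta>) z \<noteq> 0"
    and z: "z1 \<in> arc_around x \<epsilon>" "z2 \<in> arc_around x \<epsilon>" "\<bar>\<eta> z1\<bar> = 1" "\<bar>\<eta> z2\<bar> = 1"
  shows "z1 = z2"
proof -
  have no: False if s: "- \<epsilon> < s1" "s1 < s2" "s2 < \<epsilon>" "\<bar>\<eta> (x + circ s1)\<bar> = 1" "\<bar>\<eta> (x + circ s2)\<bar> = 1" for s1 s2
  proof -
    have "\<exists>s>s1. s < s2 \<and> circle_deriv \<eta> (x + circ s2) - circle_deriv \<eta> (x + circ s1)
        = (s2 - s1) * circle_deriv (circle_deriv \<eta>) (x + circ s)"
      by (rule MVT2[OF s(2)]) (rule circle_differentiable_DERIV[OF \<eta>(2)])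
    then obtain s where "s1 < s" "s < s2" "circle_deriv (circle_deriv \<eta>) (x + circ s) = 0"
      using saturation_point_deriv_zero[OF \<eta>(1) b] s by auto
    moreover have "x + circ s \<in> arc_around x \<epsilon>"
      using \<open>s1 < s\<close> \<open>s < s2\<close> s by (auto simp: arc_around_def)
    ultimately show False using nz by blast
  qed
  obtain s1 s2 where s: "- \<epsilon> < s1" "s1 < \<epsilon>" "- \<epsilon> < s2" "s2 < \<epsilon>" "z1 = x + circ s1" "z2 = x + circ s2"
    using z(1,2) by (auto simp: arc_around_def)
  then have "\<not> s1 < s2" "\<not> s2 < s1" using no[of s1 s2] no[of s2 s1] z by auto
  then show ?thesis using s by simp
qed

lemma arc_around_sets [simp]: "arc_around x \<epsilon> \<in> sets borel"
  by (simp add: arc_around_eq_ball)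

text \<open>m is carried by the points where \<eta> is 1 or -1, and the curvature leaves at most one
  of them in the arc. Since \<eta> has the sign s there, only one Jordan part can charge that point,
  which fixes the sign of the coefficient.\<close>

lemma restrict_radon_dirac:
  assumes m: "m \<in> radon_measures" and \<epsilon>: "\<epsilon> > 0"
    and \<eta>: "circle_differentiable \<eta>" "circle_differentiable (circle_deriv \<eta>)" "\<And>x. \<bar>\<eta> x\<bar> \<le> 1"
    and sat: "signed_integral m \<eta> = tv_norm m"
    and nz: "\<And>z. z \<in> arc_around x \<epsilon> \<Longrightarrow> circle_deriv (circle_deriv \<eta>) z \<noteq> 0"
    and s: "\<bar>s\<bar> = 1" "\<And>z. z \<in> arc_around x \<epsilon> \<Longrightarrow> s * \<eta> z > 0"
  shows "restrict_radon m (arc_around x \<epsilon>) = null_radon \<or>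
    (\<exists>a z. z \<in> arc_around x \<epsilon> \<and> sgn a = s \<and> restrict_radon m (arc_around x \<epsilon>) = scaled_dirac a z)"
proof -
  let ?I = "arc_around x \<epsilon>"
  note ae = tv_norm_saturated[OF m circle_differentiable_continuous[OF \<eta>(1)] \<eta>(3) sat]
  \<comment> \<open>Without a saturation point in the arc the centre serves as z; it then has mass
    0.\<close>
  obtain z where z: "z \<in> ?I" "\<And>u. u \<in> ?I \<Longrightarrow> \<bar>\<eta> u\<bar> = 1 \<Longrightarrow> u = z"
  proof (cases "\<exists>u\<in>?I. \<bar>\<eta> u\<bar> = 1")
    case True
    then show ?thesis using that saturation_point_unique[OF \<eta> nz] by metis
  next
    case False
    have "x \<in> ?I" using \<epsilon> by (simp add: arc_around_eq_ball)
    then show ?thesis using that[of x] False by blast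
  qed
  interpret p: finite_measure "pos_part m" by (simp add: m)
  interpret n: finite_measure "neg_part m" by (simp add: m)
  have mI: "m (A \<inter> ?I) = m (A \<inter> {z})" if A: "A \<in> sets borel" for A
  proof -
    have "measure (pos_part m) (A \<inter> ?I) = measure (pos_part m) (A \<inter> {z})"
    proof (rule p.finite_measure_eq_AE)
      show "AE u in pos_part m. u \<in> A \<inter> ?I \<longleftrightarrow> u \<in> A \<inter> {z}"
        using ae(1)
      proof eventually_elim
        case (elim u)
        then have "u \<in> ?I \<Longrightarrow> u = z" using z(2)[of u] by simp
        then show ?case using z(1) by blast
      qed
    qed (use A in auto)
    moreover have "measure (neg_part m) (A \<inter> ?I) = measure (neg_part m) (A \<inter> {z})"
    proof (rule n.finite_measure_eq_AE)
      show "AE u in neg_part m. u \<in> A \<inter> ?I \<longleftrightarrow> u \<in> A \<inter> {z}"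
        using ae(2)
      proof eventually_elim
        case (elim u)
        then have "u \<in> ?I \<Longrightarrow> u = z" using z(2)[of u] by simp
        then show ?case using z(1) by blast
      qed
    qed (use A in auto)
    ultimately show ?thesis using radon_Jordan[OF m] by simp
  qed
  have "A \<inter> {z} = (if z \<in> A then {z} else {})" for A by auto
  then have restr: "restrict_radon m ?I = scaled_dirac (m {z}) z"
    using mI m by (auto simp: restrict_radon_def scaled_dirac_def fun_eq_iff)
  have pos: "\<eta> z = 1" if "measure (pos_part m) {z} > 0"
  proof (rule ccontr)
    assume ne: "\<eta> z \<noteq> 1"
    have "AE u in pos_part m. u \<in> {z} \<longleftrightarrow> u \<in> {}" using ae(1) by eventually_elim (use ne in auto)
    then have "measure (pos_part m) {z} = measure (pos_part m) {}"
      by (intro p.finite_measure_eq_AE) auto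
    then show False using that by simp
  qed
  have neg: "\<eta> z = - 1" if "measure (neg_part m) {z} > 0"
  proof (rule ccontr)
    assume ne: "\<eta> z \<noteq> - 1"
    have "AE u in neg_part m. u \<in> {z} \<longleftrightarrow> u \<in> {}" using ae(2) by eventually_elim (use ne in auto)
    then have "measure (neg_part m) {z} = measure (neg_part m) {}"
      by (intro n.finite_measure_eq_AE) auto
    then show False using that by simp
  qed
  have dec: "m {z} = measure (pos_part m) {z} - measure (neg_part m) {z}" by (rule radon_Jordan[OF m])
  have s_cases: "s = 1 \<or> s = - 1" using s(1) by (auto simp: abs_if split: if_splits)
  consider "m {z} = 0" | "m {z} > 0" | "m {z} < 0" by linarith
  then show ?thesis
  proof cases
    case 1
    then have "restrict_radon m ?I = null_radon"
      by (simp add: restr scaled_dirac_def null_radon_def fun_eq_iff)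
    then show ?thesis by blast
  next
    case 2
    then have "measure (pos_part m) {z} > 0"
      using dec measure_nonneg[of "neg_part m" "{z}"] by linarith
    then have "s = 1" using pos s(2)[OF z(1)] s_cases by auto
    then show ?thesis using 2 restr z(1) by (intro disjI2 exI[of _ "m {z}"] exI[of _ z]) simp
  next
    case 3
    then have "measure (neg_part m) {z} > 0"
      using dec measure_nonneg[of "pos_part m" "{z}"] by linarith
    then have "s = - 1" using neg s(2)[OF z(1)] s_cases by auto
    then show ?thesis using 3 restr z(1) by (intro disjI2 exI[of _ "m {z}"] exI[of _ z]) simp
  qed
qed

text \<open>The certificate keeps its sign and the sign of its curvature near \<open>x\<close>, uniformly in the dual variable.\<close>

lemma certificate_stable:
  assumes \<phi>: "C2_circle \<phi>" and p0: "p0 \<in> L2"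
    and s: "\<bar>Phi_adj \<phi> p0 x\<bar> = 1" and nz: "circle_deriv (circle_deriv (Phi_adj \<phi> p0)) x \<noteq> 0"
  shows "\<exists>\<epsilon>0>0. \<exists>\<delta>>0. \<forall>p\<in>L2. \<forall>z\<in>arc_around x \<epsilon>0. L2_norm (\<lambda>t. p t - p0 t) \<le> \<delta> \<longrightarrow>
    Phi_adj \<phi> p0 x * Phi_adj \<phi> p z > 0 \<and> circle_deriv (circle_deriv (Phi_adj \<phi> p)) z \<noteq> 0"
proof -
  note cont = C2_circle_continuous[OF \<phi>]
  let ?\<phi>2 = "circle_deriv (circle_deriv \<phi>)"
  define c where "c = \<bar>Phi_adj ?\<phi>2 p0 x\<bar>"
  have c: "c > 0" using nz Phi_adj_deriv2(3)[OF \<phi> p0] by (simp add: c_def)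
  obtain B where B: "B > 0" "\<And>x. \<bar>\<phi> x\<bar> \<le> B" using continuous_circle_bounded[OF cont(1)] by blast
  obtain B2 where B2: "B2 > 0" "\<And>x. \<bar>?\<phi>2 x\<bar> \<le> B2" using continuous_circle_bounded[OF cont(3)] by blast
  obtain d1 where d1: "d1 > 0" "\<And>u v. dist u v < d1 \<Longrightarrow> \<bar>Phi_adj \<phi> p0 u - Phi_adj \<phi> p0 v\<bar> < 1 / 2"
    using continuous_circle_uniform[OF continuous_Phi_adj[OF cont(1) p0], of "1/2"] by auto
  obtain d2 where d2: "d2 > 0" "\<And>u v. dist u v < d2 \<Longrightarrow> \<bar>Phi_adj ?\<phi>2 p0 u - Phi_adj ?\<phi>2 p0 v\<bar> < c / 2"
    using continuous_circle_uniform[OF continuous_Phi_adj[OF cont(3) p0], of "c/2"] c by auto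
  \<comment> \<open>The change of p contributes at most 1/4 to the value and c/4 to the curvature,
    the passage from x to z less than 1/2 and c/2. The totals stay below 1 and c, so neither
    quantity can reach 0.\<close>
  define \<delta> where "\<delta> = min (1 / (4 * B)) (c / (4 * B2))"
  have \<delta>: "\<delta> > 0" "B * \<delta> \<le> 1 / 4" "B2 * \<delta> \<le> c / 4"
  proof -
    show "\<delta> > 0" using B(1) B2(1) c by (simp add: \<delta>_def)
    have "B * \<delta> \<le> B * (1 / (4 * B))" using B(1) by (intro mult_left_mono) (auto simp: \<delta>_def)
    then show "B * \<delta> \<le> 1 / 4" using B(1) by simp
    have "B2 * \<delta> \<le> B2 * (c / (4 * B2))" using B2(1) by (intro mult_left_mono) (auto simp: \<delta>_def)
    then show "B2 * \<delta> \<le> c / 4" using B2(1) by simp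
  qed
  have "Phi_adj \<phi> p0 x * Phi_adj \<phi> p z > 0 \<and> circle_deriv (circle_deriv (Phi_adj \<phi> p)) z \<noteq> 0"
    if p: "p \<in> L2" and z: "z \<in> arc_around x (min d1 d2)" and close: "L2_norm (\<lambda>t. p t - p0 t) \<le> \<delta>"
    for p z
  proof
    have dz: "dist x z < d1" "dist x z < d2" using z by (auto simp: arc_around_eq_ball)
    have "\<bar>Phi_adj \<phi> p z - Phi_adj \<phi> p0 z\<bar> \<le> B * L2_norm (\<lambda>t. p t - p0 t)"
      by (rule Phi_adj_diff_bound[OF cont(1) B(2) p p0])
    also have "\<dots> \<le> B * \<delta>" using close B(1) by (intro mult_left_mono) auto
    finally have 1: "\<bar>Phi_adj \<phi> p z - Phi_adj \<phi> p0 z\<bar> \<le> 1 / 4" using \<delta>(2) by linarith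
    have "\<bar>Phi_adj ?\<phi>2 p z - Phi_adj ?\<phi>2 p0 z\<bar> \<le> B2 * L2_norm (\<lambda>t. p t - p0 t)"
      by (rule Phi_adj_diff_bound[OF cont(3) B2(2) p p0])
    also have "\<dots> \<le> B2 * \<delta>" using close B2(1) by (intro mult_left_mono) auto
    finally have 2: "\<bar>Phi_adj ?\<phi>2 p z - Phi_adj ?\<phi>2 p0 z\<bar> \<le> c / 4" using \<delta>(3) by linarith
    have "\<bar>Phi_adj \<phi> p z - Phi_adj \<phi> p0 x\<bar> < 1"
      using 1 d1(2)[OF dz(1)] by linarith
    then show "Phi_adj \<phi> p0 x * Phi_adj \<phi> p z > 0"
      using s by (cases "Phi_adj \<phi> p0 x \<ge> 0") (auto simp: abs_if split: if_splits)
    have "Phi_adj ?\<phi>2 p z \<noteq> 0"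
      using 2 d2(2)[OF dz(2)] c unfolding c_def by linarith
    then show "circle_deriv (circle_deriv (Phi_adj \<phi> p)) z \<noteq> 0"
      by (simp add: Phi_adj_deriv2(3)[OF \<phi> p])
  qed
  moreover have "min d1 d2 > 0" using d1(1) d2(1) by simp
  ultimately show ?thesis using \<delta>(1) by blast
qed

section \<open>Persistence of the spike for identifiable measures\<close>

lemma restrict_radon_zero:
  assumes "restrict_radon m I = null_radon" "A \<in> sets borel" "A \<subseteq> I"
  shows "m A = 0"
  using fun_cong[OF assms(1), of A] assms(2,3)
  by (simp add: restrict_radon_def null_radon_def Int_absorb2)

lemma total_variation_zero:
  assumes m: "m \<in> radon_measures" and I: "I \<in> sets borel"
    and null: "\<And>A. A \<in> sets borel \<Longrightarrow> A \<subseteq> I \<Longrightarrow> m A = 0"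
  shows "total_variation m I = 0"
proof -
  obtain P where P: "P \<in> sets borel"
    "\<And>A. A \<in> sets borel \<Longrightarrow> measure (pos_part m) A = m (A \<inter> P)"
    "\<And>A. A \<in> sets borel \<Longrightarrow> measure (neg_part m) A = - m (A - P)"
    using radon_Jordan_Hahn[OF m] by metis
  show ?thesis
    using I P(1) null[of "I \<inter> P"] null[of "I - P"] by (simp add: total_variation_def P(2,3))
qed

lemma signed_integral_zero:
  assumes m: "m \<in> radon_measures" and I: "I \<in> sets borel"
    and null: "\<And>A. A \<in> sets borel \<Longrightarrow> A \<subseteq> I \<Longrightarrow> m A = 0"
    and f: "\<And>x. x \<notin> I \<Longrightarrow> f x = 0"
  shows "signed_integral m f = 0"
proof -
  have z: "measure (pos_part m) I = 0" "measure (neg_part m) I = 0"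
    using total_variation_zero[OF m I null] measure_nonneg[of "pos_part m" I] measure_nonneg[of "neg_part m" I]
    unfolding total_variation_def by linarith+
  have "AE x in M. f x = 0" if "finite_measure M" "sets M = sets borel" "measure M I = 0" for M
  proof (rule AE_I[of _ _ I])
    interpret finite_measure M by fact
    show "emeasure M I = 0" using that(3) by (simp add: emeasure_eq_measure)
  qed (use f I that in auto)
  then show ?thesis
    using z m by (simp add: signed_integral_def integral_eq_zero_AE)
qed

text \<open>If null restrictions persisted as \<lambda> \<rightarrow> 0, a weak limit would solve
  the noise-free problem and so be m0, and m0 would annihilate a bump supported on the arc. The
  hypothesis that m0 restricts to 0 or to one spike excludes cancellation in that integral.\<close>

lemma identifiable_not_null:
  assumes c: "continuous_on UNIV \<phi>" and m0: "m0 \<in> radon_measures" and id: "identifiable \<phi> m0"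
    and \<epsilon>: "\<epsilon> > 0" and \<alpha>: "\<alpha> > 0"
    and tv: "total_variation m0 (arc_around x \<epsilon>) \<noteq> 0"
    and dirac: "restrict_radon m0 (arc_around x \<epsilon>) = null_radon \<or>
      (\<exists>a z. z \<in> arc_around x \<epsilon> \<and> sgn a = s \<and> restrict_radon m0 (arc_around x \<epsilon>) = scaled_dirac a z)"
    and s: "s \<noteq> 0"
  shows "\<exists>l1>0. \<forall>lam w m. 0 < lam \<longrightarrow> lam \<le> l1 \<longrightarrow> w \<in> L2 \<longrightarrow> L2_norm w \<le> \<alpha> * lam \<longrightarrow>
    P_solution \<phi> lam (\<lambda>t. Phi \<phi> m0 t + w t) m \<longrightarrow> restrict_radon m (arc_around x \<epsilon>) \<noteq> null_radon"
proof (rule ccontr)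
  let ?I = "arc_around x \<epsilon>"
  let ?y = "Phi \<phi> m0"
  let ?T = "tv_norm m0"
  assume "\<not> ?thesis"
  then have "\<exists>lam w m. 0 < lam \<and> lam \<le> l1 \<and> w \<in> L2 \<and> L2_norm w \<le> \<alpha> * lam \<and>
      P_solution \<phi> lam (\<lambda>t. ?y t + w t) m \<and> restrict_radon m ?I = null_radon" if "l1 > 0" for l1
    using that by blast
  then have "\<forall>n. \<exists>lam w m. 0 < lam \<and> lam \<le> inverse (real (Suc n)) \<and> w \<in> L2 \<and> L2_norm w \<le> \<alpha> * lam \<and>
      P_solution \<phi> lam (\<lambda>t. ?y t + w t) m \<and> restrict_radon m ?I = null_radon"
    by simp
  then obtain lam w m where lam: "\<And>n. 0 < lam n" "\<And>n. lam n \<le> inverse (real (Suc n))"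
    and w: "\<And>n. w n \<in> L2" "\<And>n. L2_norm (w n) \<le> \<alpha> * lam n"
    and sol: "\<And>n. P_solution \<phi> (lam n) (\<lambda>t. ?y t + w n t) (m n)"
    and null: "\<And>n. restrict_radon (m n) ?I = null_radon"
    unfolding choice_iff by blast
  have y: "?y \<in> L2" by (rule Phi_L2[OF c m0])
  have m: "m n \<in> radon_measures" for n using sol[of n] lam(1)[of n] by (simp add: P_solution_def)
  have T: "?T \<ge> 0" by (rule tv_norm_nonneg[OF m0])
  have lam0: "lam \<longlonglongrightarrow> 0"
    using lam less_imp_le[OF lam(1)]
    by (intro tendsto_sandwich[OF _ _ tendsto_const LIMSEQ_inverse_real_of_nat] always_eventually allI)
  \<comment> \<open>The noise enters through its squared norm, of order lam squared. One factor lam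
    can be cancelled and the excess over \<open>tv_norm m0\<close> still tends to 0.\<close>
  have obj: "1 / 2 * (L2_norm (\<lambda>t. Phi \<phi> (m n) t - (?y t + w n t)))\<^sup>2 + lam n * tv_norm (m n)
      \<le> lam n * (\<alpha>\<^sup>2 / 2 * lam n + ?T)" for n
  proof -
    have "(L2_norm (w n))\<^sup>2 \<le> (\<alpha> * lam n)\<^sup>2" using w(2) by (intro power_mono) auto
    then show ?thesis
      using P_solution_objective_bounds[OF lam(1) sol m0, of n]
      by (simp add: power2_eq_square algebra_simps)
  qed
  define t where "t n = \<alpha>\<^sup>2 / 2 * lam n + ?T" for n
  have tv_t: "tv_norm (m n) \<le> t n" for n
  proof -
    have "0 \<le> 1 / 2 * (L2_norm (\<lambda>t. Phi \<phi> (m n) t - (?y t + w n t)))\<^sup>2" by simp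
    then have "lam n * tv_norm (m n) \<le> lam n * t n" using obj[of n] unfolding t_def by linarith
    then show ?thesis using lam(1)[of n] by simp
  qed
  have t_lim: "t \<longlonglongrightarrow> \<alpha>\<^sup>2 / 2 * 0 + ?T" unfolding t_def by (intro tendsto_intros lam0)
  have tv_R: "tv_norm (m n) \<le> \<alpha>\<^sup>2 / 2 + ?T" for n
  proof -
    have "inverse (real (Suc n)) \<le> 1" by (simp add: inverse_le_1_iff)
    then have "\<alpha>\<^sup>2 / 2 * lam n \<le> \<alpha>\<^sup>2 / 2 * 1" using lam(2)[of n] by (intro mult_left_mono) auto
    then show ?thesis using tv_t[of n] by (simp add: t_def)
  qed
  have resid: "L2_norm (\<lambda>t. Phi \<phi> (m n) t - ?y t) \<le> sqrt (2 * (lam n * t n)) + \<alpha> * lam n" for n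
  proof -
    let ?r = "\<lambda>t. Phi \<phi> (m n) t - (?y t + w n t)"
    have rL: "?r \<in> L2" by (intro L2_diff L2_add Phi_L2 c m m0 w)
    have "L2_norm (\<lambda>t. Phi \<phi> (m n) t - ?y t) = L2_norm (\<lambda>t. ?r t + w n t)"
      by (simp add: algebra_simps)
    also have "\<dots> \<le> L2_norm ?r + L2_norm (w n)" by (rule L2_norm_add_le[OF rL w(1)])
    also have "L2_norm ?r \<le> sqrt (2 * (lam n * t n))"
    proof (rule real_le_rsqrt)
      have "0 \<le> lam n * tv_norm (m n)" using lam(1)[of n] tv_norm_nonneg[OF m] by simp
      then show "(L2_norm ?r)\<^sup>2 \<le> 2 * (lam n * t n)" using obj[of n] unfolding t_def by linarith
    qed
    finally show ?thesis using w(2)[of n] by simp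
  qed
  obtain r m' where r: "strict_mono r" and m': "m' \<in> radon_measures"
    and "\<forall>f. continuous_on UNIV f \<longrightarrow> (\<lambda>n. signed_integral (m (r n)) f) \<longlonglongrightarrow> signed_integral m' f"
    using radon_weak_compact[of m, OF m tv_R] by (elim exE conjE)
  then have conv: "continuous_on UNIV f \<Longrightarrow>
      (\<lambda>n. signed_integral (m (r n)) f) \<longlonglongrightarrow> signed_integral m' f" for f by blast
  have "(\<lambda>n. L2_norm (\<lambda>t. Phi \<phi> (m (r n)) t - ?y t)) \<longlonglongrightarrow> L2_norm (\<lambda>t. Phi \<phi> m' t - ?y t)"
    by (rule Phi_weak_limit[OF c y m m' tv_R conv])
  moreover have "(\<lambda>n. sqrt (2 * (lam n * t n)) + \<alpha> * lam n) \<longlonglongrightarrow> sqrt (2 * (0 * (\<alpha>\<^sup>2 / 2 * 0 + ?T))) + \<alpha> * 0"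
    by (intro tendsto_intros lam0 t_lim)
  then have "(\<lambda>n. sqrt (2 * (lam (r n) * t (r n))) + \<alpha> * lam (r n)) \<longlonglongrightarrow> 0"
    using LIMSEQ_subseq_LIMSEQ[OF _ r] by (fastforce simp: o_def)
  ultimately have "L2_norm (\<lambda>t. Phi \<phi> m' t - ?y t) \<le> 0"
    using resid by (intro LIMSEQ_le) auto
  then have feas: "m' \<in> P0_feasible \<phi> ?y"
    using L2_norm_nonneg[of "\<lambda>t. Phi \<phi> m' t - ?y t"]
    by (intro P0_feasible_of_L2_norm_zero[OF c m' y]) linarith
  have "tv_norm m' \<le> \<alpha>\<^sup>2 / 2 * 0 + ?T"
    using LIMSEQ_subseq_LIMSEQ[OF t_lim r] tv_t
    by (intro tv_norm_weak_limit_le[OF m conv, where t="\<lambda>n. t (r n)"]) (auto simp: o_def)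
  then have "tv_norm m' \<le> ?T" by simp
  moreover have m0_sol: "P_solution \<phi> 0 ?y m0" using id by (simp add: identifiable_def)
  ultimately have "P_solution \<phi> 0 ?y m'"
    using feas by (auto simp: P_solution_def intro: order_trans)
  then have m'_eq: "m' = m0" using id by (simp add: identifiable_def)
  \<comment> \<open>A continuous tent that is positive exactly on the arc.\<close>
  define \<psi> where "\<psi> z = max 0 (\<epsilon> - dist x z)" for z
  have \<psi>: "continuous_on UNIV \<psi>"
    unfolding \<psi>_def by (intro continuous_intros)
  have \<psi>0: "\<psi> z = 0" if "z \<notin> ?I" for z
    using that by (simp add: \<psi>_def arc_around_eq_ball)
  have "signed_integral (m n) \<psi> = 0" for n
    by (rule signed_integral_zero[OF m arc_around_sets restrict_radon_zero[OF null] \<psi>0])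
  then have si0: "signed_integral m0 \<psi> = 0"
    using conv[OF \<psi>] by (simp add: m'_eq LIMSEQ_const_iff)
  from dirac show False
  proof
    assume "restrict_radon m0 ?I = null_radon"
    from total_variation_zero[OF m0 arc_around_sets restrict_radon_zero[OF this]] show False
      using tv by blast
  next
    assume "\<exists>a z. z \<in> ?I \<and> sgn a = s \<and> restrict_radon m0 ?I = scaled_dirac a z"
    then obtain a z where z: "z \<in> ?I" and a: "sgn a = s" and eq: "restrict_radon m0 ?I = scaled_dirac a z"
      by blast
    \<comment> \<open>m0 minus its spike vanishes on all Borel subsets of the arc, so the integral
      of the bump against m0 is that of the spike alone.\<close>
    let ?n = "\<lambda>A. 1 * m0 A + (- 1) * scaled_dirac a z A"
    have "?n A = 0" if "A \<in> sets borel" "A \<subseteq> ?I" for A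
      using fun_cong[OF eq, of A] that by (simp add: restrict_radon_def Int_absorb2)
    then have "signed_integral ?n \<psi> = 0"
      by (intro signed_integral_zero[OF radon_linear[OF m0 scaled_dirac_radon] arc_around_sets _ \<psi>0])
    moreover obtain B where B: "\<And>x. \<bar>\<psi> x\<bar> \<le> B" using continuous_circle_bounded[OF \<psi>] by blast
    note b = borel_measurable_continuous_onI[OF \<psi>]
    have "signed_integral ?n \<psi> = signed_integral m0 \<psi> - a * \<psi> z"
      using signed_integral_linear[OF m0 scaled_dirac_radon b B, of 1 "-1" a z]
        signed_integral_scaled_dirac[OF b B, of a z] by simp
    moreover have "\<psi> z > 0" using z by (simp add: \<psi>_def arc_around_eq_ball)
    moreover have "a \<noteq> 0" using a s by auto
    ultimately show False using si0 by simp
  qed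
qed

text \<open>At \<lambda> = 0 the noise has norm 0 and thus vanishes only almost everywhere, so the
  data agree as classes but not as functions.\<close>

lemma P_solution_0_cong:
  assumes "AE t in haar. y t = y' t"
  shows "P_solution \<phi> 0 y m \<longleftrightarrow> P_solution \<phi> 0 y' m"
proof -
  have "(AE t in haar. Phi \<phi> n t = y t) \<longleftrightarrow> (AE t in haar. Phi \<phi> n t = y' t)" for n
  proof
    show "AE t in haar. Phi \<phi> n t = y' t" if "AE t in haar. Phi \<phi> n t = y t"
      using that assms by eventually_elim simp
    show "AE t in haar. Phi \<phi> n t = y t" if "AE t in haar. Phi \<phi> n t = y' t"
      using that assms by eventually_elim simp
  qed
  then have "P0_feasible \<phi> y = P0_feasible \<phi> y'" by (simp add: P0_feasible_def)
  then show ?thesis by (simp add: P_solution_def)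
qed

theorem lemma2:
  fixes \<phi> :: "circle \<Rightarrow> real"
    and m0 :: "circle set \<Rightarrow> real"
    and y0 \<eta>0 :: "circle \<Rightarrow> real"
    and x :: circle
  assumes "C2_circle \<phi>"
    and "m0 \<in> radon_measures"
    and "y0 = Phi \<phi> m0"
    and "\<exists>p. D0_solution \<phi> y0 p"
    and "\<eta>0 = min_norm_certificate \<phi> y0"
    and "x \<in> extended_support \<phi> m0"
    and "circle_deriv (circle_deriv \<eta>0) x \<noteq> 0"
  shows "\<exists>\<epsilon>0>0. \<forall>\<epsilon>. 0 < \<epsilon> \<and> \<epsilon> < \<epsilon>0 \<longrightarrow>
    (\<exists>\<alpha>>0. \<exists>lam0>0. \<forall>(lam, w)\<in>noise_domain \<alpha> lam0. \<forall>m.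
      P_solution \<phi> lam (\<lambda>t. y0 t + w t) m \<longrightarrow>
        (restrict_radon m (arc_around x \<epsilon>) = null_radon \<or>
         (\<exists>a z. z \<in> arc_around x \<epsilon> \<and> sgn a = \<eta>0 x \<and>
            restrict_radon m (arc_around x \<epsilon>) = scaled_dirac a z)) \<and>
        (identifiable \<phi> m0 \<and> total_variation m0 (arc_around x \<epsilon>) \<noteq> 0 \<longrightarrow>
         restrict_radon m (arc_around x \<epsilon>) \<noteq> null_radon \<and>
         (\<exists>a z. z \<in> arc_around x \<epsilon> \<and> sgn a = \<eta>0 x \<and>
            restrict_radon m (arc_around x \<epsilon>) = scaled_dirac a z)))"
proof -
  note \<phi> = assms(1) and m0 = assms(2)
  note c = C2_circle_continuous(1)[OF \<phi>]
  have y0: "y0 \<in> L2" using Phi_L2[OF c m0] assms(3) by simp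
  \<comment> \<open>The same choice term as in \<open>min_norm_certificate\<close>, so that the
    certificate is literally the adjoint applied to this p0.\<close>
  define p0 where "p0 = (SOME p. D0_min_norm_solution \<phi> y0 p)"
  have p0: "D0_min_norm_solution \<phi> y0 p0"
    unfolding p0_def using assms(4) D0_min_norm_exists[OF c y0] by (metis someI_ex)
  have \<eta>0: "\<eta>0 = Phi_adj \<phi> p0"
    by (simp add: assms(5) min_norm_certificate_def p0_def)
  have p0_sol: "D0_solution \<phi> y0 p0" using p0 by (simp add: D0_min_norm_solution_def)
  then have p0f: "p0 \<in> D0_feasible \<phi>" by (simp add: D0_solution_def)
  then have p0L: "p0 \<in> L2" by (simp add: D0_feasible_iff)
  have s: "\<bar>\<eta>0 x\<bar> = 1"
    using assms(3,5,6) by (auto simp: extended_support_def)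
  obtain \<epsilon>0 \<delta> where \<epsilon>0: "\<epsilon>0 > 0" and \<delta>: "\<delta> > 0"
    and stable: "\<And>p z. p \<in> L2 \<Longrightarrow> z \<in> arc_around x \<epsilon>0 \<Longrightarrow> L2_norm (\<lambda>t. p t - p0 t) \<le> \<delta> \<Longrightarrow>
      \<eta>0 x * Phi_adj \<phi> p z > 0 \<and> circle_deriv (circle_deriv (Phi_adj \<phi> p)) z \<noteq> 0"
    using certificate_stable[OF \<phi> p0L s[unfolded \<eta>0] assms(7)[unfolded \<eta>0]] unfolding \<eta>0 by blast
  \<comment> \<open>These constants come from \<delta> alone and serve all radii \<epsilon> below
    \<epsilon>0.\<close>
  obtain \<alpha> l0 where \<alpha>: "\<alpha> > 0" and l0: "l0 > 0"
    and close: "\<forall>lam w p. 0 < lam \<and> lam \<le> l0 \<and> w \<in> L2 \<and> L2_norm w \<le> \<alpha> * lam \<and> p \<in> D0_feasible \<phi> \<and>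
      L2_inner (\<lambda>x. (y0 x + w x) - lam * p x) p0 \<le> L2_inner (\<lambda>x. (y0 x + w x) - lam * p x) p \<longrightarrow>
      L2_norm (\<lambda>x. p x - p0 x) \<le> \<delta>"
    using dual_convergence[OF c y0 p0 \<delta>] by (elim exE conjE)
  let ?concl = "\<lambda>\<epsilon> m. restrict_radon m (arc_around x \<epsilon>) = null_radon \<or>
    (\<exists>a z. z \<in> arc_around x \<epsilon> \<and> sgn a = \<eta>0 x \<and> restrict_radon m (arc_around x \<epsilon>) = scaled_dirac a z)"
  have local_structure: "?concl \<epsilon> m"
    if m: "m \<in> radon_measures" and \<epsilon>: "0 < \<epsilon>" "\<epsilon> < \<epsilon>0" and p: "p \<in> D0_feasible \<phi>"
      and sat: "signed_integral m (Phi_adj \<phi> p) = tv_norm m" and pd: "L2_norm (\<lambda>t. p t - p0 t) \<le> \<delta>"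
    for \<epsilon> m p
  proof -
    have pL: "p \<in> L2" and b: "\<And>t. \<bar>Phi_adj \<phi> p t\<bar> \<le> 1" using p by (auto simp: D0_feasible_iff)
    have "z \<in> arc_around x \<epsilon>0" if "z \<in> arc_around x \<epsilon>" for z
      using that \<epsilon> by (simp add: arc_around_eq_ball)
    then show ?thesis
      using stable[OF pL _ pd]
      by (intro restrict_radon_dirac[OF m \<epsilon>(1) Phi_adj_deriv2(1,2)[OF \<phi> pL] b sat _ s]) auto
  qed
  have noise_free: "?concl \<epsilon> m" if "P_solution \<phi> 0 y0 m" and \<epsilon>: "0 < \<epsilon>" "\<epsilon> < \<epsilon>0" for \<epsilon> m
  proof (rule local_structure[OF _ \<epsilon> p0f])
    show "m \<in> radon_measures" using that(1) by (simp add: P_solution_def P0_feasible_def)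
    show "signed_integral m (Phi_adj \<phi> p0) = tv_norm m"
      using P0_solution_saturates[OF c m0] p0_sol that(1) unfolding assms(3) by blast
    show "L2_norm (\<lambda>t. p0 t - p0 t) \<le> \<delta>" using \<delta> by (simp add: L2_norm_def L2_inner_def)
  qed
  have noisy: "?concl \<epsilon> m"
    if sol: "P_solution \<phi> lam (\<lambda>t. y0 t + w t) m" and lam: "0 < lam" "lam \<le> l0"
      and w: "w \<in> L2" "L2_norm w \<le> \<alpha> * lam" and \<epsilon>: "0 < \<epsilon>" "\<epsilon> < \<epsilon>0" for \<epsilon> lam w m
  proof -
    define p where "p = (\<lambda>t. (1 / lam) * ((y0 t + w t) - Phi \<phi> m t))"
    have p: "p \<in> D0_feasible \<phi>" and sat: "signed_integral m (Phi_adj \<phi> p) = tv_norm m"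
      using P_solution_dual[OF c L2_add[OF y0 w(1)] lam(1) sol] unfolding p_def by auto
    have m: "m \<in> radon_measures" using sol lam(1) by (simp add: P_solution_def)
    \<comment> \<open>This turns the inequality required by \<open>close\<close> into weak duality
      at p0 together with saturation at p.\<close>
    have "(\<lambda>t. (y0 t + w t) - lam * p t) = Phi \<phi> m"
      using lam(1) by (simp add: p_def)
    moreover have "L2_inner (Phi \<phi> m) p = tv_norm m"
      using Phi_adjoint[OF c _ m] p sat by (simp add: D0_feasible_iff)
    ultimately have "L2_norm (\<lambda>t. p t - p0 t) \<le> \<delta>"
      using D0_feasible_inner_le[OF c p0f m] close[rule_format, of lam w p] lam w p by simp
    then show ?thesis by (rule local_structure[OF m \<epsilon> p sat])
  qed
  show ?thesis
  proof (rule exI[of _ \<epsilon>0], rule conjI[OF \<epsilon>0], intro allI impI)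
    fix \<epsilon> assume \<epsilon>: "0 < \<epsilon> \<and> \<epsilon> < \<epsilon>0"
    let ?hyp = "identifiable \<phi> m0 \<and> total_variation m0 (arc_around x \<epsilon>) \<noteq> 0"
    have m0_sol: "P_solution \<phi> 0 y0 m0" if ?hyp
      using that assms(3) by (simp add: identifiable_def)
    \<comment> \<open>The extra hypothesis stays inside the existential, so that one bound on lam
      can be fixed in either case.\<close>
    have "\<exists>l1>0. ?hyp \<longrightarrow> (\<forall>lam w m. 0 < lam \<longrightarrow> lam \<le> l1 \<longrightarrow> w \<in> L2 \<longrightarrow> L2_norm w \<le> \<alpha> * lam \<longrightarrow>
      P_solution \<phi> lam (\<lambda>t. y0 t + w t) m \<longrightarrow> restrict_radon m (arc_around x \<epsilon>) \<noteq> null_radon)"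
    proof (cases ?hyp)
      case True
      then show ?thesis
        using identifiable_not_null[OF c m0 _ _ \<alpha> _ noise_free[OF m0_sol]] \<epsilon> s
        unfolding assms(3) by auto
    next
      case False
      then show ?thesis by (intro exI[of _ 1]) auto
    qed
    then obtain l1 where l1: "l1 > 0" and persist: "\<And>lam w m. ?hyp \<Longrightarrow> 0 < lam \<Longrightarrow> lam \<le> l1 \<Longrightarrow> w \<in> L2 \<Longrightarrow>
      L2_norm w \<le> \<alpha> * lam \<Longrightarrow> P_solution \<phi> lam (\<lambda>t. y0 t + w t) m \<Longrightarrow>
      restrict_radon m (arc_around x \<epsilon>) \<noteq> null_radon" by blast
    have first: "?concl \<epsilon> m" and second: "?hyp \<Longrightarrow> restrict_radon m (arc_around x \<epsilon>) \<noteq> null_radon"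
      if dom: "(lam, w) \<in> noise_domain \<alpha> (min l0 l1)" and sol: "P_solution \<phi> lam (\<lambda>t. y0 t + w t) m"
      for lam w m
    proof -
      have lam: "0 \<le> lam" "lam \<le> l0" "lam \<le> l1" and w: "w \<in> L2" "L2_norm w \<le> \<alpha> * lam"
        using dom by (auto simp: noise_domain_def)
      have zero: "P_solution \<phi> 0 y0 m" if "lam = 0"
      proof -
        have "AE t in haar. w t = 0"
          using w that L2_norm_nonneg[of w] L2_norm_eq_0_iff[OF w(1)] by simp
        then have "AE t in haar. y0 t + w t = y0 t" by eventually_elim simp
        from P_solution_0_cong[OF this] show ?thesis using sol that by simp
      qed
      show "?concl \<epsilon> m"
        using noise_free[OF zero] noisy[OF sol _ lam(2) w] \<epsilon> lam(1) by (cases "lam = 0") auto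
      show "restrict_radon m (arc_around x \<epsilon>) \<noteq> null_radon" if h: ?hyp
      proof (cases "lam = 0")
        case True
        then have "m = m0" using zero h assms(3) by (simp add: identifiable_def)
        then show ?thesis
          using h total_variation_zero[OF m0 arc_around_sets restrict_radon_zero[of m0 "arc_around x \<epsilon>"]] by blast
      next
        case False
        then show ?thesis using persist[OF h _ lam(3) w sol] lam(1) by simp
      qed
    qed
    show "\<exists>\<alpha>>0. \<exists>lam0>0. \<forall>(lam, w)\<in>noise_domain \<alpha> lam0. \<forall>m.
      P_solution \<phi> lam (\<lambda>t. y0 t + w t) m \<longrightarrow> ?concl \<epsilon> m \<and>
        (?hyp \<longrightarrow> restrict_radon m (arc_around x \<epsilon>) \<noteq> null_radon \<and>
         (\<exists>a z. z \<in> arc_around x \<epsilon> \<and> sgn a = \<eta>0 x \<and>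
            restrict_radon m (arc_around x \<epsilon>) = scaled_dirac a z))"
    proof (rule exI[of _ \<alpha>], intro conjI \<alpha>, rule exI[of _ "min l0 l1"], intro conjI ballI)
      show "min l0 l1 > 0" using l0 l1 by simp
      show "case lw of (lam, w) \<Rightarrow> \<forall>m. P_solution \<phi> lam (\<lambda>t. y0 t + w t) m \<longrightarrow> ?concl \<epsilon> m \<and>
        (?hyp \<longrightarrow> restrict_radon m (arc_around x \<epsilon>) \<noteq> null_radon \<and>
         (\<exists>a z. z \<in> arc_around x \<epsilon> \<and> sgn a = \<eta>0 x \<and>
            restrict_radon m (arc_around x \<epsilon>) = scaled_dirac a z))"
        if dom: "lw \<in> noise_domain \<alpha> (min l0 l1)" for lw
      proof (cases lw)
        case (Pair lam w)
        show ?thesis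
          unfolding Pair case_prod_conv
          using first[OF dom[unfolded Pair]] second[OF dom[unfolded Pair]] by blast
      qed
    qed
  qed
qed

end
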